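(* Let $H:\mathbb{T}^n\times\mathbb{R}^n\times\mathbb{R}\to\mathbb{R}$ be continuous and satisfy: (A1) $p\mapsto H(x,p,\theta)$ is convex for every $(x,\theta)$; (A2) $\lim_{|p|\to\infty}H(x,p,\theta)/|p|=+\infty$ for every $(x,\theta)$; (A3) $\partial_\theta H(x,p,\theta)$ is continuous and non-negative everywhere. Let $\varepsilon>0$, let $c\in\mathcal{C}:=\{\overline H(0,\theta):\theta\in\mathbb{R}\}$ with $\overline H$ as in the context, and consider $$H\left(\tfrac{x}{\varepsilon},d_xu,u\right)=c,\quad x\in\varepsilon\mathbb{T}^n.\qquad (E_\varepsilon)$$ Let $\mathfrak{M}_-(\cdot)$ denote the set of ordinal Mather measures defined in the context. (i) Suppose $u_\varepsilon^1$ (resp. $u_\varepsilon^2$) is a solution (resp. subsolution) of $(E_\varepsilon)$ satisfying $$\int_{\varepsilon\mathbb{T}^n\times\mathbb{R}^n}u_\varepsilon^1(x)\,d\mu(x,v)\ge\int_{\varepsilon\mathbb{T}^n\times\mathbb{R}^n}u_\varepsilon^2(x)\,d\mu(x,v)\qquad\forall\,\mu\in\mathfrak{M}_-(u_\varepsilon^1).$$ Then $u_\varepsilon^1\ge u_\varepsilon^2$. (ii) If $u_\varepsilon^1$ is a solution of $(E_\varepsilon)$ with $\mathfrak{M}_-(u_\varepsilon^1)=\varnothing$, then $u_\varepsilon^1$ is the unique solution (on $\varepsilon\mathbb{T}^n$) of $(E_\varepsilon)$. (iii) If $u_\varepsilon$ is a solution of $(E_\varepsilon)$ and $w_\varepsilon$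 is a strict subsolution of $(E_\varepsilon)$, i.e. $H\left(\frac{x}{\varepsilon},d_xw_\varepsilon,w_\varepsilon\right)<c$ in the viscosity sense, then $w_\varepsilon\le u_\varepsilon$. (iv) Let $I(c):=\{\theta\in\mathbb{R}:\overline H(0,\theta)=c\}$. If $\sup I(c)<\infty$, then there is a continuous supersolution $\nu_\varepsilon$ of $(E_\varepsilon)$ which is not less than any solution $u_\varepsilon$ of $(E_\varepsilon)$.
   Context: $\mathbb{T}^n=\mathbb{R}^n/\mathbb{Z}^n$ and $\varepsilon\mathbb{T}^n=\mathbb{R}^n/\varepsilon\mathbb{Z}^n$. Solutions, subsolutions and supersolutions are continuous functions on $\varepsilon\mathbb{T}^n$ and are understood in the viscosity sense. $d_xu$ denotes the gradient. Effective Hamiltonian: for $(p,\theta)\in\mathbb{R}^n\times\mathbb{R}$, $\overline H(p,\theta)$ is the unique real number for which $H(x,p+d_xu,\theta)=\overline H(p,\theta)$, $x\in\mathbb{T}^n$, admits a continuous viscosity solution on $\mathbb{T}^n$. Lagrangian: $L(x,v,u):=\max_{p\in\mathbb{R}^n}\big(\langle p,v\rangle-H(x,p,u)\big)$, and $\partial_uL$ is its partial derivative in the last variable. Mather measures: a Borel probability measure $\mu$ on $\varepsilon\mathbb{T}^n\times\mathbb{R}^n$ (the tangent bundle of $\varepsilon\mathbb{T}^n$) is holonomic if $\int|v|\,d\mu<\infty$ and $\int\langle d_x\phi,v\rangle\,d\mu=0$ for all $\phi\in C^1(\varepsilon\mathbb{T}^n)$. For $\phi_\varepsilon\in C(\varepsilon\mathbb{T}^n,\mathbb{R})$,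 a Mather measure associated with $\phi_\varepsilon$ is a holonomic measure minimizing $\mu\mapsto\int L\left(\frac{x}{\varepsilon},v,\phi_\varepsilon(x)\right)d\mu(x,v)$ among holonomic measures. An ordinal Mather measure associated with $\phi_\varepsilon$ is a Mather measure $\mu$ associated with $\phi_\varepsilon$ such that $\int\partial_uL\left(\frac{x}{\varepsilon},v,\phi_\varepsilon(x)\right)d\mu(x,v)=0$. The set of these is $\mathfrak{M}_-(\phi_\varepsilon)$.
   Formalization: ∂_uL is read as the right partial derivative, since L need not be differentiable in u under (A1)–(A3); a strict subsolution in (iii) means H ≤ c−δ in the viscosity sense for some δ>0, as the pointwise strict inequality makes (iii) false. *)

theory Defs
  imports "HOL-Probability.Probability"
begin

section \<open>The torus of side \<open>\<epsilon>\<close>\<close>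

text \<open>A point of the torus is a coset \<open>x + \<epsilon> \<int>\<^sup>n\<close>, represented as a set of vectors; the torus carries
  the quotient topology. Functions on the torus are total functions on sets of vectors, of which
  only the values at cosets matter.\<close>

definition coset :: "real \<Rightarrow> real ^ 'n \<Rightarrow> (real ^ 'n) set" where
  "coset \<epsilon> x = {x + \<epsilon> *\<^sub>R k | k. \<forall>i. k $ i \<in> \<int>}"

definition torus :: "real \<Rightarrow> (real ^ 'n) set topology" where
  "torus \<epsilon> = topology (\<lambda>U. U \<subseteq> range (coset \<epsilon>) \<and> open (coset \<epsilon> -` U))"

text \<open>The map \<open>x \<mapsto> x / \<epsilon>\<close> from the torus of side \<open>\<epsilon>\<close> to the unit torus.\<close>

definition rescale :: "real \<Rightarrow> (real ^ 'n) set \<Rightarrow> (real ^ 'n) set" where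
  "rescale \<epsilon> X = (\<lambda>x. x /\<^sub>R \<epsilon>) ` X"

lemma openin_torus:
  fixes U :: "(real ^ 'n) set set"
  shows "openin (torus \<epsilon>) U \<longleftrightarrow> U \<subseteq> range (coset \<epsilon>) \<and> open (coset \<epsilon> -` U)"
proof -
  have "istopology (\<lambda>U :: (real ^ 'n) set set. U \<subseteq> range (coset \<epsilon>) \<and> open (coset \<epsilon> -` U))"
    unfolding istopology_def by (auto simp: vimage_Int vimage_Union)
  then show ?thesis
    by (simp add: torus_def topology_inverse')
qed

lemma topspace_torus: "topspace (torus \<epsilon>) = range (coset \<epsilon>)"
proof -
  have "openin (torus \<epsilon>) (range (coset \<epsilon>))"
    by (simp add: openin_torus vimage_def)
  then show ?thesis
    by (metis openin_torus openin_subset openin_topspace subset_antisym)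
qed

lemma quotient_map_coset: "quotient_map euclidean (torus \<epsilon>) (coset \<epsilon>)"
  unfolding quotient_map_def by (auto simp: topspace_torus openin_torus vimage_def)

lemma rescale_coset:
  assumes "\<epsilon> > 0"
  shows "rescale \<epsilon> (coset \<epsilon> x) = coset 1 (x /\<^sub>R \<epsilon>)"
  using assms unfolding rescale_def coset_def
  by (force simp: image_def scaleR_add_right)

text \<open>\<open>torus_C1 \<epsilon> \<phi> d\<phi>\<close>: the function \<open>\<phi>\<close> is of class \<open>C\<^sup>1\<close> on the torus, with gradient \<open>d\<phi>\<close>.\<close>

definition torus_C1 ::
    "real \<Rightarrow> ((real ^ 'n) set \<Rightarrow> real) \<Rightarrow> ((real ^ 'n) set \<Rightarrow> real ^ 'n) \<Rightarrow> bool" where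
  "torus_C1 \<epsilon> \<phi> d\<phi> \<longleftrightarrow>
     (\<forall>x. GDERIV (\<lambda>y. \<phi> (coset \<epsilon> y)) x :> d\<phi> (coset \<epsilon> x)) \<and>
     continuous_map (torus \<epsilon>) euclidean d\<phi>"


section \<open>Viscosity solutions\<close>

text \<open>Continuous viscosity sub- and supersolutions on the torus of side \<open>\<epsilon>\<close> of
  \<open>F(x, d\<^sub>xu, u) = c\<close>.\<close>

definition visc_subsolution ::
    "real \<Rightarrow> ((real ^ 'n) set \<Rightarrow> real ^ 'n \<Rightarrow> real \<Rightarrow> real) \<Rightarrow> real
      \<Rightarrow> ((real ^ 'n) set \<Rightarrow> real) \<Rightarrow> bool" where
  "visc_subsolution \<epsilon> F c u \<longleftrightarrow>
     continuous_map (torus \<epsilon>) euclideanreal u \<and>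
     (\<forall>\<phi> d\<phi> X U. torus_C1 \<epsilon> \<phi> d\<phi> \<and> openin (torus \<epsilon>) U \<and> X \<in> U \<and>
        (\<forall>Y\<in>U. u Y - \<phi> Y \<le> u X - \<phi> X) \<longrightarrow> F X (d\<phi> X) (u X) \<le> c)"

definition visc_supersolution ::
    "real \<Rightarrow> ((real ^ 'n) set \<Rightarrow> real ^ 'n \<Rightarrow> real \<Rightarrow> real) \<Rightarrow> real
      \<Rightarrow> ((real ^ 'n) set \<Rightarrow> real) \<Rightarrow> bool" where
  "visc_supersolution \<epsilon> F c u \<longleftrightarrow>
     continuous_map (torus \<epsilon>) euclideanreal u \<and>
     (\<forall>\<phi> d\<phi> X U. torus_C1 \<epsilon> \<phi> d\<phi> \<and> openin (torus \<epsilon>) U \<and> X \<in> U \<and>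
        (\<forall>Y\<in>U. u X - \<phi> X \<le> u Y - \<phi> Y) \<longrightarrow> c \<le> F X (d\<phi> X) (u X))"

definition visc_solution ::
    "real \<Rightarrow> ((real ^ 'n) set \<Rightarrow> real ^ 'n \<Rightarrow> real \<Rightarrow> real) \<Rightarrow> real
      \<Rightarrow> ((real ^ 'n) set \<Rightarrow> real) \<Rightarrow> bool" where
  "visc_solution \<epsilon> F c u \<longleftrightarrow> visc_subsolution \<epsilon> F c u \<and> visc_supersolution \<epsilon> F c u"

text \<open>Strictness is uniform over the (compact) torus: \<open>F(x, d\<^sub>xw, w) \<le> c - \<delta>\<close> in the viscosity sense
  for some \<open>\<delta> > 0\<close>. Requiring only \<open>F(x, d\<phi>(x), w(x)) < c\<close> at each touching point would be weaker,
  since it says nothing at points where no test function touches \<open>w\<close> from above, such as a convex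
  kink; when \<open>F\<close> is not strictly convex in the gradient, comparison fails for that notion.\<close>

definition visc_strict_subsolution ::
    "real \<Rightarrow> ((real ^ 'n) set \<Rightarrow> real ^ 'n \<Rightarrow> real \<Rightarrow> real) \<Rightarrow> real
      \<Rightarrow> ((real ^ 'n) set \<Rightarrow> real) \<Rightarrow> bool" where
  "visc_strict_subsolution \<epsilon> F c w \<longleftrightarrow> (\<exists>\<delta>>0. visc_subsolution \<epsilon> F (c - \<delta>) w)"


section \<open>Hamiltonian and Lagrangian\<close>

text \<open>A Hamiltonian \<open>H x p \<theta>\<close> takes its first argument in the unit torus.\<close>

definition eps_hamiltonian ::
    "real \<Rightarrow> ((real ^ 'n) set \<Rightarrow> real ^ 'n \<Rightarrow> real \<Rightarrow> real)
      \<Rightarrow> (real ^ 'n) set \<Rightarrow> real ^ 'n \<Rightarrow> real \<Rightarrow> real" where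
  "eps_hamiltonian \<epsilon> H = (\<lambda>X p \<theta>. H (rescale \<epsilon> X) p \<theta>)"

definition effective_hamiltonian ::
    "((real ^ 'n) set \<Rightarrow> real ^ 'n \<Rightarrow> real \<Rightarrow> real) \<Rightarrow> real ^ 'n \<Rightarrow> real \<Rightarrow> real" where
  "effective_hamiltonian H p \<theta> = (THE a. \<exists>u. visc_solution 1 (\<lambda>X q _. H X (p + q) \<theta>) a u)"

definition lagrangian ::
    "((real ^ 'n) set \<Rightarrow> real ^ 'n \<Rightarrow> real \<Rightarrow> real)
      \<Rightarrow> (real ^ 'n) set \<Rightarrow> real ^ 'n \<Rightarrow> real \<Rightarrow> real" where
  "lagrangian H X v \<theta> = (SUP p. p \<bullet> v - H X p \<theta>)"

text \<open>The partial derivative of the Lagrangian in its last variable. Unless \<open>H\<close> is strictly convex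
  in \<open>p\<close>, the two-sided derivative need not exist. The right derivative always exists when \<open>H\<close> is
  continuous, superlinear in \<open>p\<close> and continuously differentiable in \<open>\<theta>\<close>, the Lagrangian being a
  maximum of functions of class \<open>C\<^sup>1\<close> in \<open>\<theta>\<close>, and it agrees with the two-sided derivative wherever
  the latter exists.\<close>

definition lagrangian_du ::
    "((real ^ 'n) set \<Rightarrow> real ^ 'n \<Rightarrow> real \<Rightarrow> real)
      \<Rightarrow> (real ^ 'n) set \<Rightarrow> real ^ 'n \<Rightarrow> real \<Rightarrow> real" where
  "lagrangian_du H X v \<theta> = vector_derivative (lagrangian H X v) (at_right \<theta>)"


section \<open>Mather measures\<close>

definition borel_of :: "'a topology \<Rightarrow> 'a measure" where
  "borel_of T = sigma (topspace T) {U. openin T U}"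

text \<open>The tangent bundle of the torus is trivial: torus times \<open>\<real>\<^sup>n\<close>.\<close>

definition holonomic :: "real \<Rightarrow> ((real ^ 'n) set \<times> (real ^ 'n)) measure \<Rightarrow> bool" where
  "holonomic \<epsilon> \<mu> \<longleftrightarrow>
     prob_space \<mu> \<and> sets \<mu> = sets (borel_of (prod_topology (torus \<epsilon>) euclidean)) \<and>
     integrable \<mu> (\<lambda>(X, v). norm v) \<and>
     (\<forall>\<phi> d\<phi>. torus_C1 \<epsilon> \<phi> d\<phi> \<longrightarrow> (\<integral>(X, v). d\<phi> X \<bullet> v \<partial>\<mu>) = 0)"

text \<open>The action integrand is bounded below, so its integral is \<open>+\<infinity>\<close> when it is not integrable;
  hence minimizers and competitors are restricted to measures of finite action.\<close>

definition mather_measure ::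
    "real \<Rightarrow> ((real ^ 'n) set \<Rightarrow> real ^ 'n \<Rightarrow> real \<Rightarrow> real) \<Rightarrow> ((real ^ 'n) set \<Rightarrow> real)
      \<Rightarrow> ((real ^ 'n) set \<times> (real ^ 'n)) measure \<Rightarrow> bool" where
  "mather_measure \<epsilon> H \<phi> \<mu> \<longleftrightarrow>
     holonomic \<epsilon> \<mu> \<and> integrable \<mu> (\<lambda>(X, v). lagrangian H (rescale \<epsilon> X) v (\<phi> X)) \<and>
     (\<forall>\<nu>. holonomic \<epsilon> \<nu> \<and> integrable \<nu> (\<lambda>(X, v). lagrangian H (rescale \<epsilon> X) v (\<phi> X)) \<longrightarrow>
        (\<integral>(X, v). lagrangian H (rescale \<epsilon> X) v (\<phi> X) \<partial>\<mu>)
          \<le> (\<integral>(X, v). lagrangian H (rescale \<epsilon> X) v (\<phi> X) \<partial>\<nu>))"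

definition ordinal_mather_measures ::
    "real \<Rightarrow> ((real ^ 'n) set \<Rightarrow> real ^ 'n \<Rightarrow> real \<Rightarrow> real) \<Rightarrow> ((real ^ 'n) set \<Rightarrow> real)
      \<Rightarrow> ((real ^ 'n) set \<times> (real ^ 'n)) measure set" where
  "ordinal_mather_measures \<epsilon> H \<phi> =
     {\<mu>. mather_measure \<epsilon> H \<phi> \<mu> \<and>
         integrable \<mu> (\<lambda>(X, v). lagrangian_du H (rescale \<epsilon> X) v (\<phi> X)) \<and>
         (\<integral>(X, v). lagrangian_du H (rescale \<epsilon> X) v (\<phi> X) \<partial>\<mu>) = 0}"

end

theory Submission
  imports Defs "HOL-Complex_Analysis.Great_Picard"
begin

text \<open>
  Let \<open>u\<close> be a solution and \<open>w\<close> a subsolution with \<open>M = max (w - u) > 0\<close>. Following the inf-convolution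
  of \<open>u\<close> backwards from a maximum point of \<open>w - u\<close>, with velocities dual to its supergradients, gives
  discrete curves that are almost calibrated for \<open>u\<close>. The sup-convolution of \<open>w\<close> decreases along them by
  at most the action with potential \<open>w\<close>, and \<open>L\<close> is antitone in \<open>u\<close>; hence \<open>w - u\<close> stays close to \<open>M\<close>.
  A limit \<open>\<mu>\<close> of occupation measures is holonomic, has action at most \<open>- c\<close>, and is concentrated where
  \<open>w = u + M\<close> and \<open>L(x, v, u) = L(x, v, w)\<close>. Every holonomic measure has action at least \<open>- c\<close>, by testing
  with mollified sup-convolutions, so \<open>\<mu>\<close> is a Mather measure for \<open>u\<close> and for \<open>w\<close>. As \<open>L\<close> is constant on
  \<open>[u, w]\<close>, the right derivatives of \<open>L\<close> at both endpoints vanish, so \<open>\<mu>\<close> is ordinal, while the integral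
  of \<open>w\<close> exceeds that of \<open>u\<close> by \<open>M\<close>. This contradicts the hypotheses of (i) and (ii).

  Part (iii) is comparison by doubling of variables. For (iv), choose \<open>\<theta>\<close> above \<open>sup I(c)\<close>: then the
  effective Hamiltonian at \<open>\<theta>\<close> exceeds \<open>c\<close>, and the rescaled solution of the cell problem at \<open>\<theta>\<close>,
  raised by a constant so as to lie above \<open>\<theta>\<close>, is a strict supersolution. Cell solutions come from
  Perron's method for the discounted equation as the discount vanishes.
\<close>

section \<open>The torus and periodic functions\<close>

text \<open>The Hamiltonian is merely continuous, and convex but not strictly so, in
  \<open>p\<close>: no flow is available and the maximizer in the Legendre transform need not be
  unique. So no calibrated curve is constructed. Chains with time step \<open>h\<close> suffice,
  because convolution makes \<open>u\<close> semiconcave and \<open>w\<close> semiconvex, so that a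
  step errs by a quadratic term in \<open>h\<close>, hence by a multiple of \<open>h\<close> over a
  fixed time. The parameters are fixed in the order horizon, tolerance, penalty, time step; the
  velocities stay in a ball independent of all four. That ball makes the occupation measures
  compactly supported, so their limit is tested on every continuous integrand, the action included.

  The delicate derivative is that at the upper endpoint: constancy of \<open>L\<close> on
  \<open>[u, w]\<close> says nothing to the right of \<open>w\<close>. But for a momentum that is
  maximal at \<open>w\<close>, the Hamiltonian itself is constant on \<open>[u, w]\<close>, and
  being differentiable in the unknown it has derivative zero at \<open>w\<close> from both sides.

  That the measure is ordinal for \<open>w\<close> too serves (ii): if the second solution is
  somewhere below the given one, the two exchange roles.\<close>

definition lattice :: "(real ^ 'n) set" where
  "lattice = {k. \<forall>i. k $ i \<in> \<int>}"

definition periodic :: "real \<Rightarrow> (real ^ 'n \<Rightarrow> 'b) \<Rightarrow> bool" where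
  "periodic \<epsilon> f \<longleftrightarrow> (\<forall>k\<in>lattice. \<forall>x. f (x + \<epsilon> *\<^sub>R k) = f x)"

lemma periodicD: "periodic \<epsilon> f \<Longrightarrow> k \<in> lattice \<Longrightarrow> f (x + \<epsilon> *\<^sub>R k) = f x"
  by (simp add: periodic_def)

lemma zero_in_lattice: "0 \<in> lattice"
  by (simp add: lattice_def)

lemma uminus_in_lattice: "k \<in> lattice \<Longrightarrow> - k \<in> lattice"
  by (simp add: lattice_def)

lemma coset_shift:
  assumes "k \<in> lattice" shows "coset \<epsilon> (x + \<epsilon> *\<^sub>R k) = coset \<epsilon> x"
proof -
  have "\<exists>k'. x + \<epsilon> *\<^sub>R k + \<epsilon> *\<^sub>R j = x + \<epsilon> *\<^sub>R k' \<and> (\<forall>i. k' $ i \<in> \<int>)" if "\<forall>i. j $ i \<in> \<int>" for j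
    using that assms by (intro exI[of _ "k + j"]) (auto simp: lattice_def scaleR_add_right)
  moreover have "\<exists>k'. x + \<epsilon> *\<^sub>R j = x + \<epsilon> *\<^sub>R k + \<epsilon> *\<^sub>R k' \<and> (\<forall>i. k' $ i \<in> \<int>)" if "\<forall>i. j $ i \<in> \<int>" for j
    using that assms by (intro exI[of _ "j - k"]) (auto simp: lattice_def scaleR_diff_right)
  ultimately show ?thesis unfolding coset_def by blast
qed

lemma mem_coset_self: "x \<in> coset \<epsilon> x"
  unfolding coset_def using zero_in_lattice by (force simp: lattice_def)

lemma coset_eqD:
  assumes "coset \<epsilon> x = coset \<epsilon> y" shows "\<exists>k\<in>lattice. y = x + \<epsilon> *\<^sub>R k"
  using mem_coset_self[of y \<epsilon>] unfolding assms[symmetric] by (auto simp: coset_def lattice_def)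

lemma periodic_coset: "periodic \<epsilon> (\<lambda>x. f (coset \<epsilon> x))"
  by (simp add: periodic_def coset_shift)

text \<open>Analysis takes place upstairs, with periodic functions of a vector; this is the way back
  to functions of cosets. Periodicity makes the chosen representative irrelevant.\<close>

lemma periodic_lift:
  fixes f :: "real ^ 'n \<Rightarrow> 'b"
  assumes "periodic \<epsilon> f" obtains \<phi> where "\<And>x. \<phi> (coset \<epsilon> x) = f x"
proof
  fix x :: "real ^ 'n"
  have "coset \<epsilon> (SOME y. coset \<epsilon> x = coset \<epsilon> y) = coset \<epsilon> x"
    by (metis (mono_tags, lifting) someI_ex)
  then show "(\<lambda>X. f (SOME y. X = coset \<epsilon> y)) (coset \<epsilon> x) = f x"
    using assms coset_eqD by (metis periodicD)
qed

text \<open>The cube is half-open: after division by \<open>\<epsilon>\<close> the coordinates are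
  less than 1, as \<open>schoenberg_surj\<close> demands of the points it reaches.\<close>

lemma fundamental_shift:
  fixes x :: "real ^ 'n"
  assumes "\<epsilon> > 0"
  obtains k where "k \<in> lattice" "\<And>i. 0 \<le> (x + \<epsilon> *\<^sub>R k) $ i" "\<And>i. (x + \<epsilon> *\<^sub>R k) $ i < \<epsilon>"
proof
  let ?k = "(\<chi> i. - of_int \<lfloor>x $ i / \<epsilon>\<rfloor>) :: real ^ 'n"
  show "?k \<in> lattice" by (simp add: lattice_def)
  fix i
  have "of_int \<lfloor>x $ i / \<epsilon>\<rfloor> \<le> x $ i / \<epsilon>" "x $ i / \<epsilon> < of_int \<lfloor>x $ i / \<epsilon>\<rfloor> + 1"
    by linarith+
  then have "of_int \<lfloor>x $ i / \<epsilon>\<rfloor> * \<epsilon> \<le> x $ i" "x $ i < (of_int \<lfloor>x $ i / \<epsilon>\<rfloor> + 1) * \<epsilon>"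
    using assms by (simp_all only: pos_le_divide_eq pos_divide_less_eq)
  then show "0 \<le> (x + \<epsilon> *\<^sub>R ?k) $ i" "(x + \<epsilon> *\<^sub>R ?k) $ i < \<epsilon>"
    by (simp_all add: algebra_simps)
qed

definition fundamental_box :: "real \<Rightarrow> (real ^ 'n) set" where
  "fundamental_box \<epsilon> = cbox 0 (\<chi> i. \<epsilon>)"

lemma compact_fundamental_box: "compact (fundamental_box \<epsilon>)"
  by (simp add: fundamental_box_def)

lemma fundamental_box_shift:
  fixes x :: "real ^ 'n"
  assumes "\<epsilon> > 0"
  obtains k where "k \<in> lattice" "x + \<epsilon> *\<^sub>R k \<in> fundamental_box \<epsilon>"
proof -
  obtain k where "k \<in> lattice" "\<And>i. 0 \<le> (x + \<epsilon> *\<^sub>R k) $ i" "\<And>i. (x + \<epsilon> *\<^sub>R k) $ i < \<epsilon>"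
    using fundamental_shift[OF assms] by blast
  then show ?thesis
    by (intro that[of k]) (auto simp: fundamental_box_def mem_box_cart less_imp_le)
qed

lemma continuous_map_torus:
  "continuous_map (torus \<epsilon>) euclidean f \<longleftrightarrow> continuous_on UNIV (\<lambda>x. f (coset \<epsilon> x))"
  using continuous_compose_quotient_map_eq[OF quotient_map_coset[of \<epsilon>], of euclidean f]
  by (simp add: o_def)

text \<open>The saturation of an open set is the union of its lattice translates, hence
  open.\<close>

lemma open_map_coset: "open_map euclidean (torus \<epsilon>) (coset \<epsilon>)"
proof (unfold open_map_def, intro allI impI)
  fix U :: "(real ^ 'a) set" assume "openin euclidean U"
  then have U: "open U" by simp
  have "coset \<epsilon> -` coset \<epsilon> ` U = (\<Union>k\<in>lattice. (+) (\<epsilon> *\<^sub>R k) ` U)"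
  proof (intro equalityI subsetI)
    fix x assume "x \<in> coset \<epsilon> -` coset \<epsilon> ` U"
    then obtain y where y: "y \<in> U" "coset \<epsilon> y = coset \<epsilon> x" by auto
    then obtain k where "k \<in> lattice" "x = y + \<epsilon> *\<^sub>R k" using coset_eqD by blast
    then show "x \<in> (\<Union>k\<in>lattice. (+) (\<epsilon> *\<^sub>R k) ` U)"
      using y by (auto simp: image_def add.commute)
  next
    fix x assume "x \<in> (\<Union>k\<in>lattice. (+) (\<epsilon> *\<^sub>R k) ` U)"
    then obtain k y where k: "k \<in> lattice" and y: "y \<in> U" "x = y + \<epsilon> *\<^sub>R k" by (auto simp: add.commute)
    then have "coset \<epsilon> x = coset \<epsilon> y" using coset_shift[OF k] by simp
    then show "x \<in> coset \<epsilon> -` coset \<epsilon> ` U" using y by auto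
  qed
  moreover have "open (\<Union>k\<in>lattice. (+) (\<epsilon> *\<^sub>R k) ` U)"
    by (intro open_UN ballI open_translation U)
  ultimately show "openin (torus \<epsilon>) (coset \<epsilon> ` U)"
    by (auto simp: openin_torus)
qed

lemma openin_coset_image: "open U \<Longrightarrow> openin (torus \<epsilon>) (coset \<epsilon> ` U)"
  using open_map_coset by (auto simp: open_map_def)

text \<open>A product of a quotient map with an identity need not be a quotient map in general. Here
  it is, because \<open>coset\<close> is open. This reduces continuity and measurability on the
  tangent bundle to continuity upstairs.\<close>

lemma quotient_map_coset_prod:
  "quotient_map euclidean (prod_topology (torus \<epsilon>) euclidean)
     (\<lambda>(x :: real ^ 'n, v :: 'b :: topological_space). (coset \<epsilon> x, v))"
  (is "quotient_map _ ?T ?f")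
proof (rule continuous_open_imp_quotient_map)
  have "continuous_map euclidean (torus \<epsilon>) (coset \<epsilon> \<circ> (fst :: (real ^ 'n) \<times> 'b \<Rightarrow> _))"
    by (rule continuous_map_compose[OF _ quotient_imp_continuous_map[OF quotient_map_coset]])
      (auto intro: continuous_on_fst continuous_on_id)
  moreover have "continuous_map euclidean euclidean (snd :: (real ^ 'n) \<times> 'b \<Rightarrow> 'b)"
    by (auto intro: continuous_on_snd continuous_on_id)
  ultimately show "continuous_map euclidean ?T ?f"
    by (simp add: continuous_map_pairwise o_def case_prod_beta)
  show "?f ` topspace euclidean = topspace ?T"
    by (auto simp: topspace_torus)
  show "open_map euclidean ?T ?f"
  proof (unfold open_map_def openin_prod_topology_alt, intro allI impI)
    fix U :: "((real ^ 'n) \<times> 'b) set" and X v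
    assume U: "openin euclidean U" and "(X, v) \<in> ?f ` U"
    then obtain x where x: "(x, v) \<in> U" "X = coset \<epsilon> x" by auto
    then obtain A B where AB: "open A" "open B" "(x, v) \<in> A \<times> B" "A \<times> B \<subseteq> U"
      using U by (metis open_openin open_prod_elim)
    show "\<exists>V W. openin (torus \<epsilon>) V \<and> openin euclidean W \<and> X \<in> V \<and> v \<in> W \<and>
              V \<times> W \<subseteq> ?f ` U"
      using AB x by (intro exI[of _ "coset \<epsilon> ` A"] exI[of _ B]) (auto simp: openin_coset_image)
  qed
qed

lemma continuous_map_torus_prod:
  "continuous_map (prod_topology (torus \<epsilon>) euclidean) euclidean g
     \<longleftrightarrow> continuous_on UNIV (\<lambda>(x, v). g (coset \<epsilon> x, v))"
  using continuous_compose_quotient_map_eq[OF quotient_map_coset_prod[of \<epsilon>], of euclidean g]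
  by (simp add: o_def case_prod_beta)

lemma periodic_attains_sup:
  fixes f :: "real ^ 'n \<Rightarrow> real"
  assumes "\<epsilon> > 0" "periodic \<epsilon> f" "continuous_on UNIV f"
  obtains x0 where "\<And>x. f x \<le> f x0"
proof -
  have "fundamental_box \<epsilon> \<noteq> ({} :: (real ^ 'n) set)"
    using fundamental_box_shift[OF assms(1)] by (metis empty_iff)
  then obtain x0 where x0: "\<And>x. x \<in> fundamental_box \<epsilon> \<Longrightarrow> f x \<le> f x0"
    using continuous_attains_sup[OF compact_fundamental_box _ continuous_on_subset[OF assms(3) subset_UNIV]]
    by blast
  show ?thesis
  proof
    fix x :: "real ^ 'n"
    obtain k where "k \<in> lattice" "x + \<epsilon> *\<^sub>R k \<in> fundamental_box \<epsilon>"
      using fundamental_box_shift[OF assms(1)] by blast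
    then show "f x \<le> f x0" using x0 periodicD[OF assms(2)] by metis
  qed
qed

lemma periodic_uniformly_continuous:
  fixes f :: "real ^ 'n \<Rightarrow> 'q::metric_space \<Rightarrow> 'c::metric_space"
  assumes "\<epsilon> > 0" "periodic \<epsilon> f" "continuous_on (UNIV \<times> Q) (\<lambda>(x, q). f x q)" "compact Q" "e > 0"
  obtains r where "r > 0" "\<And>x y q q'. norm (x - y) < r \<Longrightarrow> q \<in> Q \<Longrightarrow> q' \<in> Q \<Longrightarrow> dist q q' < r
     \<Longrightarrow> dist (f x q) (f y q') < e"
proof -
  \<comment> \<open>One period of margin on each side of the fundamental cube: a lattice vector
    moving \<open>x\<close> into the cube also moves every \<open>y\<close> within distance
    \<open>\<epsilon>\<close> of \<open>x\<close> into this box.\<close>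
  let ?C = "cbox (\<chi> i. - \<epsilon>) (\<chi> i. 2 * \<epsilon>) :: (real ^ 'n) set"
  have "uniformly_continuous_on (?C \<times> Q) (\<lambda>(x, q). f x q)"
    by (intro compact_uniformly_continuous continuous_on_subset[OF assms(3)] compact_Times compact_cbox assms)
      auto
  then obtain d where d: "d > 0" "\<And>x y q q'. x \<in> ?C \<Longrightarrow> y \<in> ?C \<Longrightarrow> q \<in> Q \<Longrightarrow> q' \<in> Q \<Longrightarrow>
      dist (x, q) (y, q') < d \<Longrightarrow> dist (f x q) (f y q') < e"
  proof -
    obtain d where "d > 0" "\<forall>z\<in>?C \<times> Q. \<forall>z'\<in>?C \<times> Q. dist z' z < d \<longrightarrow> dist (case z' of (x, q) \<Rightarrow> f x q) (case z of (x, q) \<Rightarrow> f x q) < e"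
      using \<open>uniformly_continuous_on (?C \<times> Q) _\<close> assms(5) unfolding uniformly_continuous_on_def by blast
    then show ?thesis by (intro that[of d]) auto
  qed
  define r where "r = min (d / 2) \<epsilon>"
  have "dist (f x q) (f y q') < e"
    if *: "norm (x - y) < r" "q \<in> Q" "q' \<in> Q" "dist q q' < r" for x y q q'
  proof -
    obtain k where k: "k \<in> lattice" "\<And>i. 0 \<le> (x + \<epsilon> *\<^sub>R k) $ i" "\<And>i. (x + \<epsilon> *\<^sub>R k) $ i < \<epsilon>"
      using fundamental_shift[OF assms(1)] by blast
    have n: "norm ((x + \<epsilon> *\<^sub>R k) - (y + \<epsilon> *\<^sub>R k)) < r" using * by simp
    have c: "\<bar>(x + \<epsilon> *\<^sub>R k) $ i - (y + \<epsilon> *\<^sub>R k) $ i\<bar> < \<epsilon>" for i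
      using component_le_norm_cart[of "(x + \<epsilon> *\<^sub>R k) - (y + \<epsilon> *\<^sub>R k)" i] n by (simp add: r_def)
    have "x + \<epsilon> *\<^sub>R k \<in> ?C"
      unfolding mem_box_cart
    proof (intro allI conjI)
      fix i
      show "(\<chi> i. - \<epsilon>) $ i \<le> (x + \<epsilon> *\<^sub>R k) $ i" "(x + \<epsilon> *\<^sub>R k) $ i \<le> (\<chi> i. 2 * \<epsilon>) $ i"
        using k(2,3)[of i] assms(1) by (auto simp del: vector_add_component vector_scaleR_component)
    qed
    moreover have "y + \<epsilon> *\<^sub>R k \<in> ?C"
      unfolding mem_box_cart
    proof (intro allI conjI)
      fix i
      show "(\<chi> i. - \<epsilon>) $ i \<le> (y + \<epsilon> *\<^sub>R k) $ i" "(y + \<epsilon> *\<^sub>R k) $ i \<le> (\<chi> i. 2 * \<epsilon>) $ i"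
        using c[of i] k(2,3)[of i] by (auto simp del: vector_add_component vector_scaleR_component)
    qed
    moreover have "dist (x + \<epsilon> *\<^sub>R k, q) (y + \<epsilon> *\<^sub>R k, q') < d"
    proof -
      have "dist (x + \<epsilon> *\<^sub>R k, q) (y + \<epsilon> *\<^sub>R k, q') \<le> dist (x + \<epsilon> *\<^sub>R k) (y + \<epsilon> *\<^sub>R k) + dist q q'"
        unfolding dist_prod_def by (simp add: sqrt_sum_squares_le_sum)
      also have "\<dots> < d" using n * by (simp add: dist_norm r_def)
      finally show ?thesis .
    qed
    ultimately show ?thesis
      using d(2)[of "x + \<epsilon> *\<^sub>R k" "y + \<epsilon> *\<^sub>R k" q q'] * k(1) periodicD[OF assms(2) k(1)] by simp
  qed
  moreover have "r > 0" using d(1) assms(1) by (simp add: r_def)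
  ultimately show ?thesis using that by blast
qed

lemma periodic_bounded:
  fixes f :: "real ^ 'n \<Rightarrow> 'q::metric_space \<Rightarrow> 'c::real_normed_vector"
  assumes "\<epsilon> > 0" "periodic \<epsilon> f" "continuous_on (UNIV \<times> Q) (\<lambda>(x, q). f x q)" "compact Q"
  obtains B where "B > 0" "\<And>x q. q \<in> Q \<Longrightarrow> norm (f x q) \<le> B"
proof -
  have K: "compact ((\<lambda>(x, q). f x q) ` (fundamental_box \<epsilon> \<times> Q))"
    by (intro compact_continuous_image continuous_on_subset[OF assms(3)] compact_Times
        compact_fundamental_box assms) auto
  obtain B where B: "B > 0" "\<And>x q. x \<in> fundamental_box \<epsilon> \<Longrightarrow> q \<in> Q \<Longrightarrow> norm (f x q) \<le> B"
  proof -
    obtain B where "B > 0" "\<forall>z\<in>(\<lambda>(x, q). f x q) ` (fundamental_box \<epsilon> \<times> Q). norm z \<le> B"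
      using compact_imp_bounded[OF K] by (simp only: bounded_pos) blast
    then show ?thesis by (intro that[of B]) auto
  qed
  show ?thesis
  proof
    fix x :: "real ^ 'n" and q assume "q \<in> Q"
    obtain k where "k \<in> lattice" "x + \<epsilon> *\<^sub>R k \<in> fundamental_box \<epsilon>"
      using fundamental_box_shift[OF assms(1)] by blast
    then show "norm (f x q) \<le> B" using B(2)[of "x + \<epsilon> *\<^sub>R k" q] periodicD[OF assms(2)] \<open>q \<in> Q\<close> by metis
  qed (rule B(1))
qed

lemma periodic_bounded1:
  fixes f :: "real ^ 'n \<Rightarrow> 'c::real_normed_vector"
  assumes "\<epsilon> > 0" "periodic \<epsilon> f" "continuous_on UNIV f"
  obtains B where "B > 0" "\<And>x. norm (f x) \<le> B"
proof -
  have "continuous_on (UNIV \<times> {0::real}) (\<lambda>(x, q). f x)"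
    unfolding case_prod_beta
    by (rule continuous_on_compose2[OF assms(3)]) (auto intro: continuous_on_fst continuous_on_id)
  then show ?thesis
    using periodic_bounded[OF assms(1), of "\<lambda>x q. f x" "{0::real}"] assms that
    by (auto simp: periodic_def)
qed

lemma periodic_uniformly_continuous1:
  fixes f :: "real ^ 'n \<Rightarrow> 'c::metric_space"
  assumes "\<epsilon> > 0" "periodic \<epsilon> f" "continuous_on UNIV f" "e > 0"
  obtains r where "r > 0" "\<And>x y. norm (x - y) < r \<Longrightarrow> dist (f x) (f y) < e"
proof -
  have "continuous_on (UNIV \<times> {0::real}) (\<lambda>(x, q). f x)"
    unfolding case_prod_beta
    by (rule continuous_on_compose2[OF assms(3)]) (auto intro: continuous_on_fst continuous_on_id)
  moreover have "periodic \<epsilon> (\<lambda>x (q :: real). f x)" using assms(2) by (simp add: periodic_def)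
  ultimately show ?thesis
  proof (rule_tac periodic_uniformly_continuous[of \<epsilon> "\<lambda>x (q :: real). f x" "{0}" e])
    fix r :: real
    assume r: "r > 0" "\<And>x y q q'. norm (x - y) < r \<Longrightarrow> q \<in> {0::real} \<Longrightarrow> q' \<in> {0} \<Longrightarrow> dist q q' < r
       \<Longrightarrow> dist (f x) (f y) < e"
    show thesis
    proof (rule that[OF r(1)])
      fix x y :: "real ^ 'n" assume "norm (x - y) < r"
      then show "dist (f x) (f y) < e" by (rule r(2)[of _ _ 0 0]) (use r(1) in simp_all)
    qed
  qed (use assms in simp_all)
qed

section \<open>The periodic penalty\<close>

text \<open>A smooth substitute for \<open>\<bar>z\<bar>\<^sup>2 / 2\<close> that descends to the torus, so that doubling of
  variables and sup-convolutions need no cut-off of test functions.\<close>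

definition pen :: "real \<Rightarrow> real ^ 'n \<Rightarrow> real" where
  "pen \<epsilon> z = (\<Sum>i\<in>UNIV. 1 - cos (2 * pi / \<epsilon> * z $ i)) * (\<epsilon> / (2 * pi))\<^sup>2"

definition dpen :: "real \<Rightarrow> real ^ 'n \<Rightarrow> real ^ 'n" where
  "dpen \<epsilon> z = (\<chi> i. sin (2 * pi / \<epsilon> * z $ i) * (\<epsilon> / (2 * pi)))"

lemma pen_nonneg: "0 \<le> pen \<epsilon> z"
  unfolding pen_def by (intro mult_nonneg_nonneg sum_nonneg) auto

lemma pen_0 [simp]: "pen \<epsilon> 0 = 0"
  by (simp add: pen_def)

lemma pen_uminus [simp]: "pen \<epsilon> (- z) = pen \<epsilon> z"
  by (simp add: pen_def)

lemma dpen_0 [simp]: "dpen \<epsilon> 0 = 0"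
  by (simp add: dpen_def vec_eq_iff)

lemma dpen_uminus [simp]: "dpen \<epsilon> (- z) = - dpen \<epsilon> z"
  by (simp add: dpen_def vec_eq_iff)

lemma pen_commute: "pen \<epsilon> (x - y) = pen \<epsilon> (y - x)"
  using pen_uminus[of \<epsilon> "y - x"] by simp

lemma cos_scaled_shift:
  assumes "\<epsilon> > 0" "m \<in> \<int>"
  shows "cos (2 * pi / \<epsilon> * (t + \<epsilon> * m)) = cos (2 * pi / \<epsilon> * t)"
    and "sin (2 * pi / \<epsilon> * (t + \<epsilon> * m)) = sin (2 * pi / \<epsilon> * t)"
proof -
  have *: "2 * pi / \<epsilon> * (t + \<epsilon> * m) = 2 * pi / \<epsilon> * t + 2 * pi * m"
    using assms by (simp add: field_simps)
  have "cos (2 * pi * m) = 1" "sin (2 * pi * m) = 0"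
    using assms(2) by (auto simp: cos_one_2pi_int elim!: Ints_cases intro: sin_integer_2pi)
  then show "cos (2 * pi / \<epsilon> * (t + \<epsilon> * m)) = cos (2 * pi / \<epsilon> * t)"
    and "sin (2 * pi / \<epsilon> * (t + \<epsilon> * m)) = sin (2 * pi / \<epsilon> * t)"
    unfolding * by (simp_all add: cos_add sin_add)
qed

lemma periodic_pen: "\<epsilon> > 0 \<Longrightarrow> periodic \<epsilon> (pen \<epsilon>)"
  unfolding periodic_def pen_def lattice_def
  by (simp add: cos_scaled_shift del: times_divide_eq_left times_divide_eq_right)

lemma periodic_dpen: "\<epsilon> > 0 \<Longrightarrow> periodic \<epsilon> (dpen \<epsilon>)"
  unfolding periodic_def dpen_def lattice_def
  by (simp add: cos_scaled_shift del: times_divide_eq_left times_divide_eq_right)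

lemma continuous_on_pen [continuous_intros]:
  fixes f :: "'a :: t2_space \<Rightarrow> real ^ 'n"
  shows "continuous_on S f \<Longrightarrow> continuous_on S (\<lambda>x. pen \<epsilon> (f x))"
  unfolding pen_def
  by (intro continuous_on_mult_right continuous_on_sum continuous_on_diff continuous_on_const
      continuous_on_cos continuous_on_mult_left continuous_on_component)

lemma continuous_on_dpen [continuous_intros]:
  fixes f :: "'a :: t2_space \<Rightarrow> real ^ 'n"
  shows "continuous_on S f \<Longrightarrow> continuous_on S (\<lambda>x. dpen \<epsilon> (f x))"
  unfolding dpen_def
  by (intro continuous_on_vec_lambda continuous_on_mult_right continuous_on_sin continuous_on_mult_left
      continuous_on_component)

lemma GDERIV_pen:
  assumes "\<epsilon> > 0" shows "GDERIV (\<lambda>y. pen \<epsilon> (y - a)) x :> dpen \<epsilon> (x - a)"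
proof -
  have *: "((\<lambda>y. 1 - cos (2 * pi / \<epsilon> * (y - a) $ i)) has_derivative
      (\<lambda>h. 2 * pi / \<epsilon> * h $ i * sin (2 * pi / \<epsilon> * (x - a) $ i))) (at x)" for i
    using assms by (auto intro!: derivative_eq_intros bounded_linear.has_derivative[OF bounded_linear_vec_nth]
        simp: algebra_simps)
  have "((\<lambda>y. pen \<epsilon> (y - a)) has_derivative
      (\<lambda>h. (\<Sum>i\<in>UNIV. 2 * pi / \<epsilon> * h $ i * sin (2 * pi / \<epsilon> * (x - a) $ i)) * (\<epsilon> / (2 * pi))\<^sup>2)) (at x)"
    unfolding pen_def by (intro has_derivative_mult_left has_derivative_sum *)
  moreover have "(\<lambda>h. (\<Sum>i\<in>UNIV. 2 * pi / \<epsilon> * h $ i * sin (2 * pi / \<epsilon> * (x - a) $ i)) * (\<epsilon> / (2 * pi))\<^sup>2)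
     = (\<lambda>h. h \<bullet> dpen \<epsilon> (x - a))"
    unfolding inner_vec_def dpen_def sum_distrib_right using assms
    by (intro ext sum.cong) (auto simp: field_simps power2_eq_square)
  ultimately show ?thesis by (simp add: gderiv_def)
qed

text \<open>The difference of the two sides vanishes at \<open>b = 0\<close>, and its derivative has
  the sign of \<open>b\<close> because sine is 1-Lipschitz.\<close>

lemma cos_quadratic_bound:
  fixes a b :: real shows "1 - cos (a + b) \<le> 1 - cos a + b * sin a + b\<^sup>2 / 2"
proof -
  define g where "g = (\<lambda>b. b * sin a + b\<^sup>2 / 2 - cos a + cos (a + b))"
  define g' where "g' = (\<lambda>b. sin a + b - sin (a + b))"
  have d: "(g has_real_derivative g' b) (at b)" for b
    unfolding g_def g'_def by (auto intro!: derivative_eq_intros)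
  have l: "\<bar>sin (a + b) - sin a\<bar> \<le> \<bar>b\<bar>" for b
  proof -
    have "sin (a + b) - sin a = 2 * sin (b / 2) * cos (a + b / 2)"
      by (simp add: sin_diff_sin add_divide_distrib)
    moreover have "\<bar>sin (b / 2) * cos (a + b / 2)\<bar> \<le> \<bar>b / 2\<bar> * 1"
      unfolding abs_mult by (intro mult_mono abs_sin_x_le_abs_x) auto
    ultimately show ?thesis by (simp add: abs_mult)
  qed
  have "g (0::real) \<le> g b"
  proof (cases "0 \<le> b")
    case True
    show ?thesis
    proof (rule DERIV_nonneg_imp_nondecreasing[OF True])
      fix x :: real assume "0 \<le> x"
      then show "\<exists>y. (g has_real_derivative y) (at x) \<and> 0 \<le> y" using d[of x] l[of x] by (auto simp: g'_def)
    qed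
  next
    case False
    show ?thesis
    proof (rule DERIV_nonpos_imp_nonincreasing[of b 0])
      fix x :: real assume "b \<le> x" "x \<le> 0"
      then show "\<exists>y. (g has_real_derivative y) (at x) \<and> y \<le> 0" using d[of x] l[of x] by (auto simp: g'_def)
    qed (use False in auto)
  qed
  then show ?thesis by (simp add: g_def)
qed

text \<open>The factor \<open>(\<epsilon> / (2 * pi))\<^sup>2\<close> normalizes the second
  derivative of each summand to at most 1, so \<open>pen\<close> obeys the same upper expansion as
  half the squared norm. Semiconvexity of sup-convolutions rests on this.\<close>

lemma pen_add_le:
  assumes "\<epsilon> > 0" shows "pen \<epsilon> (z + s) \<le> pen \<epsilon> z + dpen \<epsilon> z \<bullet> s + (norm s)\<^sup>2 / 2"
proof -
  define \<kappa> where "\<kappa> = \<epsilon> / (2 * pi)"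
  have \<kappa>: "\<kappa> > 0" and e: "2 * pi / \<epsilon> = 1 / \<kappa>" using assms by (auto simp: \<kappa>_def)
  have "(\<Sum>i\<in>UNIV. 1 - cos (1 / \<kappa> * (z + s) $ i)) \<le>
     (\<Sum>i\<in>UNIV. (1 - cos (1 / \<kappa> * z $ i)) + s $ i / \<kappa> * sin (1 / \<kappa> * z $ i) + (s $ i / \<kappa>)\<^sup>2 / 2)"
    by (rule sum_mono) (use cos_quadratic_bound[of "z $ i / \<kappa>" "s $ i / \<kappa>" for i] in \<open>simp add: distrib_left add_divide_distrib\<close>)
  then have "pen \<epsilon> (z + s) \<le>
     (\<Sum>i\<in>UNIV. (1 - cos (1 / \<kappa> * z $ i)) + s $ i / \<kappa> * sin (1 / \<kappa> * z $ i) + (s $ i / \<kappa>)\<^sup>2 / 2) * \<kappa>\<^sup>2"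
    unfolding pen_def e \<kappa>_def[symmetric] by (intro mult_right_mono) auto
  also have "\<dots> = pen \<epsilon> z + dpen \<epsilon> z \<bullet> s + (norm s)\<^sup>2 / 2"
    unfolding pen_def e \<kappa>_def[symmetric] dpen_def inner_vec_def power2_norm_eq_inner
      sum.distrib distrib_right sum_distrib_right sum_divide_distrib using \<kappa>
    by (intro arg_cong2[where f="(+)"] sum.cong refl) (auto simp: field_simps power2_eq_square)
  finally show ?thesis .
qed

lemma cos_near_one:
  fixes t d :: real
  assumes "0 < d" "d \<le> pi" "cos d < cos t" "\<bar>t\<bar> \<le> pi" shows "\<bar>t\<bar> < d"
proof (rule ccontr)
  assume "\<not> ?thesis"
  then have "cos \<bar>t\<bar> \<le> cos d" using assms by (intro cos_monotone_0_pi_le) auto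
  then show False using assms by simp
qed

text \<open>\<open>pen\<close> vanishes exactly on the scaled lattice, so smallness gives closeness
  only modulo lattice translations. This is why maximizers are translated throughout before
  distances are compared.\<close>

lemma pen_small:
  assumes "\<epsilon> > 0" "\<rho> > 0"
  obtains d where "d > 0" "\<And>z :: real ^ 'n. pen \<epsilon> z < d \<Longrightarrow> \<exists>k\<in>lattice. norm (z + \<epsilon> *\<^sub>R k) < \<rho>"
proof -
  define \<kappa> where "\<kappa> = 2 * pi / \<epsilon>"
  define N where "N = real CARD('n)"
  have pos: "\<kappa> > 0" "N > 0" using assms by (auto simp: \<kappa>_def N_def)
  \<comment> \<open>The angle that corresponds to the length \<open>\<rho> / N\<close>: a bound of
    \<open>\<rho> / N\<close> on each of the \<open>N\<close> coordinates bounds the norm by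
    \<open>\<rho>\<close>. The minimum with \<open>pi\<close> keeps cosine injective.\<close>
  define s where "s = min pi (\<kappa> * \<rho> / N)"
  have s: "0 < s" "s \<le> pi" using pos assms by (auto simp: s_def)
  define d where "d = (1 - cos s) / \<kappa>\<^sup>2"
  have "cos s < 1" using cos_monotone_0_pi[of 0 s] s by simp
  then have "d > 0" using pos by (auto simp: d_def)
  moreover have "\<exists>k\<in>lattice. norm (z + \<epsilon> *\<^sub>R k) < \<rho>" if z: "pen \<epsilon> z < d" for z :: "real ^ 'n"
  proof -
    \<comment> \<open>Minus the nearest integer to \<open>z $ i / \<epsilon>\<close>; after the
      shift each angle lies in \<open>[- pi, pi]\<close>.\<close>
    define k :: "real ^ 'n" where "k = (\<chi> i. - of_int \<lfloor>z $ i / \<epsilon> + 1/2\<rfloor>)"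
    have "\<bar>(z + \<epsilon> *\<^sub>R k) $ i\<bar> < \<rho> / N" for i
    proof -
      have "1 - cos (\<kappa> * z $ i) \<le> (\<Sum>i\<in>UNIV. 1 - cos (\<kappa> * z $ i))"
        by (rule member_le_sum) auto
      also have "\<dots> < 1 - cos s"
      proof -
        have "(\<Sum>i\<in>UNIV. 1 - cos (\<kappa> * z $ i)) * (1 / \<kappa>)\<^sup>2 < (1 - cos s) * (1 / \<kappa>)\<^sup>2"
          using z assms unfolding pen_def d_def \<kappa>_def by (simp add: power_divide)
        then show ?thesis using pos by (simp add: mult_less_cancel_right)
      qed
      finally have c: "cos s < cos (\<kappa> * z $ i)" by simp
      define t where "t = \<kappa> * (z $ i + \<epsilon> * k $ i)"
      have "\<bar>z $ i / \<epsilon> + k $ i\<bar> \<le> 1 / 2" unfolding k_def vec_lambda_beta by linarith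
      moreover have "t = 2 * pi * (z $ i / \<epsilon> + k $ i)" using assms by (simp add: t_def \<kappa>_def field_simps)
      ultimately have "\<bar>t\<bar> \<le> pi" by (simp add: abs_mult)
      moreover have "cos s < cos t"
        using c assms cos_scaled_shift(1)[of \<epsilon> "k $ i" "z $ i"] by (simp add: t_def \<kappa>_def k_def)
      ultimately have "\<bar>t\<bar> < s" using cos_near_one s by blast
      then have "\<kappa> * \<bar>z $ i + \<epsilon> * k $ i\<bar> < \<kappa> * \<rho> / N"
        unfolding t_def using pos by (simp add: abs_mult s_def)
      then show ?thesis using pos by (simp add: field_simps)
    qed
    then have "(\<Sum>i\<in>UNIV. \<bar>(z + \<epsilon> *\<^sub>R k) $ i\<bar>) < (\<Sum>i\<in>(UNIV::'n set). \<rho> / N)"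
      by (intro sum_strict_mono) auto
    also have "\<dots> = \<rho>" using pos by (simp add: N_def)
    finally have "norm (z + \<epsilon> *\<^sub>R k) < \<rho>" using norm_le_l1_cart[of "z + \<epsilon> *\<^sub>R k"] by simp
    moreover have "k \<in> lattice" by (simp add: k_def lattice_def)
    ultimately show ?thesis by blast
  qed
  ultimately show ?thesis using that by blast
qed

lemma torus_C1_coset:
  assumes "periodic \<epsilon> f" "periodic \<epsilon> g" "\<And>x. GDERIV f x :> g x" "continuous_on UNIV g"
  obtains \<phi> d\<phi> where "torus_C1 \<epsilon> \<phi> d\<phi>" "\<And>x. \<phi> (coset \<epsilon> x) = f x" "\<And>x. d\<phi> (coset \<epsilon> x) = g x"
proof -
  obtain \<phi> where \<phi>: "\<And>x. \<phi> (coset \<epsilon> x) = f x" using periodic_lift[OF assms(1)] by blast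
  obtain d\<phi> where d\<phi>: "\<And>x. d\<phi> (coset \<epsilon> x) = g x" using periodic_lift[OF assms(2)] by blast
  have "torus_C1 \<epsilon> \<phi> d\<phi>" using assms(3,4) by (simp add: torus_C1_def continuous_map_torus \<phi> d\<phi>)
  then show ?thesis using that \<phi> d\<phi> by blast
qed

lemma torus_C1_pen:
  fixes y :: "real ^ 'n"
  assumes "\<epsilon> > 0"
  obtains \<phi> d\<phi> where "torus_C1 \<epsilon> \<phi> d\<phi>" "\<And>x. \<phi> (coset \<epsilon> x) = A * pen \<epsilon> (x - y)"
    "\<And>x. d\<phi> (coset \<epsilon> x) = A *\<^sub>R dpen \<epsilon> (x - y)"
proof -
  have "pen \<epsilon> (x + \<epsilon> *\<^sub>R k - y) = pen \<epsilon> (x - y)" "dpen \<epsilon> (x + \<epsilon> *\<^sub>R k - y) = dpen \<epsilon> (x - y)"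
    if "k \<in> lattice" for k x :: "real ^ 'n"
    using periodicD[OF periodic_pen[OF assms] that, of "x - y"]
      periodicD[OF periodic_dpen[OF assms] that, of "x - y"] by (simp_all add: diff_add_eq)
  then have "periodic \<epsilon> (\<lambda>x. A * pen \<epsilon> (x - y))" "periodic \<epsilon> (\<lambda>x. A *\<^sub>R dpen \<epsilon> (x - y))"
    by (simp_all add: periodic_def)
  moreover have "GDERIV (\<lambda>x. A * pen \<epsilon> (x - y)) x :> A *\<^sub>R dpen \<epsilon> (x - y)" for x
    using GDERIV_mult[OF GDERIV_const[of A] GDERIV_pen[OF assms]] by simp
  moreover have "continuous_on UNIV (\<lambda>x. A *\<^sub>R dpen \<epsilon> (x - y))"
    by (intro continuous_on_scaleR continuous_on_const continuous_on_dpen continuous_on_diff continuous_on_id)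
  ultimately show ?thesis by (rule torus_C1_coset) (rule that)
qed

section \<open>A space-filling curve\<close>

text \<open>Schoenberg's curve. It transports weak compactness from the real line, where Helly's
  selection theorem is available, to \<open>\<real>\<^sup>n \<times> \<real>\<^sup>n\<close>.\<close>

definition plateau :: "real \<Rightarrow> real" where
  "plateau t = max 0 (min 1 (1 / 2 - cos (pi * t)))"

lemma plateau_bounds: "0 \<le> plateau t" "plateau t \<le> 1"
  by (auto simp: plateau_def)

lemma continuous_on_plateau: "continuous_on UNIV plateau"
  unfolding plateau_def by (intro continuous_intros)

lemma plateau_periodic:
  assumes "m \<in> \<int>" shows "plateau (2 * m + t) = plateau t"
proof -
  have "pi * (2 * m + t) = pi * t + 2 * pi * m" by (simp add: algebra_simps)
  moreover have "cos (2 * pi * m) = 1" "sin (2 * pi * m) = 0"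
    using assms by (auto simp: cos_one_2pi_int elim!: Ints_cases intro: sin_integer_2pi)
  ultimately show ?thesis by (simp add: plateau_def cos_add)
qed

lemma plateau_zero: assumes "0 \<le> t" "t \<le> 1 / 3" shows "plateau t = 0"
proof -
  have "cos (pi / 3) \<le> cos (pi * t)"
    using assms by (intro cos_monotone_0_pi_le) auto
  then show ?thesis by (simp add: plateau_def cos_60)
qed

lemma plateau_one: assumes "2 / 3 \<le> t" "t \<le> 1" shows "plateau t = 1"
proof -
  have "cos (pi * t) \<le> cos (2 * pi / 3)"
    using assms by (intro cos_monotone_0_pi_le) (auto simp: field_simps)
  then show ?thesis by (simp add: plateau_def cos_120)
qed

text \<open>The point of the Cantor set whose ternary digits are 0 and 2. Multiplication by 3 shifts
  the digits and produces an even integer part, which the period 2 of \<open>plateau\<close>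
  ignores.\<close>

definition cantor :: "(nat \<Rightarrow> bool) \<Rightarrow> real" where
  "cantor b = (\<Sum>j. 2 * of_bool (b j) / 3 ^ Suc j)"

lemma cantor_sums: "(\<lambda>j. 2 * of_bool (b j) / 3 ^ Suc j :: real) sums cantor b"
  and cantor_bounds: "0 \<le> cantor b" "cantor b \<le> 1"
proof -
  have g: "(\<lambda>j. 2 / 3 ^ Suc j :: real) sums 1"
    using sums_mult[OF geometric_sums[of "1 / 3 :: real"], of "2 / 3"] by (simp add: power_divide)
  have s: "summable (\<lambda>j. 2 * of_bool (b j) / 3 ^ Suc j :: real)"
    by (rule summable_comparison_test'[OF sums_summable[OF g], of 0]) auto
  then show "(\<lambda>j. 2 * of_bool (b j) / 3 ^ Suc j :: real) sums cantor b"
    unfolding cantor_def by (rule summable_sums)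
  show "0 \<le> cantor b" unfolding cantor_def by (rule suminf_nonneg[OF s]) simp
  have "cantor b \<le> (\<Sum>j. 2 / 3 ^ Suc j :: real)"
    unfolding cantor_def by (rule suminf_le[OF _ s sums_summable[OF g]]) simp
  then show "cantor b \<le> 1" using sums_unique[OF g] by simp
qed

lemma cantor_shift: "3 * cantor b = 2 * of_bool (b 0) + cantor (\<lambda>j. b (Suc j))"
proof -
  have "(\<lambda>j. 2 * of_bool (b (Suc j)) / 3 ^ Suc (Suc j) :: real) sums (cantor b - 2 * of_bool (b 0) / 3)"
    using iffD2[OF sums_Suc_iff, of "\<lambda>j. 2 * of_bool (b j) / 3 ^ Suc j" "cantor b - 2 * of_bool (b 0) / 3"]
      cantor_sums[of b] by simp
  from sums_mult[OF this, of 3]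
  have "(\<lambda>j. 2 * of_bool (b (Suc j)) / 3 ^ Suc j :: real) sums (3 * cantor b - 2 * of_bool (b 0))"
    by (simp add: right_diff_distrib)
  then show ?thesis using sums_unique2[OF cantor_sums[of "\<lambda>j. b (Suc j)"]] by simp
qed

text \<open>The leading digit decides whether the point lies in \<open>[0, 1/3]\<close>, where
  \<open>plateau\<close> is 0, or in \<open>[2/3, 1]\<close>, where it is 1. Induction shifts the
  later digits to the front.\<close>

lemma plateau_cantor: "plateau (3 ^ i * cantor b) = of_bool (b i)"
proof (induction i arbitrary: b)
  case 0
  have "0 \<le> cantor (\<lambda>j. b (Suc j))" "cantor (\<lambda>j. b (Suc j)) \<le> 1" by (rule cantor_bounds)+
  then show ?case
    using cantor_shift[of b] cantor_bounds[of b] by (cases "b 0") (auto intro: plateau_zero plateau_one)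
next
  case (Suc i)
  have "3 ^ Suc i * cantor b = 2 * (3 ^ i * of_bool (b 0)) + 3 ^ i * cantor (\<lambda>j. b (Suc j))"
  proof -
    have "3 ^ Suc i * cantor b = 3 ^ i * (3 * cantor b)" by simp
    then show ?thesis unfolding cantor_shift by (simp only: distrib_left mult.left_commute)
  qed
  moreover have "3 ^ i * of_bool (b 0) \<in> (\<int> :: real set)" by (intro Ints_mult Ints_power) auto
  ultimately show ?case using Suc plateau_periodic by metis
qed

text \<open>\<open>prod_encode\<close> distributes the digits of \<open>t\<close> among countably
  many coordinates: the binary digit number \<open>k\<close> of coordinate \<open>j\<close> is the
  ternary digit of \<open>t\<close> at position \<open>prod_encode (k, j)\<close>, halved. The
  dimension therefore plays no part until coordinates are selected.\<close>

definition schoenberg :: "nat \<Rightarrow> real \<Rightarrow> real" where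
  "schoenberg j t = (\<Sum>k. plateau (3 ^ prod_encode (k, j) * t) / 2 ^ Suc k)"

lemma half_powers_sums: "(\<lambda>k. 1 / 2 ^ Suc k :: real) sums 1"
  using power_half_series by (simp add: power_divide)

lemma schoenberg_summable: "summable (\<lambda>k. plateau (3 ^ prod_encode (k, j) * t) / 2 ^ Suc k)"
  by (rule summable_comparison_test'[OF sums_summable[OF half_powers_sums], of 0])
    (use plateau_bounds in \<open>auto intro!: divide_right_mono\<close>)

lemma schoenberg_bounds: "0 \<le> schoenberg j t" "schoenberg j t \<le> 1"
proof -
  show "0 \<le> schoenberg j t"
    unfolding schoenberg_def by (rule suminf_nonneg[OF schoenberg_summable]) (simp add: plateau_bounds)
  have "schoenberg j t \<le> (\<Sum>k. 1 / 2 ^ Suc k)"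
    unfolding schoenberg_def
    by (rule suminf_le[OF _ schoenberg_summable sums_summable[OF half_powers_sums]])
      (intro divide_right_mono plateau_bounds, simp)
  then show "schoenberg j t \<le> 1" using sums_unique[OF half_powers_sums] by simp
qed

lemma continuous_on_schoenberg: "continuous_on UNIV (schoenberg j)"
proof -
  have "uniform_limit UNIV (\<lambda>n t. \<Sum>k<n. plateau (3 ^ prod_encode (k, j) * t) / 2 ^ Suc k)
      (\<lambda>t. \<Sum>k. plateau (3 ^ prod_encode (k, j) * t) / 2 ^ Suc k) sequentially"
    by (rule Weierstrass_m_test[OF _ sums_summable[OF half_powers_sums]])
      (use plateau_bounds in \<open>auto intro!: divide_right_mono\<close>)
  then have "uniform_limit UNIV (\<lambda>n t. \<Sum>k<n. plateau (3 ^ prod_encode (k, j) * t) / 2 ^ Suc k) (schoenberg j) sequentially"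
    by (simp add: schoenberg_def[abs_def])
  then show ?thesis
    by (rule uniform_limit_theorem[rotated])
      (auto intro!: always_eventually continuous_on_sum continuous_on_divide continuous_on_const
        continuous_on_compose2[OF continuous_on_plateau] continuous_on_mult continuous_on_id)
qed

text \<open>The partial sums are \<open>\<lfloor>2 ^ n * z\<rfloor> / 2 ^ n\<close>. The strict
  bound on \<open>z\<close> makes the integer part 0, which starts the induction.\<close>

lemma binary_expansion:
  fixes z :: real assumes "0 \<le> z" "z < 1"
  shows "(\<lambda>k. of_bool (odd \<lfloor>2 ^ Suc k * z\<rfloor>) / 2 ^ Suc k) sums z"
proof -
  have step: "of_int \<lfloor>2 ^ Suc n * z\<rfloor> = 2 * of_int \<lfloor>2 ^ n * z\<rfloor> + (of_bool (odd \<lfloor>2 ^ Suc n * z\<rfloor>) :: real)" for n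
  proof -
    have "\<lfloor>2 ^ n * z\<rfloor> = \<lfloor>2 ^ Suc n * z\<rfloor> div 2"
      using floor_divide_real_eq_div[of 2 "2 ^ Suc n * z"] by simp
    then have "\<lfloor>2 ^ Suc n * z\<rfloor> = 2 * \<lfloor>2 ^ n * z\<rfloor> + of_bool (odd \<lfloor>2 ^ Suc n * z\<rfloor>)"
      by (simp add: mod_2_eq_odd[symmetric])
    then have "real_of_int \<lfloor>2 ^ Suc n * z\<rfloor> = real_of_int (2 * \<lfloor>2 ^ n * z\<rfloor> + of_bool (odd \<lfloor>2 ^ Suc n * z\<rfloor>))"
      by (rule arg_cong)
    then show ?thesis by simp
  qed
  have part: "(\<Sum>k<n. of_bool (odd \<lfloor>2 ^ Suc k * z\<rfloor>) / 2 ^ Suc k) = (of_int \<lfloor>2 ^ n * z\<rfloor> / 2 ^ n :: real)" for n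
  proof (induction n)
    case 0
    have "\<lfloor>z\<rfloor> = 0" using assms by (simp add: floor_eq_iff)
    then show ?case by simp
  next
    case (Suc n) then show ?case using step[of n] by (simp add: field_simps)
  qed
  have "(\<lambda>n. z - (1 / 2) ^ n) \<longlonglongrightarrow> z - 0"
    by (intro tendsto_diff tendsto_const LIMSEQ_power_zero) simp
  then have lim: "(\<lambda>n. z - (1 / 2) ^ n) \<longlonglongrightarrow> z" by simp
  have "(\<lambda>n. of_int \<lfloor>2 ^ n * z\<rfloor> / 2 ^ n) \<longlonglongrightarrow> z"
  proof (rule tendsto_sandwich[OF _ _ lim tendsto_const])
    have "z - (1 / 2) ^ n \<le> of_int \<lfloor>2 ^ n * z\<rfloor> / 2 ^ n" for n
    proof -
      have "2 ^ n * z - 1 \<le> of_int \<lfloor>2 ^ n * z\<rfloor>" by linarith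
      then have "(2 ^ n * z - 1) / 2 ^ n \<le> of_int \<lfloor>2 ^ n * z\<rfloor> / 2 ^ n" by (intro divide_right_mono) auto
      then show ?thesis by (simp add: diff_divide_distrib power_divide)
    qed
    then show "\<forall>\<^sub>F n in sequentially. z - (1 / 2) ^ n \<le> of_int \<lfloor>2 ^ n * z\<rfloor> / 2 ^ n" by simp
    have "of_int \<lfloor>2 ^ n * z\<rfloor> / 2 ^ n \<le> z" for n
    proof -
      have "of_int \<lfloor>2 ^ n * z\<rfloor> \<le> 2 ^ n * z" by linarith
      then show ?thesis by (simp add: divide_le_eq mult.commute)
    qed
    then show "\<forall>\<^sub>F n in sequentially. of_int \<lfloor>2 ^ n * z\<rfloor> / 2 ^ n \<le> z" by simp
  qed
  then show ?thesis unfolding sums_def part .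
qed

lemma schoenberg_surj:
  fixes z :: "nat \<Rightarrow> real"
  assumes "\<And>j. 0 \<le> z j" "\<And>j. z j < 1"
  obtains t where "0 \<le> t" "t \<le> 1" "\<And>j. schoenberg j t = z j"
proof -
  define b where "b = (\<lambda>i. case prod_decode i of (k, j) \<Rightarrow> odd \<lfloor>2 ^ Suc k * z j\<rfloor>)"
  have "schoenberg j (cantor b) = z j" for j
    unfolding schoenberg_def plateau_cantor
    using sums_unique[OF binary_expansion[OF assms, of j]] by (simp add: b_def)
  then show ?thesis using that cantor_bounds by blast
qed

lemma space_filling:
  fixes \<epsilon> R :: real
  assumes "\<epsilon> > 0" "R > 0"
  obtains e :: "real \<Rightarrow> (real ^ 'n) \<times> (real ^ 'n)"
  where "continuous_on UNIV e" "bounded (range e)"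
    "\<And>y v. (\<And>i. 0 \<le> y $ i) \<Longrightarrow> (\<And>i. y $ i < \<epsilon>) \<Longrightarrow> norm v \<le> R \<Longrightarrow> \<exists>t. 0 \<le> t \<and> t \<le> 1 \<and> e t = (y, v)"
proof -
  define n where "n = to_nat_on (UNIV :: 'n set)"
  have inv: "from_nat_into UNIV (n i) = i" for i :: 'n
    unfolding n_def by (rule from_nat_into_to_nat_on) (auto intro: countable_finite)
  \<comment> \<open>The enlargement keeps the coordinates of vectors of norm at most
    \<open>R\<close> strictly inside the interval that is rescaled to \<open>[0, 1)\<close>. Below,
    positions use the even coordinates of the curve and velocities the odd ones.\<close>
  define R' where "R' = R + 1"
  define Y where "Y t = (\<chi> i. \<epsilon> * schoenberg (2 * n i) t)" for t
  define W where "W t = (\<chi> i. R' * (2 * schoenberg (2 * n i + 1) t - 1))" for t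
  define e where "e t = (Y t, W t)" for t
  have "continuous_on UNIV e"
    unfolding e_def Y_def W_def
    by (intro continuous_on_Pair continuous_on_vec_lambda continuous_on_mult continuous_on_diff
        continuous_on_const continuous_on_schoenberg)
  moreover have "bounded (range e)"
  proof -
    have "range e \<subseteq> cbox (0, \<chi> i. - R') (\<chi> i. \<epsilon>, \<chi> i. R')"
    proof
      fix a assume "a \<in> range e"
      then obtain t where a: "a = (Y t, W t)" by (auto simp: e_def)
      have "Y t \<in> cbox 0 (\<chi> i. \<epsilon>)"
        using assms schoenberg_bounds by (auto simp: mem_box_cart Y_def mult_left_le)
      moreover have "W t \<in> cbox (\<chi> i. - R') (\<chi> i. R')"
      proof -
        have "- R' \<le> R' * (2 * schoenberg j t - 1) \<and> R' * (2 * schoenberg j t - 1) \<le> R'" for j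
        proof -
          have "R' * (- 1) \<le> R' * (2 * schoenberg j t - 1)" "R' * (2 * schoenberg j t - 1) \<le> R' * 1"
            using assms schoenberg_bounds[of j t] by (intro mult_left_mono; simp add: R'_def)+
          then show ?thesis by simp
        qed
        then show ?thesis by (simp add: mem_box_cart W_def)
      qed
      ultimately show "a \<in> cbox (0, \<chi> i. - R') (\<chi> i. \<epsilon>, \<chi> i. R')" by (simp add: a cbox_Pair_eq)
    qed
    then show ?thesis by (rule bounded_subset[OF bounded_cbox])
  qed
  moreover have "\<exists>t. 0 \<le> t \<and> t \<le> 1 \<and> e t = (y, v)"
    if y: "\<And>i. 0 \<le> y $ i" "\<And>i. y $ i < \<epsilon>" and v: "norm v \<le> R" for y v
  proof -
    define z where "z j = (if even j then y $ from_nat_into UNIV (j div 2) / \<epsilon>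
        else (v $ from_nat_into UNIV (j div 2) / R' + 1) / 2)" for j
    have v': "- R' < v $ i" "v $ i < R'" for i
      using component_le_norm_cart[of v i] v by (auto simp: R'_def)
    have z: "0 \<le> z j" "z j < 1" for j
    proof -
      have v1: "- 1 < v $ i / R'" "v $ i / R' < 1" for i using v'[of i] assms by (auto simp: R'_def field_simps)
      have half: "0 \<le> (a + 1) / 2 \<and> (a + 1) / 2 < 1" if "- 1 < a" "a < 1" for a :: real
        using that by simp
      have "0 \<le> (v $ i / R' + 1) / 2" "(v $ i / R' + 1) / 2 < 1" for i using half[OF v1[of i]] by blast+
      moreover have "0 \<le> y $ i / \<epsilon>" "y $ i / \<epsilon> < 1" for i using y[of i] assms by auto
      ultimately show "0 \<le> z j" "z j < 1" by (simp_all add: z_def)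
    qed
    obtain t where t: "0 \<le> t" "t \<le> 1" "\<And>j. schoenberg j t = z j"
      by (rule schoenberg_surj[of z, OF z]) blast
    have "Y t = y" using assms by (simp add: Y_def t(3) z_def inv vec_eq_iff)
    moreover have "W t = v" using assms by (simp add: W_def t(3) z_def inv vec_eq_iff R'_def field_simps)
    ultimately show ?thesis using t(1,2) by (auto simp: e_def)
  qed
  ultimately show ?thesis using that by blast
qed

section \<open>Limits of occupation measures\<close>

lemma space_borel_of: "space (borel_of T) = topspace T"
  by (simp add: borel_of_def space_measure_of_conv)

lemma sets_borel_of: "openin T U \<Longrightarrow> U \<in> sets (borel_of T)"
proof -
  assume "openin T U"
  moreover have "{U. openin T U} \<subseteq> Pow (topspace T)" by (auto dest: openin_subset)
  ultimately show ?thesis unfolding borel_of_def by (auto simp: sets_measure_of intro: sigma_sets.Basic)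
qed

lemma measurable_borel_of_continuous:
  fixes g :: "'a \<Rightarrow> 'b::topological_space"
  assumes "continuous_map T euclidean g" shows "g \<in> borel_measurable (borel_of T)"
proof (rule borel_measurableI)
  fix U :: "'b set" assume "open U"
  then have "openin T {x \<in> topspace T. g x \<in> U}"
    using openin_continuous_map_preimage[OF assms, of U] by simp
  moreover have "g -` U \<inter> space (borel_of T) = {x \<in> topspace T. g x \<in> U}"
    by (auto simp: space_borel_of)
  ultimately show "g -` U \<inter> space (borel_of T) \<in> sets (borel_of T)" by (simp add: sets_borel_of)
qed

lemma continuous_map_measurable_borel_of:
  fixes J :: "'b::topological_space \<Rightarrow> 'a"
  assumes "continuous_map euclidean T J" shows "J \<in> borel \<rightarrow>\<^sub>M borel_of T"
  unfolding borel_of_def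
proof (rule measurable_measure_of)
  show "{U. openin T U} \<subseteq> Pow (topspace T)" by (auto dest: openin_subset)
  show "J \<in> space borel \<rightarrow> topspace T" using continuous_map_image_subset_topspace[OF assms] by auto
  fix U assume "U \<in> {U. openin T U}"
  then have "openin euclidean {x \<in> topspace euclidean. J x \<in> U}"
    by (intro openin_continuous_map_preimage[OF assms]) simp
  then have "open {x. J x \<in> U}" by simp
  moreover have "J -` U \<inter> space borel = {x. J x \<in> U}" by auto
  ultimately show "J -` U \<inter> space borel \<in> sets borel" by simp
qed

text \<open>The sample points are lifted along the space-filling curve to parameters in
  \<open>[0, 1]\<close>. The uniform distributions on the lifts are tight on the line, so a
  subsequence converges weakly there, and the limit is pushed forward along the curve. The same
  subsequence serves every continuous \<open>g\<close>, even one unbounded in the velocity, since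
  the curve has bounded range.\<close>

lemma occupation_measure_limit:
  fixes y v :: "nat \<Rightarrow> nat \<Rightarrow> real ^ 'n" and N :: "nat \<Rightarrow> nat"
  assumes "\<epsilon> > 0" "R > 0" and N: "\<And>n. N n > 0" and v: "\<And>n k. k < N n \<Longrightarrow> norm (v n k) \<le> R"
  obtains \<mu> r where "prob_space \<mu>" "sets \<mu> = sets (borel_of (prod_topology (torus \<epsilon>) euclidean))"
    "strict_mono (r :: nat \<Rightarrow> nat)"
    "\<And>g :: _ \<Rightarrow> real. continuous_on UNIV (\<lambda>(x, w). g (coset \<epsilon> x, w)) \<Longrightarrow> integrable \<mu> g"
    "\<And>g :: _ \<Rightarrow> real. continuous_on UNIV (\<lambda>(x, w). g (coset \<epsilon> x, w)) \<Longrightarrow>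
       (\<lambda>n. (\<Sum>k<N (r n). g (coset \<epsilon> (y (r n) k), v (r n) k)) / real (N (r n))) \<longlonglongrightarrow> (\<integral>z. g z \<partial>\<mu>)"
proof -
  obtain e :: "real \<Rightarrow> (real ^ 'n) \<times> (real ^ 'n)" where e: "continuous_on UNIV e" "bounded (range e)"
    "\<And>y v. (\<And>i. 0 \<le> y $ i) \<Longrightarrow> (\<And>i. y $ i < \<epsilon>) \<Longrightarrow> norm v \<le> R \<Longrightarrow> \<exists>t. 0 \<le> t \<and> t \<le> 1 \<and> e t = (y, v)"
    by (rule space_filling[OF assms(1,2)]) blast
  define T where "T = prod_topology (torus \<epsilon> :: (real ^ 'n) set topology) (euclidean :: (real ^ 'n) topology)"
  define Q where "Q = (\<lambda>(x :: real ^ 'n, w :: real ^ 'n). (coset \<epsilon> x, w))"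
  define J where "J = Q \<circ> e"
  have "\<exists>t. 0 \<le> t \<and> t \<le> 1 \<and> J t = (coset \<epsilon> (y n k), v n k)" if kN: "k < N n" for n k
  proof -
    obtain l where l: "l \<in> lattice" "\<And>i. 0 \<le> (y n k + \<epsilon> *\<^sub>R l) $ i" "\<And>i. (y n k + \<epsilon> *\<^sub>R l) $ i < \<epsilon>"
      by (rule fundamental_shift[OF assms(1)]) blast
    obtain t where "0 \<le> t" "t \<le> 1" "e t = (y n k + \<epsilon> *\<^sub>R l, v n k)"
      using e(3)[OF l(2,3) v[OF kN]] by blast
    then show ?thesis by (intro exI[of _ t]) (simp add: J_def Q_def coset_shift[OF l(1)])
  qed
  then have "\<forall>n k. \<exists>t. k < N n \<longrightarrow> 0 \<le> t \<and> t \<le> 1 \<and> J t = (coset \<epsilon> (y n k), v n k)" by blast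
  then obtain t where "\<forall>n k. k < N n \<longrightarrow> 0 \<le> t n k \<and> t n k \<le> 1 \<and> J (t n k) = (coset \<epsilon> (y n k), v n k)"
    unfolding choice_iff by (elim exE)
  then have t: "\<And>n k. k < N n \<Longrightarrow> 0 \<le> t n k" "\<And>n k. k < N n \<Longrightarrow> t n k \<le> 1"
    "\<And>n k. k < N n \<Longrightarrow> J (t n k) = (coset \<epsilon> (y n k), v n k)" by simp_all
  define \<nu> where "\<nu> n = distr (measure_pmf (pmf_of_set {..<N n})) borel (t n)" for n
  have ne: "{..<N n} \<noteq> {}" for n using N[of n] by auto
  have rd: "real_distribution (\<nu> n)" for n
    unfolding \<nu>_def by (rule prob_space.real_distribution_distr[OF measure_pmf.prob_space_axioms]) simp
  have int: "integral\<^sup>L (\<nu> n) g = (\<Sum>k<N n. g (t n k)) / real (N n)" if "g \<in> borel_measurable borel" for n and g :: "real \<Rightarrow> real"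
    unfolding \<nu>_def using that integral_pmf_of_set[OF ne finite_lessThan, of n "\<lambda>k. g (t n k)"]
    by (simp add: integral_distr)
  have "tight \<nu>"
    unfolding tight_def
  proof (intro conjI allI impI)
    fix \<delta> :: real assume "\<delta> > 0"
    \<comment> \<open>Tightness is phrased with intervals open on the left, so \<open>[0, 1]\<close>
      is enlarged.\<close>
    have "measure (\<nu> n) {- 1<..2} = 1" for n
    proof -
      interpret real_distribution "\<nu> n" by (rule rd)
      have "AE k in measure_pmf (pmf_of_set {..<N n}). t n k \<in> {- 1<..2}"
      proof -
        have "t n k \<in> {- 1<..2}" if "k < N n" for k using t(1,2)[OF that] by simp
        then show ?thesis by (simp add: AE_measure_pmf_iff set_pmf_of_set ne)
      qed
      then have "AE x in \<nu> n. x \<in> {- 1<..2}"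
        unfolding \<nu>_def by (subst AE_distr_iff) auto
      then show ?thesis using prob_eq_1[of "{- 1<..2}"] by simp
    qed
    then show "\<exists>a b. a < b \<and> (\<forall>n. 1 - \<delta> < measure (\<nu> n) {a<..b})"
      using \<open>\<delta> > 0\<close> by (intro exI[of _ "- 1"] exI[of _ 2]) simp
  qed (rule rd)
  from tight_imp_convergent_subsubsequence[OF this strict_mono_id]
  obtain r M where r: "strict_mono (r :: nat \<Rightarrow> nat)" and M: "real_distribution M" "weak_conv_m (\<nu> \<circ> r) M"
    unfolding comp_id by (elim exE conjE)
  interpret M: real_distribution M by (rule M(1))
  define \<mu> where "\<mu> = distr M (borel_of T) J"
  have cJ: "continuous_map euclidean T J"
  proof -
    have "continuous_map euclidean euclidean e" using e(1) by simp
    moreover have "continuous_map euclidean T Q"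
      unfolding T_def Q_def by (rule quotient_imp_continuous_map[OF quotient_map_coset_prod])
    ultimately show ?thesis unfolding J_def by (rule continuous_map_compose)
  qed
  have mJ: "J \<in> M \<rightarrow>\<^sub>M borel_of T"
    using continuous_map_measurable_borel_of[OF cJ] M.events_eq_borel measurable_cong_sets by blast
  have key: "continuous_on UNIV (g \<circ> J) \<and> (\<exists>B. \<forall>x. norm (g (J x)) \<le> B) \<and> g \<in> borel_measurable (borel_of T)"
    if g: "continuous_on UNIV (\<lambda>(x, w). g (coset \<epsilon> x, w))" for g :: "_ \<Rightarrow> real"
  proof (intro conjI)
    have gT: "continuous_map T euclidean g" unfolding T_def using g continuous_map_torus_prod by blast
    then show "g \<in> borel_measurable (borel_of T)" by (rule measurable_borel_of_continuous)
    show "continuous_on UNIV (g \<circ> J)" using continuous_map_compose[OF cJ gT] by simp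
    \<comment> \<open>\<open>g\<close> is bounded along the curve because it is continuous upstairs
      on a compact set. Weak convergence on the line needs a bounded integrand.\<close>
    have "compact (closure (range e))" using e(2) by (simp add: compact_closure)
    then have "compact ((\<lambda>(x, w). g (coset \<epsilon> x, w)) ` closure (range e))"
      by (rule compact_continuous_image[rotated]) (rule continuous_on_subset[OF g subset_UNIV])
    from compact_imp_bounded[OF this]
    obtain B where B: "\<forall>z \<in> (\<lambda>(x, w). g (coset \<epsilon> x, w)) ` closure (range e). norm z \<le> B"
      unfolding bounded_iff by (elim exE)
    have "norm (g (J x)) \<le> B" for x
    proof -
      have "e x \<in> closure (range e)" by (rule subsetD[OF closure_subset rangeI])
      then have "norm ((\<lambda>(x, w). g (coset \<epsilon> x, w)) (e x)) \<le> B" by (intro bspec[OF B] imageI)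
      then show ?thesis by (simp add: J_def Q_def case_prod_beta)
    qed
    then show "\<exists>B. \<forall>x. norm (g (J x)) \<le> B" by blast
  qed
  have "prob_space \<mu>" unfolding \<mu>_def by (rule M.prob_space_distr[OF mJ])
  moreover have "sets \<mu> = sets (borel_of (prod_topology (torus \<epsilon>) euclidean))" by (simp add: \<mu>_def T_def)
  moreover have "integrable \<mu> g" if g: "continuous_on UNIV (\<lambda>(x, w). g (coset \<epsilon> x, w))" for g :: "_ \<Rightarrow> real"
  proof -
    obtain B where B: "\<And>x. norm (g (J x)) \<le> B" using key[OF g] by blast
    have "(g \<circ> J) \<in> borel_measurable M" using measurable_comp[OF mJ] key[OF g] by blast
    then have "integrable M (\<lambda>x. g (J x))"
      by (intro M.integrable_const_bound[of _ B]) (auto simp: o_def intro!: AE_I2 B[unfolded real_norm_def])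
    then show ?thesis unfolding \<mu>_def using key[OF g] mJ by (subst integrable_distr_eq) auto
  qed
  moreover have "(\<lambda>n. (\<Sum>k<N (r n). g (coset \<epsilon> (y (r n) k), v (r n) k)) / real (N (r n))) \<longlonglongrightarrow> (\<integral>z. g z \<partial>\<mu>)"
    if g: "continuous_on UNIV (\<lambda>(x, w). g (coset \<epsilon> x, w))" for g :: "_ \<Rightarrow> real"
  proof -
    obtain B where B: "\<And>x. norm (g (J x)) \<le> B" using key[OF g] by blast
    have c: "continuous_on UNIV (\<lambda>x. g (J x))" using key[OF g] by (simp add: o_def)
    then have ic: "isCont (\<lambda>x. g (J x)) x" for x
      using continuous_on_eq_continuous_at[OF open_UNIV] by blast
    have "(\<lambda>n. integral\<^sup>L ((\<nu> \<circ> r) n) (\<lambda>x. g (J x))) \<longlonglongrightarrow> integral\<^sup>L M (\<lambda>x. g (J x))"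
      by (rule weak_conv_imp_integral_bdd_continuous_conv[OF _ M ic B]) (simp add: rd)
    moreover have "integral\<^sup>L ((\<nu> \<circ> r) n) (\<lambda>x. g (J x)) =
       (\<Sum>k<N (r n). g (coset \<epsilon> (y (r n) k), v (r n) k)) / real (N (r n))" for n
    proof -
      have "integral\<^sup>L ((\<nu> \<circ> r) n) (\<lambda>x. g (J x)) = (\<Sum>k<N (r n). g (J (t (r n) k))) / real (N (r n))"
        using int[of "\<lambda>x. g (J x)" "r n"] borel_measurable_continuous_onI[OF c] by simp
      also have "(\<Sum>k<N (r n). g (J (t (r n) k))) = (\<Sum>k<N (r n). g (coset \<epsilon> (y (r n) k), v (r n) k))"
        by (rule sum.cong) (auto simp: t(3))
      finally show ?thesis .
    qed
    moreover have "integral\<^sup>L M (\<lambda>x. g (J x)) = (\<integral>z. g z \<partial>\<mu>)"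
      unfolding \<mu>_def using key[OF g] mJ by (subst integral_distr) auto
    ultimately show ?thesis by simp
  qed
  ultimately show ?thesis using that r by blast
qed

lemma compact_subseqE:
  fixes f :: "nat \<Rightarrow> 'a::metric_space"
  assumes "compact K" "\<And>n. f n \<in> K"
  obtains l r where "l \<in> K" "strict_mono (r :: nat \<Rightarrow> nat)" "(\<lambda>n. f (r n)) \<longlonglongrightarrow> l"
proof -
  have "\<exists>l\<in>K. \<exists>r. strict_mono (r :: nat \<Rightarrow> nat) \<and> (f \<circ> r) \<longlonglongrightarrow> l"
    using assms(1)[unfolded compact_def, rule_format, of f] assms(2) by simp
  then show ?thesis using that by (auto simp: o_def)
qed

section \<open>Sup-convolution\<close>

definition supconv :: "real \<Rightarrow> real \<Rightarrow> (real ^ 'n \<Rightarrow> real) \<Rightarrow> real ^ 'n \<Rightarrow> real" where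
  "supconv \<epsilon> A f y = (SUP x. f x - A * pen \<epsilon> (x - y))"

lemma supconv_eqI:
  assumes "\<And>z. f z - A * pen \<epsilon> (z - y) \<le> f x - A * pen \<epsilon> (x - y)"
  shows "supconv \<epsilon> A f y = f x - A * pen \<epsilon> (x - y)"
  unfolding supconv_def by (rule cSup_eq_maximum) (use assms in auto)

lemma periodic_minus_pen:
  fixes f :: "real ^ 'n \<Rightarrow> real"
  assumes "\<epsilon> > 0" "periodic \<epsilon> f"
  shows "periodic \<epsilon> (\<lambda>x. f x - A * pen \<epsilon> (x - y))"
proof -
  have "pen \<epsilon> (x + \<epsilon> *\<^sub>R k - y) = pen \<epsilon> (x - y)" if "k \<in> lattice" for k x :: "real ^ 'n"
    using periodicD[OF periodic_pen[OF assms(1)] that, of "x - y"] by (simp add: diff_add_eq)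
  then show ?thesis using assms(2) by (simp add: periodic_def)
qed

lemma supconv_attained:
  fixes f :: "real ^ 'n \<Rightarrow> real"
  assumes "\<epsilon> > 0" "periodic \<epsilon> f" "continuous_on UNIV f"
  obtains x where "\<And>z. f z - A * pen \<epsilon> (z - y) \<le> f x - A * pen \<epsilon> (x - y)"
proof (rule periodic_attains_sup[OF assms(1) periodic_minus_pen[OF assms(1,2)]])
  show "continuous_on UNIV (\<lambda>x. f x - A * pen \<epsilon> (x - y))"
    by (intro continuous_on_diff continuous_on_mult continuous_on_const continuous_on_pen assms(3) continuous_on_id)
qed (rule that)

lemma supconv_ge:
  fixes f :: "real ^ 'n \<Rightarrow> real"
  assumes "\<epsilon> > 0" "periodic \<epsilon> f" "continuous_on UNIV f"
  shows "f z - A * pen \<epsilon> (z - y) \<le> supconv \<epsilon> A f y" "f y \<le> supconv \<epsilon> A f y"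
proof -
  obtain x where x: "\<And>z. f z - A * pen \<epsilon> (z - y) \<le> f x - A * pen \<epsilon> (x - y)"
    using supconv_attained[OF assms] by blast
  then have *: "f z - A * pen \<epsilon> (z - y) \<le> supconv \<epsilon> A f y" for z
    using supconv_eqI[OF x] by simp
  show "f z - A * pen \<epsilon> (z - y) \<le> supconv \<epsilon> A f y" "f y \<le> supconv \<epsilon> A f y"
    using *[of z] *[of y] by simp_all
qed

text \<open>Comparing the maximizer with \<open>y\<close> itself bounds
  \<open>A * pen \<epsilon> (x - y)\<close> by the oscillation \<open>2 * B\<close>. With
  \<open>A \<ge> 4 * B / d\<close> the penalty is below \<open>d\<close>, so a lattice translate of
  the maximizer, which is again a maximizer, lies near \<open>y\<close>. The threshold does not
  depend on \<open>y\<close>.\<close>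

lemma supconv_near:
  fixes f :: "real ^ 'n \<Rightarrow> real"
  assumes "\<epsilon> > 0" "periodic \<epsilon> f" "continuous_on UNIV f" "r > 0"
  obtains A0 where "A0 > 0"
    "\<And>A y. A \<ge> A0 \<Longrightarrow> \<exists>x. norm (x - y) < r \<and> (\<forall>z. f z - A * pen \<epsilon> (z - y) \<le> f x - A * pen \<epsilon> (x - y))"
proof -
  obtain B where B: "B > 0" "\<And>x. norm (f x) \<le> B" using periodic_bounded1[OF assms(1-3)] by blast
  obtain d where d: "d > 0" "\<And>z :: real ^ 'n. pen \<epsilon> z < d \<Longrightarrow> \<exists>k\<in>lattice. norm (z + \<epsilon> *\<^sub>R k) < r"
    using pen_small[OF assms(1,4)] by blast
  have "\<exists>x. norm (x - y) < r \<and> (\<forall>z. f z - A * pen \<epsilon> (z - y) \<le> f x - A * pen \<epsilon> (x - y))"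
    if A: "A \<ge> 4 * B / d" for A y
  proof -
    obtain x where x: "\<And>z. f z - A * pen \<epsilon> (z - y) \<le> f x - A * pen \<epsilon> (x - y)"
      using supconv_attained[OF assms(1-3)] by blast
    have "A * pen \<epsilon> (x - y) \<le> 2 * B"
      using x[of y] B(2)[of x] B(2)[of y] by simp
    moreover have "4 * B \<le> A * d" using A d(1) by (simp add: field_simps)
    ultimately have "A * pen \<epsilon> (x - y) < A * d" using B(1) by linarith
    moreover have "A > 0" using A B(1) d(1) by (smt (verit) divide_pos_pos)
    ultimately have "pen \<epsilon> (x - y) < d" by simp
    then obtain k where k: "k \<in> lattice" "norm (x - y + \<epsilon> *\<^sub>R k) < r" using d(2) by blast
    have "f (x + \<epsilon> *\<^sub>R k) - A * pen \<epsilon> (x + \<epsilon> *\<^sub>R k - y) = f x - A * pen \<epsilon> (x - y)"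
      using periodicD[OF periodic_minus_pen[OF assms(1,2)] k(1)] .
    then show ?thesis using x k(2) by (intro exI[of _ "x + \<epsilon> *\<^sub>R k"]) (simp add: diff_add_eq)
  qed
  then show ?thesis using that[of "4 * B / d"] B(1) d(1) by simp
qed

text \<open>The sup-convolution is semiconvex: at \<open>y\<close> it has the subgradient \<open>A dpen (x - y)\<close>, which is
  at the same time a supergradient of \<open>f\<close> at the maximizer \<open>x\<close>.\<close>

lemma supconv_semiconvex:
  fixes f :: "real ^ 'n \<Rightarrow> real"
  assumes "\<epsilon> > 0" "periodic \<epsilon> f" "continuous_on UNIV f" "A \<ge> 0"
    and x: "\<And>z. f z - A * pen \<epsilon> (z - y) \<le> f x - A * pen \<epsilon> (x - y)"
  shows "supconv \<epsilon> A f y - (A *\<^sub>R dpen \<epsilon> (x - y)) \<bullet> z - A * (norm z)\<^sup>2 / 2 \<le> supconv \<epsilon> A f (y - z)"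
proof -
  have "f x - A * pen \<epsilon> (x - (y - z)) \<le> supconv \<epsilon> A f (y - z)"
    by (rule supconv_ge[OF assms(1-3)])
  moreover have "A * pen \<epsilon> ((x - y) + z) \<le> A * (pen \<epsilon> (x - y) + dpen \<epsilon> (x - y) \<bullet> z + (norm z)\<^sup>2 / 2)"
    by (intro mult_left_mono pen_add_le assms)
  moreover have "x - (y - z) = (x - y) + z" by simp
  ultimately show ?thesis
    unfolding supconv_eqI[OF x] by (simp add: algebra_simps)
qed

lemma periodic_supconv:
  fixes f :: "real ^ 'n \<Rightarrow> real"
  assumes "\<epsilon> > 0" shows "periodic \<epsilon> (supconv \<epsilon> A f)"
proof -
  have "x - (y + \<epsilon> *\<^sub>R k) = x - y + \<epsilon> *\<^sub>R (- k)" for x y k :: "real ^ 'n" by (simp add: algebra_simps)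
  then have "pen \<epsilon> (x - (y + \<epsilon> *\<^sub>R k)) = pen \<epsilon> (x - y)" if "k \<in> lattice" for x y k :: "real ^ 'n"
    using periodicD[OF periodic_pen[OF assms] uminus_in_lattice[OF that], of "x - y"] by metis
  then show ?thesis by (simp add: periodic_def supconv_def)
qed

text \<open>A one-step bound with quadratic error, iterated along ever finer subdivisions, loses the error.\<close>

lemma iterate_quadratic_bound:
  fixes w :: "'a::real_normed_vector \<Rightarrow> real"
  assumes step: "\<And>y z. w y - K * norm z - C * (norm z)\<^sup>2 \<le> w (y - z)"
  shows "w y - K * norm z \<le> w (y - z)"
proof -
  have iter: "w y - real k * (K * norm h + C * (norm h)\<^sup>2) \<le> w (y - real k *\<^sub>R h)" for k h
  proof (induction k)
    case (Suc k)
    have "w (y - real k *\<^sub>R h) - K * norm h - C * (norm h)\<^sup>2 \<le> w (y - real k *\<^sub>R h - h)"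
      by (rule step)
    moreover have "y - real k *\<^sub>R h - h = y - real (Suc k) *\<^sub>R h" by (simp add: algebra_simps)
    ultimately show ?case using Suc by (simp add: algebra_simps)
  qed simp
  have "w y - K * norm z - C * (norm z)\<^sup>2 * inverse (real (Suc n)) \<le> w (y - z)" for n
  proof -
    define m where "m = real (Suc n)"
    have m: "m > 0" by (simp add: m_def)
    have "w y - m * (K * norm (inverse m *\<^sub>R z) + C * (norm (inverse m *\<^sub>R z))\<^sup>2) \<le> w (y - m *\<^sub>R inverse m *\<^sub>R z)"
      unfolding m_def by (rule iter)
    moreover have "m * (K * norm (inverse m *\<^sub>R z) + C * (norm (inverse m *\<^sub>R z))\<^sup>2)
        = K * norm z + C * (norm z)\<^sup>2 * inverse m"
      using m by (simp add: power2_eq_square field_simps)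
    ultimately show ?thesis unfolding m_def[symmetric] using m by (simp add: algebra_simps)
  qed
  moreover have "(\<lambda>n. w y - K * norm z - C * (norm z)\<^sup>2 * inverse (real (Suc n)))
      \<longlonglongrightarrow> w y - K * norm z - C * (norm z)\<^sup>2 * 0"
    by (intro tendsto_intros LIMSEQ_inverse_real_of_nat)
  ultimately show ?thesis
    using LIMSEQ_le_const2[of _ "w y - K * norm z - C * (norm z)\<^sup>2 * 0" "w (y - z)"] by auto
qed

section \<open>Viscosity inequalities for the penalty\<close>

lemma visc_subsolution_continuous:
  "visc_subsolution \<epsilon> F c u \<Longrightarrow> continuous_on UNIV (\<lambda>x. u (coset \<epsilon> x))"
  by (simp add: visc_subsolution_def continuous_map_torus)

lemma visc_supersolution_continuous:
  "visc_supersolution \<epsilon> F c u \<Longrightarrow> continuous_on UNIV (\<lambda>x. u (coset \<epsilon> x))"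
  by (simp add: visc_supersolution_def continuous_map_torus)

text \<open>The penalty is a test function on the whole torus, so the touching neighbourhood can be
  the whole space and a global maximum needs no localization.\<close>

lemma visc_subsolution_pen:
  assumes "\<epsilon> > 0" "visc_subsolution \<epsilon> F c u"
    and max: "\<And>z. u (coset \<epsilon> z) - A * pen \<epsilon> (z - y) \<le> u (coset \<epsilon> x) - A * pen \<epsilon> (x - y)"
  shows "F (coset \<epsilon> x) (A *\<^sub>R dpen \<epsilon> (x - y)) (u (coset \<epsilon> x)) \<le> c"
proof -
  obtain \<phi> d\<phi> where \<phi>: "torus_C1 \<epsilon> \<phi> d\<phi>" "\<And>x. \<phi> (coset \<epsilon> x) = A * pen \<epsilon> (x - y)"
    "\<And>x. d\<phi> (coset \<epsilon> x) = A *\<^sub>R dpen \<epsilon> (x - y)"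
    using torus_C1_pen[OF assms(1), where A = A and y = y] by blast
  have "openin (torus \<epsilon>) (range (coset \<epsilon>))"
    by (metis openin_topspace topspace_torus)
  moreover have "\<forall>Y\<in>range (coset \<epsilon>). u Y - \<phi> Y \<le> u (coset \<epsilon> x) - \<phi> (coset \<epsilon> x)"
    using max by (auto simp: \<phi>(2))
  ultimately have "F (coset \<epsilon> x) (d\<phi> (coset \<epsilon> x)) (u (coset \<epsilon> x)) \<le> c"
    using assms(2) \<phi>(1) unfolding visc_subsolution_def by blast
  then show ?thesis by (simp add: \<phi>(3))
qed

lemma visc_supersolution_pen:
  assumes "\<epsilon> > 0" "visc_supersolution \<epsilon> F c u"
    and max: "\<And>z. u (coset \<epsilon> x) + A * pen \<epsilon> (x - y) \<le> u (coset \<epsilon> z) + A * pen \<epsilon> (z - y)"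
  shows "c \<le> F (coset \<epsilon> x) (- (A *\<^sub>R dpen \<epsilon> (x - y))) (u (coset \<epsilon> x))"
proof -
  obtain \<phi> d\<phi> where \<phi>: "torus_C1 \<epsilon> \<phi> d\<phi>" "\<And>x. \<phi> (coset \<epsilon> x) = (- A) * pen \<epsilon> (x - y)"
    "\<And>x. d\<phi> (coset \<epsilon> x) = (- A) *\<^sub>R dpen \<epsilon> (x - y)"
    using torus_C1_pen[OF assms(1), where A = "- A" and y = y] by blast
  have "openin (torus \<epsilon>) (range (coset \<epsilon>))"
    by (metis openin_topspace topspace_torus)
  moreover have "\<forall>Y\<in>range (coset \<epsilon>). u (coset \<epsilon> x) - \<phi> (coset \<epsilon> x) \<le> u Y - \<phi> Y"
    using max by (auto simp: \<phi>(2))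
  ultimately have "c \<le> F (coset \<epsilon> x) (d\<phi> (coset \<epsilon> x)) (u (coset \<epsilon> x))"
    using assms(2) \<phi>(1) unfolding visc_supersolution_def by blast
  then show ?thesis by (simp add: \<phi>(3))
qed

text \<open>At each point the subgradient of the sup-convolution is a momentum admissible for
  \<open>u\<close> at the maximizer, so it is bounded by \<open>K\<close>. Semiconvexity turns this
  into a one-step bound with quadratic error, and \<open>iterate_quadratic_bound\<close> into a
  Lipschitz bound with constant \<open>K\<close> whatever \<open>A\<close> is. Taking
  \<open>A\<close> large transfers it to \<open>u\<close>, without differentiability almost
  everywhere.\<close>

lemma visc_subsolution_lipschitz:
  fixes u :: "(real ^ 'n) set \<Rightarrow> real"
  assumes "\<epsilon> > 0" "visc_subsolution \<epsilon> F c u"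
    and K: "\<And>x p. F (coset \<epsilon> x) p (u (coset \<epsilon> x)) \<le> c \<Longrightarrow> norm p \<le> K"
  shows "\<bar>u (coset \<epsilon> x) - u (coset \<epsilon> y)\<bar> \<le> K * norm (x - y)"
proof -
  define f where "f = (\<lambda>x. u (coset \<epsilon> x))"
  have f: "periodic \<epsilon> f" "continuous_on UNIV f"
    using periodic_coset visc_subsolution_continuous[OF assms(2)] by (auto simp: f_def)
  note sc = assms(1) f
  have step: "supconv \<epsilon> A f y - K * norm z - (A / 2) * (norm z)\<^sup>2 \<le> supconv \<epsilon> A f (y - z)"
    if "A \<ge> 0" for A y z
  proof -
    obtain x where x: "\<And>z. f z - A * pen \<epsilon> (z - y) \<le> f x - A * pen \<epsilon> (x - y)"
      using supconv_attained[OF sc] by blast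
    have "norm (A *\<^sub>R dpen \<epsilon> (x - y)) \<le> K"
      by (rule K, rule visc_subsolution_pen[OF assms(1,2)], rule x[unfolded f_def])
    then have "norm (A *\<^sub>R dpen \<epsilon> (x - y)) * norm z \<le> K * norm z"
      by (rule mult_right_mono) simp
    then have "(A *\<^sub>R dpen \<epsilon> (x - y)) \<bullet> z \<le> K * norm z"
      using norm_cauchy_schwarz[of "A *\<^sub>R dpen \<epsilon> (x - y)" z] by linarith
    then show ?thesis using supconv_semiconvex[OF sc that x, of z] by simp
  qed
  have le: "f y \<le> f (y - z) + K * norm z" for y z
  proof (rule field_le_epsilon)
    fix e :: real assume "e > 0"
    then obtain r where r: "r > 0" "\<And>x y. norm (x - y) < r \<Longrightarrow> dist (f x) (f y) < e"
      using periodic_uniformly_continuous1[OF sc] by blast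
    obtain A where A: "A > 0"
      "\<And>y. \<exists>x. norm (x - y) < r \<and> (\<forall>z. f z - A * pen \<epsilon> (z - y) \<le> f x - A * pen \<epsilon> (x - y))"
      using supconv_near[OF sc r(1)] by (metis order_refl)
    obtain x where x: "norm (x - (y - z)) < r"
      "\<And>z'. f z' - A * pen \<epsilon> (z' - (y - z)) \<le> f x - A * pen \<epsilon> (x - (y - z))" using A(2) by blast
    have "supconv \<epsilon> A f y - K * norm z \<le> supconv \<epsilon> A f (y - z)"
      by (rule iterate_quadratic_bound[where C = "A / 2"]) (use step A(1) in auto)
    moreover have "f y \<le> supconv \<epsilon> A f y" by (rule supconv_ge[OF sc])
    moreover have "supconv \<epsilon> A f (y - z) \<le> f x"
      unfolding supconv_eqI[OF x(2)] using A(1) pen_nonneg[of \<epsilon> "x - (y - z)"] by simp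
    moreover have "f x \<le> f (y - z) + e"
      using r(2)[OF x(1)] by (simp add: dist_real_def)
    ultimately show "f y \<le> f (y - z) + K * norm z + e" by linarith
  qed
  show ?thesis
    using le[of x "x - y"] le[of y "y - x"] by (simp add: f_def norm_minus_commute)
qed

section \<open>Coercive convex Hamiltonians on the torus\<close>

text \<open>Dependence on the unknown enters only through monotonicity, so that the Hamiltonian with
  the unknown frozen at \<open>\<theta>\<close> is again an instance; comparison and the cell
  problem share this locale.\<close>

locale torus_hamiltonian =
  fixes \<epsilon> :: real and F :: "(real ^ 'n) set \<Rightarrow> real ^ 'n \<Rightarrow> real \<Rightarrow> real"
  assumes eps: "\<epsilon> > 0"
    and cont: "continuous_on UNIV (\<lambda>(x, p, s). F (coset \<epsilon> x) p s)"
    and convex: "convex_on UNIV (\<lambda>p. F (coset \<epsilon> x) p s)"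
    and superlinear: "filterlim (\<lambda>p. F (coset \<epsilon> x) p s / norm p) at_top at_infinity"
    and mono: "s \<le> t \<Longrightarrow> F (coset \<epsilon> x) p s \<le> F (coset \<epsilon> x) p t"
begin

abbreviation q :: "real ^ 'n \<Rightarrow> (real ^ 'n) set" where "q \<equiv> coset \<epsilon>"

lemma continuous_on_F:
  assumes "continuous_on S f" "continuous_on S g" "continuous_on S h"
  shows "continuous_on S (\<lambda>z. F (q (f z)) (g z) (h z))"
  using continuous_on_compose2[OF cont continuous_on_Pair[OF assms(1) continuous_on_Pair[OF assms(2,3)]]]
  by simp

text \<open>Superlinearity is assumed pointwise in \<open>(x, s)\<close>; convexity and compactness
  make it locally uniform. Given a sequence of counterexamples with momenta tending to infinity,
  base points, directions and values converge along a subsequence, and the limit ray contradicts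
  superlinearity at the limit point.\<close>

lemma uniformly_superlinear:
  obtains R where "R > 0" "\<And>x p s. \<bar>s\<bar> \<le> B \<Longrightarrow> R \<le> norm p \<Longrightarrow> A * norm p \<le> F (q x) p s"
proof (rule ccontr)
  note witness = that
  assume "\<not> thesis"
  then have neg: "\<exists>x p s. \<bar>s\<bar> \<le> B \<and> R \<le> norm p \<and> F (q x) p s < A * norm p" if "R > 0" for R
    using that witness[of R] by (meson linorder_not_le)
  have "\<exists>x p s. x \<in> fundamental_box \<epsilon> \<and> \<bar>s\<bar> \<le> B \<and> real (Suc n) \<le> norm p \<and> F (q x) p s < A * norm p" for n
  proof -
    obtain x p s where *: "\<bar>s\<bar> \<le> B" "real (Suc n) \<le> norm p" "F (q x) p s < A * norm p"
      using neg[of "real (Suc n)"] by auto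
    obtain k where k: "k \<in> lattice" "x + \<epsilon> *\<^sub>R k \<in> fundamental_box \<epsilon>"
      using fundamental_box_shift[OF eps] by blast
    show ?thesis using * k coset_shift[OF k(1)] by (intro exI[of _ "x + \<epsilon> *\<^sub>R k"] exI[of _ p] exI[of _ s]) auto
  qed
  then obtain X P S where XPS: "\<And>n. X n \<in> fundamental_box \<epsilon>" "\<And>n :: nat. \<bar>S n\<bar> \<le> B"
    "\<And>n. real (Suc n) \<le> norm (P n)" "\<And>n. F (q (X n)) (P n) (S n) < A * norm (P n)"
    by metis
  define D where "D n = P n /\<^sub>R norm (P n)" for n
  have Pn: "norm (P n) > 0" for n using XPS(3)[of n] by linarith
  let ?K = "fundamental_box \<epsilon> \<times> sphere 0 1 \<times> {-B..B} :: ((real ^ 'n) \<times> (real ^ 'n) \<times> real) set"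
  have K: "compact ?K" by (intro compact_Times compact_fundamental_box) auto
  have "(X n, D n, S n) \<in> ?K" for n
    using XPS(1,2)[of n] Pn[of n] by (auto simp: D_def abs_le_iff)
  then obtain z r where z: "z \<in> ?K" "strict_mono (r :: nat \<Rightarrow> nat)"
    "(\<lambda>n. (X (r n), D (r n), S (r n))) \<longlonglongrightarrow> z"
    by (rule compact_subseqE[OF K])
  obtain x d s where zz: "z = (x, d, s)" using prod_cases3 by blast
  have "compact ((\<lambda>(x, s). F (q x) 0 s) ` (fundamental_box \<epsilon> \<times> {-B..B}))"
    unfolding case_prod_beta
    by (intro compact_continuous_image continuous_on_F continuous_on_fst continuous_on_snd
        continuous_on_id continuous_on_const compact_Times compact_fundamental_box) auto
  from compact_imp_bounded[OF this] obtain C where C: "C > 0"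
    "\<forall>z \<in> (\<lambda>(x, s). F (q x) 0 s) ` (fundamental_box \<epsilon> \<times> {-B..B}). norm z \<le> C"
    unfolding bounded_pos by (elim exE conjE)
  have C': "\<bar>F (q (X n)) 0 (S n)\<bar> \<le> C" for n
  proof -
    have "F (q (X n)) 0 (S n) \<in> (\<lambda>(x, s). F (q x) 0 s) ` (fundamental_box \<epsilon> \<times> {-B..B})"
      using XPS(1,2)[of n] by (intro image_eqI[of _ _ "(X n, S n)"]) (auto simp: abs_le_iff)
    with C(2) have "norm (F (q (X n)) 0 (S n)) \<le> C" by (rule bspec)
    then show ?thesis by simp
  qed
  \<comment> \<open>For fixed \<open>t\<close> the point \<open>t *\<^sub>R D m\<close> lies on the
    segment from 0 to \<open>P m\<close> once \<open>P m\<close> is long. Convexity bounds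
    \<open>F\<close> there by the values at the ends, and the bound survives the limit by
    continuity. Growth at rate \<open>A + C + 1\<close> along the ray then gives the
    contradiction.\<close>
  have bound: "F (q x) (t *\<^sub>R d) s \<le> C + t * A" if t: "t > 0" for t
  proof -
    have "isCont (\<lambda>(x, p, s). F (q x) (t *\<^sub>R p) s) z"
      unfolding case_prod_beta
      by (rule continuous_on_interior[of UNIV])
        (auto intro!: continuous_on_F continuous_on_fst continuous_on_snd continuous_on_id continuous_on_scaleR continuous_on_const)
    then have "(\<lambda>n. F (q (X (r n))) (t *\<^sub>R D (r n)) (S (r n))) \<longlonglongrightarrow> F (q x) (t *\<^sub>R d) s"
      using isCont_tendsto_compose[OF _ z(3), of "\<lambda>(x, p, s). F (q x) (t *\<^sub>R p) s"] by (simp add: zz o_def)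
    moreover have "\<forall>\<^sub>F n in sequentially. F (q (X (r n))) (t *\<^sub>R D (r n)) (S (r n)) \<le> C + t * A"
    proof -
      have "\<forall>\<^sub>F n in sequentially. t \<le> real n" by (rule eventually_ge_at_top[of "nat \<lceil>t\<rceil>", THEN eventually_mono]) linarith
      then show ?thesis
      proof eventually_elim
        case (elim n)
        define m where "m = r n"
        have "n \<le> m" using seq_suble[OF z(2)] by (simp add: m_def)
        then have tP: "t \<le> norm (P m)" using elim XPS(3)[of m] by linarith
        define l where "l = t / norm (P m)"
        have l: "0 \<le> l" "l \<le> 1" using tP t Pn[of m] by (auto simp: l_def)
        have e: "t *\<^sub>R D m = (1 - l) *\<^sub>R 0 + l *\<^sub>R P m" by (simp add: D_def l_def divide_inverse)
        have "F (q (X m)) (t *\<^sub>R D m) (S m) \<le> (1 - l) * F (q (X m)) 0 (S m) + l * F (q (X m)) (P m) (S m)"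
          unfolding e by (rule convex_onD[OF convex l]) auto
        also have "\<dots> \<le> (1 - l) * C + l * (A * norm (P m))"
          using l C'[of m] XPS(4)[of m] by (intro add_mono mult_left_mono) auto
        also have "l * (A * norm (P m)) = t * A" using Pn[of m] by (simp add: l_def)
        also have "(1 - l) * C \<le> C" using l C(1) by (simp add: algebra_simps)
        finally show ?case by (simp add: m_def)
      qed
    qed
    ultimately show ?thesis by (rule tendsto_upperbound) simp
  qed
  have d: "norm d = 1" using z(1) by (simp add: zz)
  have "\<forall>\<^sub>F p in at_infinity. A + C + 1 \<le> F (q x) p s / norm p"
    using superlinear[of x s] by (simp add: filterlim_at_top)
  then obtain b where b: "\<And>p. b \<le> norm p \<Longrightarrow> A + C + 1 \<le> F (q x) p s / norm p"
    by (auto simp: eventually_at_infinity)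
  define t where "t = max b 1"
  have t: "t \<ge> 1" "b \<le> t" by (auto simp: t_def)
  then have "A + C + 1 \<le> F (q x) (t *\<^sub>R d) s / t" using b[of "t *\<^sub>R d"] d by simp
  then have "t * (A + C + 1) \<le> F (q x) (t *\<^sub>R d) s" using t by (simp add: field_simps)
  also have "\<dots> \<le> C + t * A" using bound t by simp
  finally have "t * C + t \<le> C" by (simp add: algebra_simps)
  moreover have "C \<le> t * C" using t C(1) by simp
  ultimately show False using t by linarith
qed

lemma coercive:
  obtains R where "R > 0" "\<And>x p s. \<bar>s\<bar> \<le> B \<Longrightarrow> F (q x) p s \<le> c \<Longrightarrow> norm p \<le> R"
proof -
  obtain R where R: "R > 0" "\<And>x p s. \<bar>s\<bar> \<le> B \<Longrightarrow> R \<le> norm p \<Longrightarrow> 1 * norm p \<le> F (q x) p s"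
    using uniformly_superlinear[of B 1] by blast
  have "norm p \<le> max R c" if "\<bar>s\<bar> \<le> B" "F (q x) p s \<le> c" for x p s
  proof (cases "R \<le> norm p")
    case True
    then show ?thesis using R(2)[OF that(1) True, of x] that(2) by simp
  qed simp
  then show ?thesis using that[of "max R c"] R(1) by simp
qed

lemma F_uniformly_continuous:
  assumes "e > 0"
  obtains r where "r > 0" "\<And>x y p s t. norm (x - y) < r \<Longrightarrow> norm p \<le> R \<Longrightarrow> \<bar>s\<bar> \<le> B \<Longrightarrow> \<bar>t\<bar> \<le> B \<Longrightarrow> \<bar>s - t\<bar> < r
     \<Longrightarrow> \<bar>F (q x) p s - F (q y) p t\<bar> < e"
proof -
  let ?f = "\<lambda>x (p, s). F (q x) p s" and ?Q = "cball 0 R \<times> {-B..B} :: ((real ^ 'n) \<times> real) set"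
  have c: "continuous_on (UNIV \<times> ?Q) (\<lambda>(x, a). ?f x a)"
    using continuous_on_subset[OF cont subset_UNIV] by (simp add: case_prod_beta)
  have "periodic \<epsilon> ?f" by (simp add: periodic_def coset_shift)
  moreover have "compact ?Q" by (intro compact_Times) auto
  ultimately obtain r where r: "r > 0" "\<And>x y a b. norm (x - y) < r \<Longrightarrow> a \<in> ?Q \<Longrightarrow> b \<in> ?Q \<Longrightarrow> dist a b < r
     \<Longrightarrow> dist (?f x a) (?f y b) < e"
    using periodic_uniformly_continuous[OF eps _ c _ assms] by metis
  have "\<bar>F (q x) p s - F (q y) p t\<bar> < e"
    if "norm (x - y) < r" "norm p \<le> R" "\<bar>s\<bar> \<le> B" "\<bar>t\<bar> \<le> B" "\<bar>s - t\<bar> < r" for x y p s t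
  proof -
    have "dist (p, s) (p, t) < r" using that(5) by (simp add: dist_Pair_Pair dist_real_def)
    then show ?thesis
      using r(2)[OF that(1), of "(p, s)" "(p, t)"] that by (simp add: dist_real_def abs_le_iff)
  qed
  then show ?thesis using that r(1) by blast
qed

text \<open>At a maximum of the doubled function the same momentum is tested at both points, since
  \<open>dpen\<close> is odd. The subsolution inequality bounds it by coercivity, so
  \<open>F\<close> is uniformly continuous on the relevant set, and the gap \<open>b - a\<close>
  absorbs the error caused by the distance of the two points. A fixed large penalty suffices; no
  limit is taken.\<close>

lemma visc_comparison:
  assumes u: "visc_subsolution \<epsilon> F a u" and v: "visc_supersolution \<epsilon> F b v" and "a < b"
  shows "u (q x0) \<le> v (q x0)"
proof (rule ccontr)
  assume neg: "\<not> ?thesis"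
  note cu = visc_subsolution_continuous[OF u] and cv = visc_supersolution_continuous[OF v]
  obtain B1 where B1: "B1 > 0" "\<And>x. norm (u (q x)) \<le> B1"
    using periodic_bounded1[OF eps periodic_coset cu] by blast
  obtain B2 where B2: "B2 > 0" "\<And>x. norm (v (q x)) \<le> B2"
    using periodic_bounded1[OF eps periodic_coset cv] by blast
  define B where "B = max B1 B2"
  have B: "B > 0" "\<And>x. \<bar>u (q x)\<bar> \<le> B" "\<And>x. \<bar>v (q x)\<bar> \<le> B"
    using B1 B2 by (auto simp: B_def le_max_iff_disj)
  obtain R where R: "R > 0" "\<And>x p s. \<bar>s\<bar> \<le> B \<Longrightarrow> F (q x) p s \<le> a \<Longrightarrow> norm p \<le> R"
    using coercive[of B a] by blast
  obtain r where r: "r > 0" "\<And>x y p s t. norm (x - y) < r \<Longrightarrow> norm p \<le> R \<Longrightarrow> \<bar>s\<bar> \<le> B \<Longrightarrow> \<bar>t\<bar> \<le> B \<Longrightarrow> \<bar>s - t\<bar> < r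
     \<Longrightarrow> \<bar>F (q x) p s - F (q y) p t\<bar> < b - a"
    using F_uniformly_continuous[of "b - a" R B] assms(3) by auto
  obtain d where d: "d > 0" "\<And>z :: real ^ 'n. pen \<epsilon> z < d \<Longrightarrow> \<exists>k\<in>lattice. norm (z + \<epsilon> *\<^sub>R k) < r"
    using pen_small[OF eps r(1)] by blast
  \<comment> \<open>Positivity of the maximum bounds \<open>A * pen \<epsilon> (x - y)\<close> by
    \<open>2 * B\<close>, which is strictly below \<open>3 * B = A * d\<close>.\<close>
  define A where "A = 3 * B / d"
  have A: "A > 0" using B d by (simp add: A_def)
  define \<Phi> where "\<Phi> = (\<lambda>(x, y). u (q x) - v (q y) - A * pen \<epsilon> (x - y))"
  have \<Phi>per: "\<Phi> (x + \<epsilon> *\<^sub>R k, y + \<epsilon> *\<^sub>R l) = \<Phi> (x, y)" if "k \<in> lattice" "l \<in> lattice" for x y k l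
  proof -
    have "k - l \<in> lattice" using that by (simp add: lattice_def)
    moreover have "x + \<epsilon> *\<^sub>R k - (y + \<epsilon> *\<^sub>R l) = x - y + \<epsilon> *\<^sub>R (k - l)" by (simp add: algebra_simps)
    ultimately have "pen \<epsilon> (x + \<epsilon> *\<^sub>R k - (y + \<epsilon> *\<^sub>R l)) = pen \<epsilon> (x - y)"
      using periodicD[OF periodic_pen[OF eps], of "k - l" "x - y"] by metis
    then show ?thesis using coset_shift[OF that(1)] coset_shift[OF that(2)] by (simp add: \<Phi>_def)
  qed
  have "continuous_on UNIV \<Phi>"
    unfolding \<Phi>_def case_prod_beta
    by (intro continuous_on_diff continuous_on_mult continuous_on_const continuous_on_pen
        continuous_on_compose2[OF cu] continuous_on_compose2[OF cv] continuous_on_fst continuous_on_snd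
        continuous_on_id) auto
  then have c\<Phi>: "continuous_on (fundamental_box \<epsilon> \<times> fundamental_box \<epsilon>) \<Phi>"
    by (rule continuous_on_subset) simp
  have "fundamental_box \<epsilon> \<noteq> ({} :: (real ^ 'n) set)"
    using fundamental_box_shift[OF eps] by (metis empty_iff)
  then have "fundamental_box \<epsilon> \<times> fundamental_box \<epsilon> \<noteq> ({} :: ((real ^ 'n) \<times> (real ^ 'n)) set)" by simp
  from continuous_attains_sup[OF compact_Times[OF compact_fundamental_box compact_fundamental_box] this c\<Phi>]
  obtain z0 where z0: "\<And>z. z \<in> fundamental_box \<epsilon> \<times> fundamental_box \<epsilon> \<Longrightarrow> \<Phi> z \<le> \<Phi> z0"
    by blast
  obtain x y where xy: "z0 = (x, y)" by (cases z0)
  have max: "\<Phi> (x', y') \<le> \<Phi> (x, y)" for x' y'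
  proof -
    obtain k where k: "k \<in> lattice" "x' + \<epsilon> *\<^sub>R k \<in> fundamental_box \<epsilon>"
      using fundamental_box_shift[OF eps] by blast
    obtain l where l: "l \<in> lattice" "y' + \<epsilon> *\<^sub>R l \<in> fundamental_box \<epsilon>"
      using fundamental_box_shift[OF eps] by blast
    show ?thesis using z0[of "(x' + \<epsilon> *\<^sub>R k, y' + \<epsilon> *\<^sub>R l)"] k l \<Phi>per[OF k(1) l(1)] by (simp add: xy)
  qed
  let ?p = "A *\<^sub>R dpen \<epsilon> (x - y)"
  have pos: "0 < u (q x) - v (q y) - A * pen \<epsilon> (x - y)"
    using max[of x0 x0] neg by (simp add: \<Phi>_def)
  have sub: "F (q x) ?p (u (q x)) \<le> a"
  proof (rule visc_subsolution_pen[OF eps u])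
    fix z show "u (q z) - A * pen \<epsilon> (z - y) \<le> u (q x) - A * pen \<epsilon> (x - y)"
      using max[of z y] by (simp add: \<Phi>_def)
  qed
  have "b \<le> F (q y) (- (A *\<^sub>R dpen \<epsilon> (y - x))) (v (q y))"
  proof (rule visc_supersolution_pen[OF eps v])
    fix z show "v (q y) + A * pen \<epsilon> (y - x) \<le> v (q z) + A * pen \<epsilon> (z - x)"
      using max[of x z] by (simp add: \<Phi>_def pen_commute[of \<epsilon> x])
  qed
  also have "- (A *\<^sub>R dpen \<epsilon> (y - x)) = ?p" using dpen_uminus[of \<epsilon> "x - y"] by simp
  \<comment> \<open>Monotonicity in the unknown enters here: at the maximum \<open>v\<close> is less
    than \<open>u\<close>, so both inequalities can be read at the value of
    \<open>u\<close>.\<close>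
  also have "F (q y) ?p (v (q y)) \<le> F (q y) ?p (u (q x))"
    using pos A pen_nonneg[of \<epsilon> "x - y"] by (intro mono) (smt (verit) mult_nonneg_nonneg)
  finally have super: "b \<le> F (q y) ?p (u (q x))" .
  have "A * pen \<epsilon> (x - y) < 3 * B" using pos B(2)[of x] B(3)[of y] B(1) by linarith
  then have "pen \<epsilon> (x - y) < d" using A d(1) B(1) by (simp add: A_def field_simps)
  then obtain k where k: "k \<in> lattice" "norm (x - y + \<epsilon> *\<^sub>R k) < r" using d(2) by blast
  have "norm ?p \<le> R" using R(2)[OF B(2) sub] .
  then have "\<bar>F (q (x + \<epsilon> *\<^sub>R k)) ?p (u (q x)) - F (q y) ?p (u (q x))\<bar> < b - a"
    using r k(2) B by (intro r(2)) (auto simp: diff_add_eq)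
  then show False using sub super coset_shift[OF k(1)] by simp
qed

end

section \<open>Perron's method and the cell problem\<close>

text \<open>Within a quarter period of the origin the lattice vector provided by
  \<open>pen_small\<close> has norm less than 1, hence is 0. So the penalty controls the distance
  itself inside a small ball.\<close>

lemma pen_small_near:
  assumes "\<epsilon> > 0" "\<rho> > 0"
  obtains d where "d > 0" "\<And>z :: real ^ 'n. norm z \<le> \<epsilon> / 4 \<Longrightarrow> pen \<epsilon> z < d \<Longrightarrow> norm z < \<rho>"
proof -
  obtain d where d: "d > 0" "\<And>z :: real ^ 'n. pen \<epsilon> z < d \<Longrightarrow> \<exists>k\<in>lattice. norm (z + \<epsilon> *\<^sub>R k) < min \<rho> (\<epsilon> / 4)"
    by (rule pen_small[of \<epsilon> "min \<rho> (\<epsilon> / 4)"]) (use assms in auto)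
  have "norm z < \<rho>" if z: "norm z \<le> \<epsilon> / 4" "pen \<epsilon> z < d" for z :: "real ^ 'n"
  proof -
    obtain k where k: "k \<in> lattice" "norm (z + \<epsilon> *\<^sub>R k) < min \<rho> (\<epsilon> / 4)" using d(2)[OF z(2)] by blast
    have "norm (\<epsilon> *\<^sub>R k) \<le> norm (z + \<epsilon> *\<^sub>R k) + norm z"
      using norm_triangle_ineq4[of "z + \<epsilon> *\<^sub>R k" z] by simp
    moreover have "norm (\<epsilon> *\<^sub>R k) = norm k * \<epsilon>" using assms(1) by simp
    ultimately have "norm k * \<epsilon> < 1 * \<epsilon>" using k(2) z(1) assms(1) by linarith
    then have nk: "norm k < 1" using assms(1) by (simp only: mult_less_cancel_right_pos)
    have "k $ i = 0" for i
    proof -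
      have "k $ i \<in> \<int>" using k(1) by (simp add: lattice_def)
      moreover have "\<bar>k $ i\<bar> < 1" using component_le_norm_cart[of k i] nk by linarith
      ultimately show ?thesis using Ints_nonzero_abs_less1 by blast
    qed
    then have "k = 0" by (simp add: vec_eq_iff)
    then show ?thesis using k(2) by simp
  qed
  then show ?thesis using that d(1) by blast
qed

section \<open>Calculus of test functions, and stability of viscosity subsolutions\<close>

lemma torus_C1_add:
  "torus_C1 \<epsilon> f df \<Longrightarrow> torus_C1 \<epsilon> g dg \<Longrightarrow> torus_C1 \<epsilon> (\<lambda>X. f X + g X) (\<lambda>X. df X + dg X)"
  unfolding torus_C1_def continuous_map_torus by (elim conjE, intro conjI allI GDERIV_add continuous_on_add; simp)

lemma torus_C1_uminus:
  "torus_C1 \<epsilon> f df \<Longrightarrow> torus_C1 \<epsilon> (\<lambda>X. - f X) (\<lambda>X. - df X)"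
  unfolding torus_C1_def continuous_map_torus by (elim conjE, intro conjI allI GDERIV_minus continuous_on_minus; simp)

lemma torus_C1_diff:
  "torus_C1 \<epsilon> f df \<Longrightarrow> torus_C1 \<epsilon> g dg \<Longrightarrow> torus_C1 \<epsilon> (\<lambda>X. f X - g X) (\<lambda>X. df X - dg X)"
  unfolding torus_C1_def continuous_map_torus by (elim conjE, intro conjI allI GDERIV_diff continuous_on_diff; simp)

lemma torus_C1_const: "torus_C1 \<epsilon> (\<lambda>X. c) (\<lambda>X. 0)"
  unfolding torus_C1_def continuous_map_torus by (simp add: GDERIV_const)

lemma torus_C1_continuous:
  assumes "torus_C1 \<epsilon> f df"
  shows "continuous_on UNIV (\<lambda>x. f (coset \<epsilon> x))" "continuous_on UNIV (\<lambda>x. df (coset \<epsilon> x))"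
proof -
  show "continuous_on UNIV (\<lambda>x. df (coset \<epsilon> x))"
    using assms by (simp add: torus_C1_def continuous_map_torus)
  have "((\<lambda>x. f (coset \<epsilon> x)) has_derivative (\<lambda>h. h \<bullet> df (coset \<epsilon> x))) (at x)" for x
    using assms by (simp add: torus_C1_def gderiv_def)
  then show "continuous_on UNIV (\<lambda>x. f (coset \<epsilon> x))"
    by (intro continuous_at_imp_continuous_on ballI has_derivative_continuous)
qed

lemma torus_C1_touching_gradient:
  assumes f: "torus_C1 \<epsilon> f df" and g: "torus_C1 \<epsilon> g dg" and U: "openin (torus \<epsilon>) U" "X \<in> U"
    and max: "\<And>Y. Y \<in> U \<Longrightarrow> f Y - g Y \<le> f X - g X"
  shows "df X = dg X"
proof -
  obtain x where x: "X = coset \<epsilon> x" using U openin_torus by blast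
  define V where "V = coset \<epsilon> -` U"
  have V: "open V" "x \<in> V" using U by (auto simp: V_def openin_torus x)
  have d: "((\<lambda>y. f (coset \<epsilon> y) - g (coset \<epsilon> y)) has_derivative (\<lambda>h. h \<bullet> (df X - dg X))) (at x)"
    using torus_C1_diff[OF f g] by (simp add: torus_C1_def gderiv_def x)
  have "(\<lambda>h. h \<bullet> (df X - dg X)) = (\<lambda>h. 0)"
    by (rule differential_zero_maxmin[OF V(2,1) d]) (use max in \<open>auto simp: V_def x\<close>)
  then have "(df X - dg X) \<bullet> (df X - dg X) = 0" by meson
  then show ?thesis by simp
qed

text \<open>The hypotheses serve two uses: in Perron's method \<open>l\<close> and \<open>a\<close>
  are constant and the sequence approaches the supremum only at the touching point; for the
  vanishing discount \<open>l\<close> tends to 0 and convergence is uniform. An upper bound uniform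
  in space together with convergence at \<open>x0\<close> covers both.\<close>

lemma visc_subsolution_stability:
  fixes G :: "(real ^ 'n) set \<Rightarrow> real ^ 'n \<Rightarrow> real"
  assumes "\<epsilon> > 0" and G: "continuous_on UNIV (\<lambda>(x, p). G (coset \<epsilon> x) p)"
    and sub: "\<And>n. visc_subsolution \<epsilon> (\<lambda>X p s. l n * s + G X p - a n) 0 (w n)"
    and l: "l \<longlonglongrightarrow> l0" and a: "a \<longlonglongrightarrow> a0"
    and u: "continuous_on UNIV (\<lambda>x. u (coset \<epsilon> x))"
    and le: "\<And>e. e > 0 \<Longrightarrow> \<forall>\<^sub>F n in sequentially. \<forall>x. w n (coset \<epsilon> x) \<le> u (coset \<epsilon> x) + e"
    and lim: "(\<lambda>n. w n (coset \<epsilon> x0)) \<longlonglongrightarrow> u (coset \<epsilon> x0)"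
    and \<phi>: "torus_C1 \<epsilon> \<phi> d\<phi>" and U: "openin (torus \<epsilon>) U" "coset \<epsilon> x0 \<in> U"
    and touch: "\<And>Y. Y \<in> U \<Longrightarrow> u Y - \<phi> Y \<le> u (coset \<epsilon> x0) - \<phi> (coset \<epsilon> x0)"
  shows "l0 * u (coset \<epsilon> x0) + G (coset \<epsilon> x0) (d\<phi> (coset \<epsilon> x0)) - a0 \<le> 0"
proof -
  let ?q = "coset \<epsilon>"
  have "open (?q -` U)" "x0 \<in> ?q -` U" using U by (auto simp: openin_torus)
  then obtain r0 where r0: "r0 > 0" "ball x0 r0 \<subseteq> ?q -` U" by (meson open_contains_ball)
  define r where "r = min (r0 / 2) (\<epsilon> / 4)"
  have r: "r > 0" "r \<le> \<epsilon> / 4" "cball x0 r \<subseteq> ?q -` U" using r0 assms(1) by (auto simp: r_def)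
  \<comment> \<open>Adding the penalty makes the touching strict, which forces the maximizers
    \<open>y n\<close> to converge to \<open>x0\<close>. Its gradient vanishes at \<open>x0\<close>,
    so the limit inequality involves \<open>d\<phi>\<close> alone.\<close>
  obtain \<psi> d\<psi> where \<psi>: "torus_C1 \<epsilon> \<psi> d\<psi>" "\<And>x. \<psi> (?q x) = 1 * pen \<epsilon> (x - x0)"
    "\<And>x. d\<psi> (?q x) = 1 *\<^sub>R dpen \<epsilon> (x - x0)"
    by (rule torus_C1_pen[OF assms(1), of 1 x0]) blast
  note \<phi>\<psi> = torus_C1_add[OF \<phi> \<psi>(1)]
  have cw: "continuous_on UNIV (\<lambda>x. w n (?q x))" for n by (rule visc_subsolution_continuous[OF sub])
  have "\<exists>y\<in>cball x0 r. \<forall>z\<in>cball x0 r. w n (?q z) - (\<phi> (?q z) + \<psi> (?q z)) \<le> w n (?q y) - (\<phi> (?q y) + \<psi> (?q y))" for n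
    using r(1) by (intro continuous_attains_sup compact_cball continuous_on_diff
        continuous_on_subset[OF cw] continuous_on_subset[OF torus_C1_continuous(1)[OF \<phi>\<psi>]]) auto
  then obtain y where y: "\<And>n. y n \<in> cball x0 r"
    "\<And>n z. z \<in> cball x0 r \<Longrightarrow> w n (?q z) - (\<phi> (?q z) + \<psi> (?q z)) \<le> w n (?q (y n)) - (\<phi> (?q (y n)) + \<psi> (?q (y n)))"
    by metis
  have yU: "?q (y n) \<in> U" for n using y(1) r(3) by blast
  have pen_le: "\<forall>\<^sub>F n in sequentially. pen \<epsilon> (y n - x0) < d" if "d > 0" for d
  proof -
    have "\<forall>\<^sub>F n in sequentially. u (?q x0) - d / 2 < w n (?q x0)"
      using that by (intro order_tendstoD(1)[OF lim]) simp
    moreover have "\<forall>\<^sub>F n in sequentially. \<forall>x. w n (?q x) \<le> u (?q x) + d / 2" using that by (intro le) simp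
    ultimately show ?thesis
    proof eventually_elim
      case (elim n)
      have "x0 \<in> cball x0 r" using r(1) by simp
      from y(2)[OF this, of n] show ?case
        using elim(1) spec[OF elim(2), of "y n"] touch[OF yU[of n]] by (simp add: \<psi>)
    qed
  qed
  have ylim: "y \<longlonglongrightarrow> x0"
  proof (rule tendstoI)
    fix \<rho> :: real assume "\<rho> > 0"
    obtain d where d: "d > 0" "\<And>z :: real ^ 'n. norm z \<le> \<epsilon> / 4 \<Longrightarrow> pen \<epsilon> z < d \<Longrightarrow> norm z < \<rho>"
      by (rule pen_small_near[OF assms(1) \<open>\<rho> > 0\<close>]) blast
    show "\<forall>\<^sub>F n in sequentially. dist (y n) x0 < \<rho>"
      using pen_le[OF d(1)]
    proof eventually_elim
      case (elim n)
      have "norm (y n - x0) \<le> \<epsilon> / 4" using y(1)[of n] r(2) by (simp add: dist_norm norm_minus_commute)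
      then show ?case using d(2) elim by (simp add: dist_norm)
    qed
  qed
  note cont_lim = continuous_on_tendsto_compose[OF _ ylim UNIV_I always_eventually, simplified]
  have cu: "(\<lambda>n. u (?q (y n))) \<longlonglongrightarrow> u (?q x0)" by (rule cont_lim[OF u])
  have c\<phi>: "(\<lambda>n. \<phi> (?q (y n)) + \<psi> (?q (y n))) \<longlonglongrightarrow> \<phi> (?q x0) + \<psi> (?q x0)"
    by (rule cont_lim[OF torus_C1_continuous(1)[OF \<phi>\<psi>]])
  have cd\<phi>: "(\<lambda>n. d\<phi> (?q (y n)) + d\<psi> (?q (y n))) \<longlonglongrightarrow> d\<phi> (?q x0) + d\<psi> (?q x0)"
    by (rule cont_lim[OF torus_C1_continuous(2)[OF \<phi>\<psi>]])
  \<comment> \<open>Below, maximality of \<open>y n\<close> against \<open>x0\<close> is used;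
    above, the uniform one-sided bound \<open>le\<close>. The zeroth-order term needs this
    convergence of values.\<close>
  have wlim: "(\<lambda>n. w n (?q (y n))) \<longlonglongrightarrow> u (?q x0)"
  proof (rule order_tendstoI)
    fix b assume b: "b < u (?q x0)"
    have "(\<lambda>n. w n (?q x0) + (\<phi> (?q (y n)) + \<psi> (?q (y n))) - (\<phi> (?q x0) + \<psi> (?q x0))) \<longlonglongrightarrow>
        u (?q x0) + (\<phi> (?q x0) + \<psi> (?q x0)) - (\<phi> (?q x0) + \<psi> (?q x0))"
      by (intro tendsto_diff tendsto_add[OF lim c\<phi>] tendsto_const)
    then have "\<forall>\<^sub>F n in sequentially. b < w n (?q x0) + (\<phi> (?q (y n)) + \<psi> (?q (y n))) - (\<phi> (?q x0) + \<psi> (?q x0))"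
      using b by (intro order_tendstoD(1)) auto
    then show "\<forall>\<^sub>F n in sequentially. b < w n (?q (y n))"
    proof eventually_elim
      case (elim n)
      have "x0 \<in> cball x0 r" using r(1) by simp
      from y(2)[OF this, of n] show ?case using elim by linarith
    qed
  next
    fix b assume b: "u (?q x0) < b"
    define e where "e = (b - u (?q x0)) / 2"
    have e: "e > 0" using b by (simp add: e_def)
    have "\<forall>\<^sub>F n in sequentially. u (?q (y n)) < u (?q x0) + e" using e by (intro order_tendstoD(2)[OF cu]) simp
    with le[OF e] show "\<forall>\<^sub>F n in sequentially. w n (?q (y n)) < b"
    proof eventually_elim
      case (elim n)
      have "w n (?q (y n)) \<le> u (?q (y n)) + e" using elim(1) by blast
      then show ?case using elim(2) by (simp add: e_def field_simps)
    qed
  qed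
  have "\<forall>\<^sub>F n in sequentially. dist (y n) x0 < r" by (rule tendstoD[OF ylim r(1)])
  then have ineq: "\<forall>\<^sub>F n in sequentially.
      l n * w n (?q (y n)) + G (?q (y n)) (d\<phi> (?q (y n)) + d\<psi> (?q (y n))) - a n \<le> 0"
  proof eventually_elim
    case (elim n)
    have "openin (torus \<epsilon>) (?q ` ball x0 r)" by (rule openin_coset_image) simp
    moreover have "?q (y n) \<in> ?q ` ball x0 r" using elim by (intro imageI) (simp add: dist_commute)
    moreover have "\<forall>Y\<in>?q ` ball x0 r. w n Y - (\<phi> Y + \<psi> Y) \<le> w n (?q (y n)) - (\<phi> (?q (y n)) + \<psi> (?q (y n)))"
      using y(2)[of _ n] by auto
    ultimately show ?case
      using sub[of n] \<phi>\<psi> unfolding visc_subsolution_def by blast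
  qed
  have "(\<lambda>n. (\<lambda>(x, p). G (?q x) p) (y n, d\<phi> (?q (y n)) + d\<psi> (?q (y n)))) \<longlonglongrightarrow> (\<lambda>(x, p). G (?q x) p) (x0, d\<phi> (?q x0) + d\<psi> (?q x0))"
    by (rule continuous_on_tendsto_compose[OF G tendsto_Pair[OF ylim cd\<phi>]]) auto
  then have "(\<lambda>n. G (?q (y n)) (d\<phi> (?q (y n)) + d\<psi> (?q (y n)))) \<longlonglongrightarrow> G (?q x0) (d\<phi> (?q x0))"
    by (simp add: \<psi>(3))
  then have "(\<lambda>n. l n * w n (?q (y n)) + G (?q (y n)) (d\<phi> (?q (y n)) + d\<psi> (?q (y n))) - a n)
      \<longlonglongrightarrow> l0 * u (?q x0) + G (?q x0) (d\<phi> (?q x0)) - a0"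
    by (intro tendsto_diff tendsto_add tendsto_mult l a wlim)
  then show ?thesis using ineq by (rule tendsto_upperbound) simp
qed

text \<open>Changing the sign of the function and passing to \<open>- G X (- p)\<close> exchanges
  super- and subsolutions. Stability, which is proved without convexity of \<open>G\<close>, thereby
  applies to supersolutions as well.\<close>

lemma visc_subsolution_uminus:
  assumes "visc_supersolution \<epsilon> (\<lambda>X p s. l * s + G X p - a) 0 v"
  shows "visc_subsolution \<epsilon> (\<lambda>X p s. l * s + (- G X (- p)) - (- a)) 0 (\<lambda>X. - v X)"
  unfolding visc_subsolution_def
proof (intro conjI allI impI)
  show "continuous_map (torus \<epsilon>) euclideanreal (\<lambda>X. - v X)"
    using visc_supersolution_continuous[OF assms] by (simp add: continuous_map_torus continuous_on_minus)
  fix \<phi> d\<phi> X U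
  assume *: "torus_C1 \<epsilon> \<phi> d\<phi> \<and> openin (torus \<epsilon>) U \<and> X \<in> U \<and> (\<forall>Y\<in>U. - v Y - \<phi> Y \<le> - v X - \<phi> X)"
  have "torus_C1 \<epsilon> (\<lambda>X. - \<phi> X) (\<lambda>X. - d\<phi> X)" using * by (intro torus_C1_uminus) simp
  moreover have "\<forall>Y\<in>U. v X - (- \<phi> X) \<le> v Y - (- \<phi> Y)"
  proof
    fix Y assume "Y \<in> U"
    then have "- v Y - \<phi> Y \<le> - v X - \<phi> X" using * by blast
    then show "v X - (- \<phi> X) \<le> v Y - (- \<phi> Y)" by linarith
  qed
  ultimately have "0 \<le> l * v X + G X (- d\<phi> X) - a"
    using assms * unfolding visc_supersolution_def by (elim conjE allE[of _ "\<lambda>X. - \<phi> X"] allE[of _ "\<lambda>X. - d\<phi> X"]) blast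
  then show "l * - v X + - G X (- d\<phi> X) - - a \<le> 0" by simp
qed

text \<open>Perron's method in a class that is equi-Lipschitz from the outset, so the supremum is
  continuous and semicontinuous envelopes do not occur. The constants \<open>- A / l\<close> and
  \<open>A / l\<close> are barriers. The Lipschitz bound \<open>K\<close> does not involve
  \<open>l\<close>, as the vanishing discount limit requires.\<close>

lemma discounted_solution:
  fixes G :: "(real ^ 'n) set \<Rightarrow> real ^ 'n \<Rightarrow> real"
  assumes "\<epsilon> > 0" and G: "continuous_on UNIV (\<lambda>(x, p). G (coset \<epsilon> x) p)" and l: "l > 0"
    and A: "\<And>x. \<bar>G (coset \<epsilon> x) 0\<bar> \<le> A" and K: "\<And>x p. G (coset \<epsilon> x) p \<le> A \<Longrightarrow> norm p \<le> K"
  obtains u where "visc_solution \<epsilon> (\<lambda>X p s. l * s + G X p) 0 u"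
    "\<And>x. \<bar>l * u (coset \<epsilon> x)\<bar> \<le> A" "\<And>x y. \<bar>u (coset \<epsilon> x) - u (coset \<epsilon> y)\<bar> \<le> K * norm (x - y)"
proof -
  let ?q = "coset \<epsilon> :: real ^ 'n \<Rightarrow> _"
  define F where "F = (\<lambda>X p s. l * s + G X p)"
  \<comment> \<open>The lower barrier is built into the class: it gives
    \<open>- A \<le> l * w\<close>, so an admissible momentum satisfies \<open>G \<le> A\<close> and
    has norm at most \<open>K\<close>.\<close>
  define S where "S = {w. visc_subsolution \<epsilon> F 0 w \<and> (\<forall>x. - A / l \<le> w (?q x))}"
  have sub_const: "visc_subsolution \<epsilon> F 0 (\<lambda>X. - A / l)"
    unfolding visc_subsolution_def
  proof (intro conjI allI impI)
    show "continuous_map (torus \<epsilon>) euclideanreal (\<lambda>X. - A / l)" by simp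
    fix \<phi> d\<phi> and X :: "(real ^ 'n) set" and U
    assume *: "torus_C1 \<epsilon> \<phi> d\<phi> \<and> openin (torus \<epsilon>) U \<and> X \<in> U \<and> (\<forall>Y\<in>U. - A / l - \<phi> Y \<le> - A / l - \<phi> X)"
    then have "0 = d\<phi> X" by (intro torus_C1_touching_gradient[OF torus_C1_const[of \<epsilon> "- A / l"], of \<phi> d\<phi> U X]) auto
    moreover obtain x where "X = ?q x" using * openin_torus by blast
    ultimately show "F X (d\<phi> X) (- A / l) \<le> 0" using A[of x] l by (auto simp: F_def)
  qed
  then have S_const: "(\<lambda>X. - A / l) \<in> S" by (simp add: S_def)
  have S_upper: "w (?q x) \<le> A / l" if "w \<in> S" for w x
  proof -
    have w: "visc_subsolution \<epsilon> F 0 w" using that by (simp add: S_def)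
    obtain x1 where x1: "\<And>x. w (?q x) \<le> w (?q x1)"
      by (rule periodic_attains_sup[OF assms(1) periodic_coset visc_subsolution_continuous[OF w]]) blast
    \<comment> \<open>A penalty with coefficient 0 is a constant test function; it touches
      \<open>w\<close> from above at a maximum point.\<close>
    have "F (?q x1) (0 *\<^sub>R dpen \<epsilon> (x1 - 0)) (w (?q x1)) \<le> 0"
      by (rule visc_subsolution_pen[OF assms(1) w]) (simp add: x1)
    then have "l * w (?q x1) \<le> A" using A[of x1] by (simp add: F_def)
    then have "w (?q x1) \<le> A / l" using l by (simp add: field_simps)
    then show ?thesis using x1[of x] by linarith
  qed
  have S_lip: "\<bar>w (?q x) - w (?q y)\<bar> \<le> K * norm (x - y)" if "w \<in> S" for w x y
  proof (rule visc_subsolution_lipschitz[OF assms(1)])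
    show "visc_subsolution \<epsilon> F 0 w" using that by (simp add: S_def)
    fix x p assume "F (?q x) p (w (?q x)) \<le> 0"
    moreover have "- A \<le> l * w (?q x)"
    proof -
      have "- A / l \<le> w (?q x)" using that by (simp add: S_def)
      then show ?thesis using l by (simp add: field_simps)
    qed
    ultimately show "norm p \<le> K" by (intro K[of x]) (simp add: F_def)
  qed
  define u where "u X = (SUP w\<in>S. w X)" for X
  have bdd: "bdd_above ((\<lambda>w. w (?q x)) ` S)" for x using S_upper by (intro bdd_aboveI[of _ "A / l"]) auto
  have u_ge: "w (?q x) \<le> u (?q x)" if "w \<in> S" for w x
    unfolding u_def by (rule cSUP_upper[OF that bdd])
  have u_le: "u (?q x) \<le> b" if "\<And>w. w \<in> S \<Longrightarrow> w (?q x) \<le> b" for x b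
    unfolding u_def by (rule cSUP_least) (use S_const that in auto)
  have u_lip: "\<bar>u (?q x) - u (?q y)\<bar> \<le> K * norm (x - y)" for x y
  proof -
    have "u (?q x) \<le> u (?q y) + K * norm (x - y)" for x y
    proof (rule u_le)
      fix w assume "w \<in> S"
      then show "w (?q x) \<le> u (?q y) + K * norm (x - y)" using S_lip[of w x y] u_ge[of w y] by linarith
    qed
    from this[of x y] this[of y x] show ?thesis by (simp add: norm_minus_commute)
  qed
  have u_cont: "continuous_on UNIV (\<lambda>x. u (?q x))"
  proof (rule lipschitz_on_continuous_on)
    \<comment> \<open>The Lipschitz inequality at the ends of a unit vector yields
      \<open>0 \<le> K\<close>.\<close>
    have "0 \<le> K * norm (axis undefined 1 - 0 :: real ^ 'n)" using u_lip[of "axis undefined 1" 0] by linarith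
    then have "0 \<le> K" by (simp add: norm_axis_1)
    then show "K-lipschitz_on UNIV (\<lambda>x. u (?q x))"
      using u_lip by (intro lipschitz_onI) (auto simp: dist_norm)
  qed
  have u_lower: "- A / l \<le> u (?q x)" for x using u_ge[OF S_const] by simp
  have u_sub: "visc_subsolution \<epsilon> F 0 u"
    unfolding visc_subsolution_def
  proof (intro conjI allI impI)
    show "continuous_map (torus \<epsilon>) euclideanreal u" using u_cont by (simp add: continuous_map_torus)
    fix \<phi> d\<phi> and X :: "(real ^ 'n) set" and U
    assume *: "torus_C1 \<epsilon> \<phi> d\<phi> \<and> openin (torus \<epsilon>) U \<and> X \<in> U \<and> (\<forall>Y\<in>U. u Y - \<phi> Y \<le> u X - \<phi> X)"
    then obtain x0 where X: "X = ?q x0" using openin_torus by blast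
    have "\<exists>w\<in>S. u (?q x0) - inverse (real (Suc n)) < w (?q x0)" for n
    proof (rule ccontr)
      assume "\<not> ?thesis"
      then have "u (?q x0) \<le> u (?q x0) - inverse (real (Suc n))" by (intro u_le) (simp add: not_less)
      then show False by simp
    qed
    then obtain w where w: "\<And>n. w n \<in> S" "\<And>n. u (?q x0) - inverse (real (Suc n)) < w n (?q x0)" by metis
    have "(\<lambda>n. u (?q x0) - inverse (real (Suc n))) \<longlonglongrightarrow> u (?q x0) - 0"
      by (intro tendsto_diff tendsto_const LIMSEQ_inverse_real_of_nat)
    then have lim0: "(\<lambda>n. u (?q x0) - inverse (real (Suc n))) \<longlonglongrightarrow> u (?q x0)" by simp
    have lim: "(\<lambda>n. w n (?q x0)) \<longlonglongrightarrow> u (?q x0)"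
      by (rule tendsto_sandwich[OF _ _ lim0 tendsto_const])
        (auto intro!: always_eventually less_imp_le[OF w(2)] u_ge w(1) simp del: of_nat_Suc)
    have wsub: "visc_subsolution \<epsilon> (\<lambda>X p s. l * s + G X p - 0) 0 (w n)" for n
      using w(1)[of n] by (simp add: S_def F_def)
    have "l * u (?q x0) + G (?q x0) (d\<phi> (?q x0)) - 0 \<le> 0"
    proof (rule visc_subsolution_stability[OF assms(1) G wsub tendsto_const tendsto_const u_cont _ lim])
      show "\<forall>\<^sub>F n in sequentially. \<forall>x. w n (?q x) \<le> u (?q x) + e" if "e > 0" for e
      proof (intro always_eventually allI)
        fix n x show "w n (?q x) \<le> u (?q x) + e" using u_ge[OF w(1), of n x] that by linarith
      qed
      show "torus_C1 \<epsilon> \<phi> d\<phi>" "openin (torus \<epsilon>) U" "?q x0 \<in> U" using * X by auto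
      show "u Y - \<phi> Y \<le> u (?q x0) - \<phi> (?q x0)" if "Y \<in> U" for Y using * X that by blast
    qed
    then show "F X (d\<phi> X) (u X) \<le> 0" by (simp add: F_def X)
  qed
  have u_sup: "visc_supersolution \<epsilon> F 0 u"
    unfolding visc_supersolution_def
  proof (intro conjI allI impI)
    show "continuous_map (torus \<epsilon>) euclideanreal u" using u_cont by (simp add: continuous_map_torus)
    fix \<phi> d\<phi> and X :: "(real ^ 'n) set" and U
    assume *: "torus_C1 \<epsilon> \<phi> d\<phi> \<and> openin (torus \<epsilon>) U \<and> X \<in> U \<and> (\<forall>Y\<in>U. u X - \<phi> X \<le> u Y - \<phi> Y)"
    then have \<phi>: "torus_C1 \<epsilon> \<phi> d\<phi>" and U: "openin (torus \<epsilon>) U" "X \<in> U"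
      and touch: "\<And>Y. Y \<in> U \<Longrightarrow> u X - \<phi> X \<le> u Y - \<phi> Y" by auto
    obtain x0 where X: "X = ?q x0" using U openin_torus by blast
    note c\<phi> = torus_C1_continuous[OF \<phi>]
    show "0 \<le> F X (d\<phi> X) (u X)"
    proof (rule ccontr)
      assume "\<not> ?thesis"
      then have neg: "l * u (?q x0) + G (?q x0) (d\<phi> (?q x0)) < 0" by (simp add: F_def X)
      have "open (?q -` U)" "x0 \<in> ?q -` U" using U by (auto simp: openin_torus X)
      then obtain r0 where r0: "r0 > 0" "ball x0 r0 \<subseteq> ?q -` U" by (meson open_contains_ball)
      obtain d where d: "d > 0" "\<And>z :: real ^ 'n. pen \<epsilon> z < d \<Longrightarrow> \<exists>k\<in>lattice. norm (z + \<epsilon> *\<^sub>R k) < r0"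
        by (rule pen_small[OF assms(1) r0(1)]) blast
      obtain Bu where Bu: "Bu > 0" "\<And>x. norm (u (?q x)) \<le> Bu"
        by (rule periodic_bounded1[OF assms(1) periodic_coset u_cont]) blast
      obtain B\<phi> where B\<phi>: "B\<phi> > 0" "\<And>x. norm (\<phi> (?q x)) \<le> B\<phi>"
        by (rule periodic_bounded1[OF assms(1) periodic_coset c\<phi>(1)]) blast
      define C where "C = (2 * Bu + 2 * B\<phi> + 1) / d"
      have C: "C > 0" "C * d = 2 * Bu + 2 * B\<phi> + 1" using Bu(1) B\<phi>(1) d(1) by (auto simp: C_def)
      obtain \<psi> d\<psi> where \<psi>: "torus_C1 \<epsilon> \<psi> d\<psi>" "\<And>x. \<psi> (?q x) = C * pen \<epsilon> (x - x0)"
        "\<And>x. d\<psi> (?q x) = C *\<^sub>R dpen \<epsilon> (x - x0)"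
        by (rule torus_C1_pen[OF assms(1), of C x0]) blast
      \<comment> \<open>The equation evaluated on the test function after raising it by
        \<open>snd z\<close>. The zeroth-order term omits the nonnegative \<open>\<psi>\<close> and
        so only overestimates. Negativity at \<open>(x0, 0)\<close> persists nearby by continuity,
        which leaves room to raise the function.\<close>
      define \<Psi> where "\<Psi> = (\<lambda>z. l * (u (?q x0) + \<phi> (?q (fst z)) - \<phi> (?q x0) + snd z)
          + G (?q (fst z)) (d\<phi> (?q (fst z)) - d\<psi> (?q (fst z))))"
      have cG: "continuous_on UNIV (\<lambda>z :: (real ^ 'n) \<times> real. G (?q (fst z)) (d\<phi> (?q (fst z)) - d\<psi> (?q (fst z))))"
      proof -
        have "continuous_on UNIV (\<lambda>z :: (real ^ 'n) \<times> real. (fst z, d\<phi> (?q (fst z)) - d\<psi> (?q (fst z))))"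
          by (intro continuous_on_Pair continuous_on_diff continuous_on_compose2[OF c\<phi>(2)]
              continuous_on_compose2[OF torus_C1_continuous(2)[OF \<psi>(1)]] continuous_on_fst continuous_on_id) auto
        from continuous_on_compose2[OF G this] show ?thesis by simp
      qed
      have "continuous_on UNIV \<Psi>"
        unfolding \<Psi>_def
        by (intro continuous_on_add continuous_on_mult continuous_on_diff continuous_on_const
            continuous_on_compose2[OF c\<phi>(1)] continuous_on_fst continuous_on_snd continuous_on_id cG) auto
      moreover have "\<Psi> (x0, 0) < 0" using neg by (simp add: \<Psi>_def \<psi>(3))
      ultimately obtain r1 where r1: "r1 > 0" "\<And>z. dist z (x0, 0) < r1 \<Longrightarrow> \<Psi> z < 0"
      proof -
        have "open {z. \<Psi> z < 0}" using \<open>continuous_on UNIV \<Psi>\<close> by (intro open_Collect_less continuous_on_const)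
        moreover have "(x0, 0) \<in> {z. \<Psi> z < 0}" using \<open>\<Psi> (x0, 0) < 0\<close> by simp
        ultimately obtain r1 where "r1 > 0" "ball (x0, 0) r1 \<subseteq> {z. \<Psi> z < 0}" by (rule openE)
        show thesis
        proof (rule that[OF \<open>r1 > 0\<close>])
          fix z :: "(real ^ 'n) \<times> real" assume "dist z (x0, 0) < r1"
          then have "z \<in> ball (x0, 0) r1" by (simp only: mem_ball dist_commute)
          then show "\<Psi> z < 0" using \<open>ball (x0, 0) r1 \<subseteq> {z. \<Psi> z < 0}\<close> by blast
        qed
      qed
      obtain d1 where d1: "d1 > 0" "\<And>z :: real ^ 'n. pen \<epsilon> z < d1 \<Longrightarrow> \<exists>k\<in>lattice. norm (z + \<epsilon> *\<^sub>R k) < r1 / 2"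
        by (rule pen_small[OF assms(1), of "r1 / 2"]) (use r1(1) in auto)
      define \<delta> where "\<delta> = Min {1, r1 / 4, C * d1}"
      have \<delta>: "\<delta> > 0" "\<delta> \<le> 1" "\<delta> \<le> r1 / 4" "\<delta> \<le> C * d1" using r1(1) C(1) d1(1) by (auto simp: \<delta>_def)
      \<comment> \<open>\<open>C\<close> keeps \<open>g\<close> below \<open>u\<close> away from \<open>x0\<close>, and small \<open>\<delta>\<close> confines \<open>{g > u}\<close> to where \<open>\<Psi> < 0\<close>:
        then \<open>max u g\<close> is a subsolution that beats \<open>u\<close> at \<open>x0\<close>.\<close>
      define g where "g X = (\<phi> X - \<psi> X) + (u (?q x0) - \<phi> (?q x0) + \<delta>)" for X
      have g: "torus_C1 \<epsilon> g (\<lambda>X. d\<phi> X - d\<psi> X)"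
        using torus_C1_add[OF torus_C1_diff[OF \<phi> \<psi>(1)] torus_C1_const] by (simp add: g_def[abs_def])
      have gu: "l * g (?q y) + G (?q y) (d\<phi> (?q y) - d\<psi> (?q y)) \<le> 0" if gt: "u (?q y) < g (?q y)" for y
      proof -
        have "pen \<epsilon> (y - x0) < d"
        proof (rule ccontr)
          assume "\<not> ?thesis"
          then have "C * d \<le> C * pen \<epsilon> (y - x0)" using C(1) by simp
          then have "g (?q y) \<le> - Bu"
            using C(2) Bu(2)[of x0] B\<phi>(2)[of y] B\<phi>(2)[of x0] \<delta>(2) by (simp add: g_def \<psi>(2))
          then show False using gt Bu(2)[of y] by simp
        qed
        then obtain k where k: "k \<in> lattice" "norm (y - x0 + \<epsilon> *\<^sub>R k) < r0" using d(2) by blast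
        have "y + \<epsilon> *\<^sub>R k \<in> ball x0 r0" using k(2) by (simp add: dist_norm norm_minus_commute algebra_simps)
        then have "y + \<epsilon> *\<^sub>R k \<in> ?q -` U" by (rule subsetD[OF r0(2)])
        then have "?q y \<in> U" using coset_shift[OF k(1)] by simp
        then have "u (?q x0) - \<phi> (?q x0) \<le> u (?q y) - \<phi> (?q y)" using touch X by blast
        then have "C * pen \<epsilon> (y - x0) < C * d1" using gt \<delta>(4) by (simp add: g_def \<psi>(2))
        then have "pen \<epsilon> (y - x0) < d1" using C(1) by simp
        then obtain j where j: "j \<in> lattice" "norm (y - x0 + \<epsilon> *\<^sub>R j) < r1 / 2" using d1(2) by blast
        have "dist (y + \<epsilon> *\<^sub>R j, \<delta>) (x0, 0) \<le> dist (y + \<epsilon> *\<^sub>R j) x0 + dist \<delta> 0"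
          unfolding dist_prod_def using \<delta>(1) by (simp add: sqrt_sum_squares_le_sum)
        also have "\<dots> < r1" using j(2) \<delta> r1(1) by (simp add: dist_norm diff_add_eq)
        finally have "\<Psi> (y + \<epsilon> *\<^sub>R j, \<delta>) < 0" by (rule r1(2))
        then have "l * (u (?q x0) + \<phi> (?q y) - \<phi> (?q x0) + \<delta>) + G (?q y) (d\<phi> (?q y) - d\<psi> (?q y)) < 0"
          using coset_shift[OF j(1)] by (simp add: \<Psi>_def)
        moreover have "l * g (?q y) \<le> l * (u (?q x0) + \<phi> (?q y) - \<phi> (?q x0) + \<delta>)"
          using l C(1) pen_nonneg[of \<epsilon> "y - x0"] by (intro mult_left_mono) (auto simp: g_def \<psi>(2))
        ultimately show ?thesis by linarith
      qed
      define w where "w X = max (u X) (g X)" for X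
      have "visc_subsolution \<epsilon> F 0 w"
        unfolding visc_subsolution_def
      proof (intro conjI allI impI)
        show "continuous_map (torus \<epsilon>) euclideanreal w"
          using u_cont torus_C1_continuous(1)[OF g] by (simp add: continuous_map_torus w_def continuous_on_max)
        fix \<phi>' d\<phi>' and Y :: "(real ^ 'n) set" and U'
        assume **: "torus_C1 \<epsilon> \<phi>' d\<phi>' \<and> openin (torus \<epsilon>) U' \<and> Y \<in> U' \<and> (\<forall>Z\<in>U'. w Z - \<phi>' Z \<le> w Y - \<phi>' Y)"
        then obtain y where Y: "Y = ?q y" using openin_torus by blast
        show "F Y (d\<phi>' Y) (w Y) \<le> 0"
        proof (cases "g Y \<le> u Y")
          case True
          then have wY: "w Y = u Y" by (simp add: w_def)
          have "\<forall>Z\<in>U'. u Z - \<phi>' Z \<le> u Y - \<phi>' Y"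
          proof
            fix Z assume "Z \<in> U'"
            then have "w Z - \<phi>' Z \<le> u Y - \<phi>' Y" using ** wY by auto
            then show "u Z - \<phi>' Z \<le> u Y - \<phi>' Y" by (simp add: w_def)
          qed
          then show ?thesis using u_sub ** unfolding wY visc_subsolution_def by blast
        next
          case False
          then have wY: "w Y = g Y" by (simp add: w_def)
          have "g Z - \<phi>' Z \<le> g Y - \<phi>' Y" if "Z \<in> U'" for Z
          proof -
            have "w Z - \<phi>' Z \<le> g Y - \<phi>' Y" using ** wY that by auto
            then show ?thesis by (simp add: w_def)
          qed
          \<comment> \<open>Where the maximum is attained by the smooth function \<open>g\<close>, a
            test function touching from above has the gradient of \<open>g\<close>, so the pointwise
            inequality \<open>gu\<close> decides.\<close>
          then have "d\<phi> Y - d\<psi> Y = d\<phi>' Y"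
            using ** by (intro torus_C1_touching_gradient[OF g, of \<phi>' d\<phi>' U' Y]) auto
          then show ?thesis using gu[of y] False wY by (simp add: F_def Y)
        qed
      qed
      moreover have "\<forall>x. - A / l \<le> w (?q x)" using u_lower by (simp add: w_def le_max_iff_disj)
      ultimately have "w \<in> S" by (simp add: S_def)
      then have "w (?q x0) \<le> u (?q x0)" by (rule u_ge)
      then show False using \<delta>(1) by (simp add: w_def g_def \<psi>(2))
    qed
  qed
  have "\<bar>l * u (?q x)\<bar> \<le> A" for x
  proof -
    have "u (?q x) \<le> A / l" by (rule u_le) (rule S_upper)
    then show ?thesis using u_lower[of x] l by (simp add: field_simps abs_le_iff)
  qed
  then show ?thesis using that[of u] u_sub u_sup u_lip by (simp add: visc_solution_def F_def)
qed

text \<open>As the discount vanishes, the solutions normalized at 0 stay equi-Lipschitz and the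
  constants \<open>- l n * u n (coset \<epsilon> 0)\<close> stay in \<open>[- A, A]\<close>. A
  subsequence converges uniformly, and the limit constant is the level of the cell problem.\<close>

theorem cell_solution:
  fixes G :: "(real ^ 'n) set \<Rightarrow> real ^ 'n \<Rightarrow> real"
  assumes "\<epsilon> > 0" and G: "continuous_on UNIV (\<lambda>(x, p). G (coset \<epsilon> x) p)"
    and coercive: "\<And>A. \<exists>K. \<forall>x p. G (coset \<epsilon> x) p \<le> A \<longrightarrow> norm p \<le> K"
  obtains a v where "visc_solution \<epsilon> (\<lambda>X p s. G X p) a v"
proof -
  let ?q = "coset \<epsilon> :: real ^ 'n \<Rightarrow> _"
  have "continuous_on UNIV (\<lambda>x. G (?q x) 0)"
    using continuous_on_compose2[OF G continuous_on_Pair[OF continuous_on_id continuous_on_const[of _ 0]]] by simp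
  then obtain A where A: "A > 0" "\<And>x. norm (G (?q x) 0) \<le> A"
    by (rule periodic_bounded1[OF assms(1) periodic_coset]) blast
  obtain K where K: "\<And>x p. G (?q x) p \<le> A \<Longrightarrow> norm p \<le> K" using coercive by blast
  define l where "l n = inverse (real (Suc n))" for n
  have l: "l n > 0" for n by (simp add: l_def)
  have "\<exists>u. visc_solution \<epsilon> (\<lambda>X p s. l n * s + G X p) 0 u \<and>
    (\<forall>x. \<bar>l n * u (?q x)\<bar> \<le> A) \<and> (\<forall>x y. \<bar>u (?q x) - u (?q y)\<bar> \<le> K * norm (x - y))" for n
  proof -
    have "\<bar>G (?q x) 0\<bar> \<le> A" for x using A(2)[of x] by simp
    then obtain u where "visc_solution \<epsilon> (\<lambda>X p s. l n * s + G X p) 0 u"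
      "\<And>x. \<bar>l n * u (?q x)\<bar> \<le> A" "\<And>x y. \<bar>u (?q x) - u (?q y)\<bar> \<le> K * norm (x - y)"
      by (rule discounted_solution[OF assms(1) G l _ K]) blast+
    then show ?thesis by blast
  qed
  then have "\<exists>u. \<forall>n. visc_solution \<epsilon> (\<lambda>X p s. l n * s + G X p) 0 (u n) \<and>
    (\<forall>x. \<bar>l n * u n (?q x)\<bar> \<le> A) \<and> (\<forall>x y. \<bar>u n (?q x) - u n (?q y)\<bar> \<le> K * norm (x - y))"
    by (intro choice allI)
  then obtain u where "\<forall>n. visc_solution \<epsilon> (\<lambda>X p s. l n * s + G X p) 0 (u n) \<and>
    (\<forall>x. \<bar>l n * u n (?q x)\<bar> \<le> A) \<and> (\<forall>x y. \<bar>u n (?q x) - u n (?q y)\<bar> \<le> K * norm (x - y))" by (elim exE)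
  then have u: "\<And>n. visc_solution \<epsilon> (\<lambda>X p s. l n * s + G X p) 0 (u n)"
    "\<And>n x. \<bar>l n * u n (?q x)\<bar> \<le> A" "\<And>n x y. \<bar>u n (?q x) - u n (?q y)\<bar> \<le> K * norm (x - y)"
    by blast+
  define a where "a n = - (l n * u n (?q 0))" for n
  define v where "v n X = u n X - u n (?q 0)" for n X
  have v_sub: "visc_subsolution \<epsilon> (\<lambda>X p s. l n * s + G X p - a n) 0 (v n)" for n
  proof -
    have "visc_subsolution \<epsilon> (\<lambda>X p s. l n * s + G X p) 0 (u n)" using u(1) by (simp add: visc_solution_def)
    then show ?thesis
      unfolding visc_subsolution_def v_def a_def by (simp add: continuous_map_torus continuous_on_diff algebra_simps)
  qed
  have v_sup: "visc_supersolution \<epsilon> (\<lambda>X p s. l n * s + G X p - a n) 0 (v n)" for n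
  proof -
    have "visc_supersolution \<epsilon> (\<lambda>X p s. l n * s + G X p) 0 (u n)" using u(1) by (simp add: visc_solution_def)
    then show ?thesis
      unfolding visc_supersolution_def v_def a_def by (simp add: continuous_map_torus continuous_on_diff algebra_simps)
  qed
  have v_lip: "\<bar>v n (?q x) - v n (?q y)\<bar> \<le> K * norm (x - y)" for n x y using u(3)[of n x y] by (simp add: v_def)
  have v_0: "v n (?q 0) = 0" for n by (simp add: v_def)
  have "0 \<le> K * norm (axis undefined 1 - 0 :: real ^ 'n)" using v_lip[of 0 "axis undefined 1" 0] by linarith
  then have K0: "0 \<le> K" by (simp add: norm_axis_1)
  have "a n \<in> {-A..A}" for n using u(2)[of n 0] by (auto simp: a_def abs_le_iff)
  then obtain a0 r1 where a0: "strict_mono (r1 :: nat \<Rightarrow> nat)" "(\<lambda>n. a (r1 n)) \<longlonglongrightarrow> a0"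
    by (rule compact_subseqE[OF compact_Icc])
  have "bounded (fundamental_box \<epsilon> :: (real ^ 'n) set)" by (intro compact_imp_bounded compact_fundamental_box)
  then obtain D where D: "\<forall>x\<in>fundamental_box \<epsilon>. norm (x :: real ^ 'n) \<le> D" unfolding bounded_iff by blast
  obtain g r2 where g: "continuous_on (fundamental_box \<epsilon>) g" "strict_mono (r2 :: nat \<Rightarrow> nat)"
    "\<And>e. 0 < e \<Longrightarrow> \<exists>N. \<forall>n x. n \<ge> N \<and> x \<in> fundamental_box \<epsilon> \<longrightarrow> norm (v (r1 (r2 n)) (?q x) - g x) < e"
  proof (rule Arzela_Ascoli[of "fundamental_box \<epsilon> :: (real ^ 'n) set" "\<lambda>n x. v (r1 n) (?q x)" "K * D"])
    show "compact (fundamental_box \<epsilon> :: (real ^ 'n) set)" by (rule compact_fundamental_box)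
    show "norm (v (r1 n) (?q x)) \<le> K * D" if "x \<in> fundamental_box \<epsilon>" for n x
    proof -
      have "\<bar>v (r1 n) (?q x)\<bar> \<le> K * norm x" using v_lip[of "r1 n" x 0] v_0 by simp
      also have "\<dots> \<le> K * D" using D that K0 by (intro mult_left_mono) auto
      finally show ?thesis by simp
    qed
    show "\<exists>d>0. \<forall>n y. y \<in> fundamental_box \<epsilon> \<and> norm (x - y) < d \<longrightarrow> norm (v (r1 n) (?q x) - v (r1 n) (?q y)) < e"
      if "0 < e" for x and e :: real
    proof (intro exI[of _ "e / (K + 1)"] conjI allI impI)
      show "0 < e / (K + 1)" using that K0 by simp
      fix n and y :: "real ^ 'n" assume "y \<in> fundamental_box \<epsilon> \<and> norm (x - y) < e / (K + 1)"
      then have "(K + 1) * norm (x - y) < e" using K0 by (simp add: field_simps)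
      moreover have "K * norm (x - y) \<le> (K + 1) * norm (x - y)" by (intro mult_right_mono) auto
      ultimately show "norm (v (r1 n) (?q x) - v (r1 n) (?q y)) < e" using v_lip[of "r1 n" x y] by simp
    qed
  qed blast
  define r where "r n = r1 (r2 n)" for n
  have r: "strict_mono r" using strict_mono_o[OF a0(1) g(2)] by (simp add: r_def[abs_def] o_def)
  \<comment> \<open>Compactness yields a limit \<open>g\<close> on the fundamental box only. Taking
    limits coset by coset gives a function on the torus at once, and compatibility of
    \<open>g\<close> on opposite faces never has to be checked.\<close>
  define vl where "vl X = lim (\<lambda>n. v (r n) X)" for X
  have vl: "\<exists>y\<in>fundamental_box \<epsilon>. ?q y = ?q x \<and> vl (?q x) = g y" for x
  proof -
    obtain k where k: "k \<in> lattice" "x + \<epsilon> *\<^sub>R k \<in> fundamental_box \<epsilon>" by (rule fundamental_box_shift[OF assms(1)])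
    define y where "y = x + \<epsilon> *\<^sub>R k"
    have qy: "?q y = ?q x" using coset_shift[OF k(1)] by (simp add: y_def)
    have "(\<lambda>n. v (r n) (?q y)) \<longlonglongrightarrow> g y"
    proof (rule LIMSEQ_I)
      fix e :: real assume "0 < e"
      then obtain N where "\<forall>n x. n \<ge> N \<and> x \<in> fundamental_box \<epsilon> \<longrightarrow> norm (v (r1 (r2 n)) (?q x) - g x) < e" using g(3) by blast
      then show "\<exists>N. \<forall>n\<ge>N. norm (v (r n) (?q y) - g y) < e" using k(2) by (auto simp: r_def y_def)
    qed
    then have "vl (?q y) = g y" unfolding vl_def by (rule limI)
    then show ?thesis using k(2) qy by (intro bexI[of _ y]) (auto simp: y_def)
  qed
  have unif: "\<forall>\<^sub>F n in sequentially. \<forall>x. \<bar>v (r n) (?q x) - vl (?q x)\<bar> < e" if "e > 0" for e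
  proof -
    obtain N where N: "\<forall>n x. n \<ge> N \<and> x \<in> fundamental_box \<epsilon> \<longrightarrow> norm (v (r1 (r2 n)) (?q x) - g x) < e"
      using g(3)[OF \<open>e > 0\<close>] by blast
    have "\<bar>v (r n) (?q x) - vl (?q x)\<bar> < e" if "n \<ge> N" for n x
    proof -
      obtain y where y: "y \<in> fundamental_box \<epsilon>" "?q y = ?q x" "vl (?q x) = g y" using vl by blast
      then have "norm (v (r1 (r2 n)) (?q y) - g y) < e" using N that by blast
      then show ?thesis by (simp add: r_def y(2,3))
    qed
    then show ?thesis by (auto simp: eventually_sequentially)
  qed
  have vlim: "(\<lambda>n. v (r n) (?q x)) \<longlonglongrightarrow> vl (?q x)" for x
  proof (rule tendstoI)
    fix e :: real assume "e > 0"
    show "\<forall>\<^sub>F n in sequentially. dist (v (r n) (?q x)) (vl (?q x)) < e"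
      by (rule eventually_mono[OF unif[OF \<open>e > 0\<close>]]) (simp add: dist_real_def)
  qed
  have vl_lip: "\<bar>vl (?q x) - vl (?q y)\<bar> \<le> K * norm (x - y)" for x y
    by (rule tendsto_upperbound[OF tendsto_rabs[OF tendsto_diff[OF vlim[of x] vlim[of y]]]])
      (auto intro: always_eventually v_lip)
  have vl_cont: "continuous_on UNIV (\<lambda>x. vl (?q x))"
    by (rule lipschitz_on_continuous_on[of K]) (use vl_lip K0 in \<open>auto intro!: lipschitz_onI simp: dist_norm\<close>)
  have l_lim: "(\<lambda>n. l (r n)) \<longlonglongrightarrow> 0"
    using LIMSEQ_subseq_LIMSEQ[OF LIMSEQ_inverse_real_of_nat r] by (simp add: l_def o_def)
  have a_lim: "(\<lambda>n. a (r n)) \<longlonglongrightarrow> a0"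
    using LIMSEQ_subseq_LIMSEQ[OF a0(2) g(2)] by (simp add: r_def o_def)
  have "visc_subsolution \<epsilon> (\<lambda>X p s. G X p) a0 vl"
    unfolding visc_subsolution_def
  proof (intro conjI allI impI)
    show "continuous_map (torus \<epsilon>) euclideanreal vl" using vl_cont by (simp add: continuous_map_torus)
    fix \<phi> d\<phi> and X :: "(real ^ 'n) set" and U
    assume *: "torus_C1 \<epsilon> \<phi> d\<phi> \<and> openin (torus \<epsilon>) U \<and> X \<in> U \<and> (\<forall>Y\<in>U. vl Y - \<phi> Y \<le> vl X - \<phi> X)"
    then obtain x0 where X: "X = ?q x0" using openin_torus by blast
    have "0 * vl (?q x0) + G (?q x0) (d\<phi> (?q x0)) - a0 \<le> 0"
    proof (rule visc_subsolution_stability[OF assms(1) G v_sub l_lim a_lim vl_cont _ vlim])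
      show "\<forall>\<^sub>F n in sequentially. \<forall>x. v (r n) (?q x) \<le> vl (?q x) + e" if "e > 0" for e
        by (rule eventually_mono[OF unif[OF that]]) (smt (verit))
      show "torus_C1 \<epsilon> \<phi> d\<phi>" "openin (torus \<epsilon>) U" "?q x0 \<in> U" using * X by auto
      show "vl Y - \<phi> Y \<le> vl (?q x0) - \<phi> (?q x0)" if "Y \<in> U" for Y using * X that by blast
    qed
    then show "G X (d\<phi> X) \<le> a0" by (simp add: X)
  qed
  moreover have "visc_supersolution \<epsilon> (\<lambda>X p s. G X p) a0 vl"
    unfolding visc_supersolution_def
  proof (intro conjI allI impI)
    show "continuous_map (torus \<epsilon>) euclideanreal vl" using vl_cont by (simp add: continuous_map_torus)
    fix \<phi> d\<phi> and X :: "(real ^ 'n) set" and U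
    assume *: "torus_C1 \<epsilon> \<phi> d\<phi> \<and> openin (torus \<epsilon>) U \<and> X \<in> U \<and> (\<forall>Y\<in>U. vl X - \<phi> X \<le> vl Y - \<phi> Y)"
    then obtain x0 where X: "X = ?q x0" using openin_torus by blast
    have cG: "continuous_on UNIV (\<lambda>(x, p). - G (?q x) (- p))"
    proof -
      have "continuous_on UNIV (\<lambda>z :: (real ^ 'n) \<times> (real ^ 'n). (fst z, - snd z))"
        by (intro continuous_on_Pair continuous_on_minus continuous_on_fst continuous_on_snd continuous_on_id)
      from continuous_on_minus[OF continuous_on_compose2[OF G this]] show ?thesis by (simp add: case_prod_beta)
    qed
    have "0 * (- vl (?q x0)) + (- G (?q x0) (- (- d\<phi> (?q x0)))) - (- a0) \<le> 0"
    proof (rule visc_subsolution_stability[OF assms(1) cG visc_subsolution_uminus[OF v_sup] l_lim tendsto_minus[OF a_lim]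
          continuous_on_minus[OF vl_cont] _ tendsto_minus[OF vlim]])
      show "\<forall>\<^sub>F n in sequentially. \<forall>x. - v (r n) (?q x) \<le> - vl (?q x) + e" if "e > 0" for e
        by (rule eventually_mono[OF unif[OF that]]) (smt (verit))
      show "torus_C1 \<epsilon> (\<lambda>X. - \<phi> X) (\<lambda>X. - d\<phi> X)" using * by (intro torus_C1_uminus) simp
      show "openin (torus \<epsilon>) U" "?q x0 \<in> U" using * X by auto
      show "- vl Y - (- \<phi> Y) \<le> - vl (?q x0) - (- \<phi> (?q x0))" if "Y \<in> U" for Y
      proof -
        have "vl X - \<phi> X \<le> vl Y - \<phi> Y" using * that by blast
        then show ?thesis by (simp add: X)
      qed
    qed
    then show "a0 \<le> G X (d\<phi> X)" by (simp add: X)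
  qed
  ultimately show ?thesis using that by (simp add: visc_solution_def)
qed

section \<open>The Lagrangian\<close>

text \<open>A hyperplane separates the point \<open>(x, f x)\<close> from the strict epigraph; its
  slope is the subgradient.\<close>

lemma convex_subgradient:
  fixes f :: "'a::euclidean_space \<Rightarrow> real"
  assumes "convex_on UNIV f"
  obtains v where "\<And>y. f x + v \<bullet> (y - x) \<le> f y"
proof -
  define T where "T = {z :: 'a \<times> real. f (fst z) < snd z}"
  have "convex T"
  proof (rule convexI)
    fix a b :: "'a \<times> real" and u v :: real
    assume *: "a \<in> T" "b \<in> T" "0 \<le> u" "0 \<le> v" "u + v = 1"
    have "f (u *\<^sub>R fst a + v *\<^sub>R fst b) \<le> u * f (fst a) + v * f (fst b)"
      using assms * unfolding convex_on_def by auto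
    also have "\<dots> < u * snd a + v * snd b"
    proof (cases "u = 0")
      case True then show ?thesis using * by (simp add: T_def)
    next
      case False
      then have "u * f (fst a) < u * snd a" using * by (simp add: T_def)
      moreover have "v * f (fst b) \<le> v * snd b" using * by (intro mult_left_mono) (auto simp: T_def)
      ultimately show ?thesis by linarith
    qed
    finally show "u *\<^sub>R a + v *\<^sub>R b \<in> T" by (simp add: T_def)
  qed
  moreover have "(0, f 0 + 1) \<in> T" by (simp add: T_def)
  then have "T \<noteq> {}" by blast
  moreover have "{(x, f x)} \<inter> T = {}" by (auto simp: T_def)
  ultimately obtain a b where ab: "a \<noteq> 0" "\<forall>z\<in>{(x, f x)}. a \<bullet> z \<le> b" "\<forall>z\<in>T. b \<le> a \<bullet> z"
    using separating_hyperplane_sets[of "{(x, f x)}" T] by auto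
  obtain w \<beta> where a: "a = (w, \<beta>)" by (cases a)
  have le: "w \<bullet> x + \<beta> * f x \<le> w \<bullet> y + \<beta> * t" if "f y < t" for y t
  proof -
    have "(y, t) \<in> T" using that by (simp add: T_def)
    then have "b \<le> a \<bullet> (y, t)" using ab(3) by blast
    moreover have "a \<bullet> (x, f x) \<le> b" using ab(2) by blast
    ultimately show ?thesis by (simp add: a)
  qed
  have \<beta>0: "0 \<le> \<beta>" using le[of x "f x + 1"] by (simp add: algebra_simps)
  \<comment> \<open>A vertical hyperplane is impossible as \<open>f\<close> is finite everywhere:
    the point \<open>x - w\<close> would lie on the wrong side of it.\<close>
  have "\<beta> \<noteq> 0"
  proof
    assume "\<beta> = 0"
    then have "w \<bullet> x \<le> w \<bullet> (x - w)" using le[of "x - w" "f (x - w) + 1"] by simp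
    then have "w \<bullet> w \<le> 0" by (simp add: inner_diff_right)
    then have "w = 0" using inner_gt_zero_iff[of w] by fastforce
    then show False using ab(1) a \<open>\<beta> = 0\<close> by (simp add: zero_prod_def)
  qed
  then have \<beta>: "\<beta> > 0" using \<beta>0 by simp
  show ?thesis
  proof
    fix y
    have "f x + (w \<bullet> x - w \<bullet> y) / \<beta> \<le> f y"
    proof (rule field_le_epsilon)
      fix e :: real assume "e > 0"
      then have "w \<bullet> x + \<beta> * f x \<le> w \<bullet> y + \<beta> * (f y + e)" by (intro le) simp
      then show "f x + (w \<bullet> x - w \<bullet> y) / \<beta> \<le> f y + e" using \<beta> by (simp add: field_simps)
    qed
    then show "f x + (- (w /\<^sub>R \<beta>)) \<bullet> (y - x) \<le> f y"
      by (simp add: inner_diff_right divide_inverse algebra_simps)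
  qed
qed

context torus_hamiltonian
begin

definition L :: "real ^ 'n \<Rightarrow> real ^ 'n \<Rightarrow> real \<Rightarrow> real" where
  "L x v s = (SUP p. p \<bullet> v - F (q x) p s)"

lemma F_bounded:
  obtains C where "C > 0" "\<And>x p s. norm p \<le> R \<Longrightarrow> \<bar>s\<bar> \<le> B \<Longrightarrow> \<bar>F (q x) p s\<bar> \<le> C"
proof -
  let ?f = "\<lambda>x (p, s). F (q x) p s" and ?Q = "cball 0 R \<times> {-B..B} :: ((real ^ 'n) \<times> real) set"
  have c: "continuous_on (UNIV \<times> ?Q) (\<lambda>(x, a). ?f x a)"
    using continuous_on_subset[OF cont subset_UNIV] by (simp add: case_prod_beta)
  have p: "periodic \<epsilon> ?f" by (simp add: periodic_def coset_shift)
  have k: "compact ?Q" by (intro compact_Times) auto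
  obtain C where C: "C > 0" "\<And>x a. a \<in> ?Q \<Longrightarrow> norm (?f x a) \<le> C"
    by (rule periodic_bounded[OF eps p c k]) blast
  have "\<bar>F (q x) p s\<bar> \<le> C" if "norm p \<le> R" "\<bar>s\<bar> \<le> B" for x p s
    using C(2)[of "(p, s)" x] that by (simp add: abs_le_iff)
  then show ?thesis using that C(1) by blast
qed

lemma L_eqI:
  assumes "\<And>p'. p' \<bullet> v - F (q x) p' s \<le> p \<bullet> v - F (q x) p s"
  shows "L x v s = p \<bullet> v - F (q x) p s"
  unfolding L_def by (rule cSup_eq_maximum) (use assms in auto)

text \<open>A radius common to all base points, velocities in a ball and values in an interval.
  Compactness arguments for \<open>L\<close> then take place in one ball of momenta.\<close>

lemma maximizer:
  obtains R where "R > 0"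
    "\<And>x v s. norm v \<le> V \<Longrightarrow> \<bar>s\<bar> \<le> B \<Longrightarrow>
       \<exists>p. norm p \<le> R \<and> (\<forall>p'. p' \<bullet> v - F (q x) p' s \<le> p \<bullet> v - F (q x) p s)"
proof -
  \<comment> \<open>The slope \<open>V + 1\<close> leaves a surplus of \<open>norm p'\<close> over
    the linear term. Once this surplus reaches \<open>C\<close>, the momentum 0 does at least as
    well as \<open>p'\<close>.\<close>
  obtain R0 where R0: "R0 > 0" "\<And>x p s. \<bar>s\<bar> \<le> B \<Longrightarrow> R0 \<le> norm p \<Longrightarrow> (V + 1) * norm p \<le> F (q x) p s"
    by (rule uniformly_superlinear[of B "V + 1"]) blast
  obtain C where C: "C > 0" "\<And>x p s. norm p \<le> 0 \<Longrightarrow> \<bar>s\<bar> \<le> B \<Longrightarrow> \<bar>F (q x) p s\<bar> \<le> C"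
    by (rule F_bounded[of 0 B]) blast
  define R where "R = max R0 C"
  have "\<exists>p. norm p \<le> R \<and> (\<forall>p'. p' \<bullet> v - F (q x) p' s \<le> p \<bullet> v - F (q x) p s)"
    if v: "norm v \<le> V" and s: "\<bar>s\<bar> \<le> B" for x v s
  proof -
    have "continuous_on (cball 0 R) (\<lambda>p. p \<bullet> v - F (q x) p s)"
      by (intro continuous_on_diff continuous_on_inner continuous_on_F continuous_on_id continuous_on_const)
    moreover have "cball 0 R \<noteq> ({} :: (real ^ 'n) set)" using R0(1) by (simp add: R_def)
    ultimately obtain p where p: "p \<in> cball 0 R" "\<forall>p'\<in>cball 0 R. p' \<bullet> v - F (q x) p' s \<le> p \<bullet> v - F (q x) p s"
      using continuous_attains_sup[OF compact_cball] by blast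
    have "p' \<bullet> v - F (q x) p' s \<le> p \<bullet> v - F (q x) p s" for p'
    proof (cases "norm p' \<le> R")
      case False
      then have p': "R0 \<le> norm p'" "C \<le> norm p'" by (auto simp: R_def)
      have "p' \<bullet> v \<le> norm p' * norm v" by (rule norm_cauchy_schwarz)
      also have "\<dots> \<le> norm p' * V" using v by (intro mult_left_mono) auto
      finally have "p' \<bullet> v - F (q x) p' s \<le> - norm p'"
        using R0(2)[OF s p'(1), of x] by (simp add: algebra_simps)
      also have "\<dots> \<le> 0 \<bullet> v - F (q x) 0 s" using p'(2) C(2)[of 0 s x] s by simp
      also have "\<dots> \<le> p \<bullet> v - F (q x) p s" using bspec[OF p(2), of 0] R0(1) by (simp add: R_def)
      finally show ?thesis .
    qed (use p(2) in simp)
    then show ?thesis using p(1) by auto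
  qed
  moreover have "R > 0" using R0(1) by (simp add: R_def)
  ultimately show ?thesis using that by blast
qed

lemma L_maximizer:
  obtains R where "R > 0"
    "\<And>x v s. norm v \<le> V \<Longrightarrow> \<bar>s\<bar> \<le> B \<Longrightarrow> \<exists>p. norm p \<le> R \<and> L x v s = p \<bullet> v - F (q x) p s"
proof -
  obtain R where R: "R > 0" "\<And>x v s. norm v \<le> V \<Longrightarrow> \<bar>s\<bar> \<le> B \<Longrightarrow>
       \<exists>p. norm p \<le> R \<and> (\<forall>p'. p' \<bullet> v - F (q x) p' s \<le> p \<bullet> v - F (q x) p s)"
    by (rule maximizer[of V B]) blast
  have "\<exists>p. norm p \<le> R \<and> L x v s = p \<bullet> v - F (q x) p s" if "norm v \<le> V" "\<bar>s\<bar> \<le> B" for x v s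
    using R(2)[OF that, of x] L_eqI by blast
  then show ?thesis using that R(1) by blast
qed

lemma fenchel: "p \<bullet> v - F (q x) p s \<le> L x v s"
proof -
  obtain R where R: "R > 0" "\<And>x' v' s'. norm v' \<le> norm v \<Longrightarrow> \<bar>s'\<bar> \<le> \<bar>s\<bar> \<Longrightarrow>
       \<exists>p. norm p \<le> R \<and> (\<forall>p'. p' \<bullet> v' - F (q x') p' s' \<le> p \<bullet> v' - F (q x') p s')"
    by (rule maximizer[of "norm v" "\<bar>s\<bar>"]) blast
  obtain p0 where "\<forall>p'. p' \<bullet> v - F (q x) p' s \<le> p0 \<bullet> v - F (q x) p0 s"
    using R(2)[of v s x] by auto
  then show ?thesis using L_eqI[of v x s p0] by simp
qed

lemma L_antimono: "s \<le> t \<Longrightarrow> L x v t \<le> L x v s"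
proof -
  assume st: "s \<le> t"
  obtain R where R: "R > 0" "\<And>x' v' s'. norm v' \<le> norm v \<Longrightarrow> \<bar>s'\<bar> \<le> \<bar>t\<bar> \<Longrightarrow>
       \<exists>p. norm p \<le> R \<and> L x' v' s' = p \<bullet> v' - F (q x') p s'"
    by (rule L_maximizer[of "norm v" "\<bar>t\<bar>"]) blast
  obtain p where "L x v t = p \<bullet> v - F (q x) p t" using R(2)[of v t x] by auto
  then show ?thesis using fenchel[of p v x s] mono[OF st, of x p] by linarith
qed

text \<open>A momentum maximal at one point is a competitor at a neighbouring one, which gives one
  inequality; exchanging the points gives the other. The common radius makes the error
  uniform.\<close>

lemma continuous_L: "continuous_on UNIV (\<lambda>(x, v, s). L x v s)"
proof (unfold continuous_on_iff, intro ballI allI impI)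
  fix z0 :: "(real ^ 'n) \<times> (real ^ 'n) \<times> real" and e :: real assume e: "e > 0"
  obtain x0 v0 s0 where z0: "z0 = (x0, v0, s0)" by (cases z0)
  define V where "V = norm v0 + 1"
  define B where "B = \<bar>s0\<bar> + 1"
  obtain R where R: "R > 0"
    "\<And>x v s. norm v \<le> V \<Longrightarrow> \<bar>s\<bar> \<le> B \<Longrightarrow> \<exists>p. norm p \<le> R \<and> L x v s = p \<bullet> v - F (q x) p s"
    by (rule L_maximizer[of V B]) blast
  obtain r where r: "r > 0" "\<And>x y p s t. norm (x - y) < r \<Longrightarrow> norm p \<le> R \<Longrightarrow> \<bar>s\<bar> \<le> B \<Longrightarrow> \<bar>t\<bar> \<le> B \<Longrightarrow> \<bar>s - t\<bar> < r
     \<Longrightarrow> \<bar>F (q x) p s - F (q y) p t\<bar> < e / 2"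
    by (rule F_uniformly_continuous[of "e / 2" R B]) (use e in auto)
  define d where "d = Min {r, 1, e / (2 * R)}"
  have d: "d > 0" "d \<le> r" "d \<le> 1" "d \<le> e / (2 * R)" using r(1) R(1) e by (auto simp: d_def)
  have half: "L x v s < L y w t + e"
    if *: "norm (x - y) < d" "norm (v - w) < d" "\<bar>s - t\<bar> < d" "norm v \<le> V" "\<bar>s\<bar> \<le> B" "\<bar>t\<bar> \<le> B" for x y v w s t
  proof -
    obtain p where p: "norm p \<le> R" "L x v s = p \<bullet> v - F (q x) p s" using R(2)[OF *(4,5)] by blast
    have "p \<bullet> v - p \<bullet> w \<le> norm p * norm (v - w)"
      using norm_cauchy_schwarz[of p "v - w"] by (simp add: inner_diff_right)
    also have "\<dots> \<le> R * (e / (2 * R))" using p * d R(1) by (intro mult_mono) auto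
    also have "\<dots> = e / 2" using R(1) by simp
    finally have "p \<bullet> v - p \<bullet> w \<le> e / 2" .
    moreover have "\<bar>F (q x) p s - F (q y) p t\<bar> < e / 2"
      by (rule r(2)) (use * d p in auto)
    ultimately show ?thesis using fenchel[of p w y t] p(2) by linarith
  qed
  have "dist (L x v s) (L x0 v0 s0) < e" if D: "dist (x, v, s) z0 < d" for x v s
  proof -
    have 1: "dist x x0 < d" using dist_fst_le[of "(x, v, s)" z0] D by (simp add: z0)
    have "dist (v, s) (v0, s0) < d" using dist_snd_le[of "(x, v, s)" z0] D by (simp add: z0)
    then have 2: "dist v v0 < d" "dist s s0 < d"
      using dist_fst_le[of "(v, s)" "(v0, s0)"] dist_snd_le[of "(v, s)" "(v0, s0)"] by auto
    have "norm v \<le> V" "\<bar>s\<bar> \<le> B"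
      using 2 d(3) norm_triangle_sub[of v v0] by (auto simp: V_def B_def dist_norm)
    then show ?thesis
      using half[of x x0 v v0 s s0] half[of x0 x v0 v s0 s] 1 2
      by (auto simp: V_def B_def dist_norm norm_minus_commute abs_minus_commute abs_less_iff)
  qed
  then show "\<exists>d>0. \<forall>z\<in>UNIV. dist z z0 < d \<longrightarrow>
      dist (case z of (x, v, s) \<Rightarrow> L x v s) (case z0 of (x, v, s) \<Rightarrow> L x v s) < e"
    using d(1) by (auto simp: z0)
qed

lemma continuous_on_L:
  assumes "continuous_on S f" "continuous_on S g" "continuous_on S h"
  shows "continuous_on S (\<lambda>z. L (f z) (g z) (h z))"
  using continuous_on_compose2[OF continuous_L continuous_on_Pair[OF assms(1) continuous_on_Pair[OF assms(2,3)]]]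
  by simp

lemma L_periodic: "k \<in> lattice \<Longrightarrow> L (x + \<epsilon> *\<^sub>R k) v s = L x v s"
  by (simp add: L_def coset_shift)

text \<open>The reverse direction of duality: for a given momentum, a subgradient of
  \<open>F\<close> is a velocity with equality in Fenchel's inequality. Testing the subgradient at
  unit distance from \<open>p\<close> bounds it by the oscillation of \<open>F\<close> on the ball
  of radius \<open>K + 1\<close>, whence \<open>2 * C\<close>.\<close>

lemma velocity:
  obtains V where "V > 0"
    "\<And>x p s. norm p \<le> K \<Longrightarrow> \<bar>s\<bar> \<le> B \<Longrightarrow> \<exists>v. norm v \<le> V \<and> L x v s = p \<bullet> v - F (q x) p s"
proof -
  obtain C where C: "C > 0" "\<And>x p s. norm p \<le> K + 1 \<Longrightarrow> \<bar>s\<bar> \<le> B \<Longrightarrow> \<bar>F (q x) p s\<bar> \<le> C"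
    by (rule F_bounded[of "K + 1" B]) blast
  have "\<exists>v. norm v \<le> 2 * C \<and> L x v s = p \<bullet> v - F (q x) p s" if *: "norm p \<le> K" "\<bar>s\<bar> \<le> B" for x p s
  proof -
    obtain v where v: "\<And>p'. F (q x) p s + v \<bullet> (p' - p) \<le> F (q x) p' s"
      by (rule convex_subgradient[OF convex[of x s]]) blast
    have "L x v s = p \<bullet> v - F (q x) p s"
    proof (rule L_eqI)
      fix p' show "p' \<bullet> v - F (q x) p' s \<le> p \<bullet> v - F (q x) p s"
        using v[of p'] by (simp add: inner_diff_right inner_commute)
    qed
    moreover have "norm v \<le> 2 * C"
    proof (cases "v = 0")
      case False
      have "norm (p + v /\<^sub>R norm v) \<le> norm p + norm (v /\<^sub>R norm v)" by (rule norm_triangle_ineq)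
      then have "norm (p + v /\<^sub>R norm v) \<le> K + 1" using False *(1) by simp
      then have "\<bar>F (q x) (p + v /\<^sub>R norm v) s\<bar> \<le> C" using C(2) *(2) by blast
      moreover have "\<bar>F (q x) p s\<bar> \<le> C" using C(2)[of p s x] * by simp
      moreover have "v \<bullet> (v /\<^sub>R norm v) = norm v"
        using False by (simp add: power2_norm_eq_inner[symmetric] power2_eq_square)
      ultimately show ?thesis using v[of "p + v /\<^sub>R norm v"] by simp
    qed (use C(1) in simp)
    ultimately show ?thesis by blast
  qed
  then show ?thesis using that[of "2 * C"] C(1) by simp
qed

end

section \<open>One-sided derivatives of the Lagrangian in the unknown\<close>

locale contact_hamiltonian = torus_hamiltonian +
  fixes dF :: "real ^ 'a \<Rightarrow> real ^ 'a \<Rightarrow> real \<Rightarrow> real"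
  assumes F_deriv: "((\<lambda>s. F (coset \<epsilon> x) p s) has_real_derivative dF x p s) (at s)"
    and dF_cont: "continuous_on UNIV (\<lambda>(x, p, s). dF x p s)"
begin

text \<open>Danskin's theorem: the right derivative of a maximum is the largest derivative over the
  compact set \<open>M\<close> of maximizers at \<open>s\<close>. Existence at every point is what
  \<open>lagrangian_du_measurable\<close> relies on.\<close>

lemma L_right_derivative:
  obtains D where "((\<lambda>s. L x v s) has_real_derivative D) (at_right s)"
proof -
  define B where "B = \<bar>s\<bar> + 1"
  obtain R where R: "R > 0"
    "\<And>x' v' t. norm v' \<le> norm v \<Longrightarrow> \<bar>t\<bar> \<le> B \<Longrightarrow> \<exists>p. norm p \<le> R \<and> L x' v' t = p \<bullet> v' - F (q x') p t"
    by (rule L_maximizer[of "norm v" B]) blast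
  define M where "M = {p \<in> cball 0 R. L x v s = p \<bullet> v - F (q x) p s}"
  have cF: "continuous_on T (\<lambda>p. p \<bullet> v - F (q x) p t)" for t T
    by (intro continuous_on_diff continuous_on_inner continuous_on_F continuous_on_id continuous_on_const)
  have "closed {p. L x v s = p \<bullet> v - F (q x) p s}"
    by (intro closed_Collect_eq continuous_on_const cF)
  then have "compact (cball 0 R \<inter> {p. L x v s = p \<bullet> v - F (q x) p s})"
    by (intro compact_Int_closed compact_cball)
  then have "compact M" by (simp add: M_def Int_def)
  have cdF: "continuous_on T (\<lambda>z. dF x (f z) (g z))" if "continuous_on T f" "continuous_on T g" for T :: "'c::topological_space set" and f g
    using continuous_on_compose2[OF dF_cont continuous_on_Pair[OF continuous_on_const continuous_on_Pair[OF that]]]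
    by simp
  obtain pm where "norm pm \<le> R" "L x v s = pm \<bullet> v - F (q x) pm s" using R(2)[of v s x] by (auto simp: B_def)
  then have "M \<noteq> {}" by (auto simp: M_def)
  moreover have "continuous_on M (\<lambda>p. - dF x p s)"
    by (intro continuous_on_minus cdF continuous_on_id continuous_on_const)
  ultimately obtain p0 where p0: "p0 \<in> M" "\<forall>p\<in>M. - dF x p s \<le> - dF x p0 s"
    using continuous_attains_sup[OF \<open>compact M\<close>] by blast
  define D where "D = - dF x p0 s"
  define Q where "Q = (\<lambda>t. (L x v t - L x v s) / (t - s))"
  have "(Q \<longlongrightarrow> D) (at_right s)"
  proof (rule order_tendstoI)
    fix a assume "a < D"
    have "((\<lambda>t. (F (q x) p0 t - F (q x) p0 s) / (t - s)) \<longlongrightarrow> dF x p0 s) (at_right s)"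
      using has_field_derivative_at_within[OF F_deriv[of x p0 s]] by (simp add: has_field_derivative_iff)
    then have "((\<lambda>t. - ((F (q x) p0 t - F (q x) p0 s) / (t - s))) \<longlongrightarrow> D) (at_right s)"
      unfolding D_def by (rule tendsto_minus)
    then have "\<forall>\<^sub>F t in at_right s. a < - ((F (q x) p0 t - F (q x) p0 s) / (t - s))"
      using \<open>a < D\<close> by (rule order_tendstoD)
    moreover have "\<forall>\<^sub>F t in at_right s. s < t" by (rule eventually_at_right_less)
    ultimately show "\<forall>\<^sub>F t in at_right s. a < Q t"
    proof eventually_elim
      case (elim t)
      have "p0 \<bullet> v - F (q x) p0 t - (p0 \<bullet> v - F (q x) p0 s) \<le> L x v t - L x v s"
        using fenchel[of p0 v x t] p0(1) by (simp add: M_def)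
      then have "(p0 \<bullet> v - F (q x) p0 t - (p0 \<bullet> v - F (q x) p0 s)) / (t - s) \<le> Q t"
        unfolding Q_def using elim by (intro divide_right_mono) auto
      moreover have "(p0 \<bullet> v - F (q x) p0 t - (p0 \<bullet> v - F (q x) p0 s)) / (t - s)
          = - ((F (q x) p0 t - F (q x) p0 s) / (t - s))"
        by (simp add: minus_divide_left)
      ultimately show ?case using elim(1) by linarith
    qed
  next
    fix a assume "D < a"
    \<comment> \<open>Otherwise quotients at least \<open>a\<close> occur at points
      \<open>T n\<close> decreasing to \<open>s\<close>. Maximizers at \<open>T n\<close>
      subconverge to a maximizer at \<open>s\<close> by continuity of \<open>L\<close>, and the mean
      value theorem turns the quotients into a bound \<open>a\<close> on its derivative, which
      exceeds \<open>D\<close>.\<close>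
    show "\<forall>\<^sub>F t in at_right s. Q t < a"
    proof (rule ccontr)
      assume neg: "\<not> ?thesis"
      have "\<exists>t. s < t \<and> t < s + inverse (real (Suc n)) \<and> a \<le> Q t" for n
      proof (rule ccontr)
        assume "\<not> ?thesis"
        then have "\<forall>t>s. t < s + inverse (real (Suc n)) \<longrightarrow> Q t < a" by (meson linorder_not_le)
        moreover have "s < s + inverse (real (Suc n))" by simp
        ultimately have "\<forall>\<^sub>F t in at_right s. Q t < a" unfolding eventually_at_right_field by blast
        then show False using neg by blast
      qed
      then obtain T where T: "\<And>n. s < T n" "\<And>n. T n < s + inverse (real (Suc n))" "\<And>n. a \<le> Q (T n)" by metis
      have T1: "\<bar>T n\<bar> \<le> B" for n
      proof -
        have "inverse (real (Suc n)) \<le> 1" by (simp add: field_simps)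
        then show ?thesis using T(1,2)[of n] by (simp add: B_def)
      qed
      have "\<exists>p. norm p \<le> R \<and> L x v (T n) = p \<bullet> v - F (q x) p (T n)" for n
        using R(2)[OF order_refl T1] by blast
      then obtain P where P: "\<And>n. norm (P n) \<le> R" "\<And>n. L x v (T n) = P n \<bullet> v - F (q x) (P n) (T n)" by metis
      have "\<exists>\<xi>. s < \<xi> \<and> \<xi> < T n \<and> F (q x) (P n) (T n) - F (q x) (P n) s = (T n - s) * dF x (P n) \<xi>" for n
        by (rule MVT2[OF T(1)]) (rule F_deriv)
      then obtain \<Xi> where \<Xi>: "\<And>n. s < \<Xi> n" "\<And>n. \<Xi> n < T n"
        "\<And>n. F (q x) (P n) (T n) - F (q x) (P n) s = (T n - s) * dF x (P n) (\<Xi> n)" by metis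
      have le: "a \<le> - dF x (P n) (\<Xi> n)" for n
      proof -
        have "L x v (T n) - L x v s \<le> - (F (q x) (P n) (T n) - F (q x) (P n) s)"
          using fenchel[of "P n" v x s] P(2)[of n] by linarith
        then have "Q (T n) \<le> - ((T n - s) * dF x (P n) (\<Xi> n)) / (T n - s)"
          unfolding Q_def \<Xi>(3) using T(1)[of n] by (intro divide_right_mono) auto
        also have "\<dots> = - dF x (P n) (\<Xi> n)" using T(1)[of n] by simp
        finally show ?thesis using T(3)[of n] by linarith
      qed
      have "P n \<in> cball 0 R" for n using P(1) by simp
      then obtain p r where p: "p \<in> cball 0 R" "strict_mono (r :: nat \<Rightarrow> nat)" "(\<lambda>n. P (r n)) \<longlonglongrightarrow> p"
        by (rule compact_subseqE[OF compact_cball])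
      have up: "(\<lambda>n. s + inverse (real (Suc n))) \<longlonglongrightarrow> s"
        using tendsto_add[OF tendsto_const[of s] LIMSEQ_inverse_real_of_nat] by simp
      have T0: "T \<longlonglongrightarrow> s"
        by (rule tendsto_sandwich[OF _ _ tendsto_const[of s] up]) (auto intro!: always_eventually less_imp_le T(1,2) simp del: of_nat_Suc)
      have \<Xi>0: "\<Xi> \<longlonglongrightarrow> s"
        by (rule tendsto_sandwich[OF _ _ tendsto_const[of s] T0]) (auto intro!: always_eventually less_imp_le \<Xi>(1,2))
      have Tr: "(\<lambda>n. T (r n)) \<longlonglongrightarrow> s" "(\<lambda>n. \<Xi> (r n)) \<longlonglongrightarrow> s"
        using LIMSEQ_subseq_LIMSEQ[OF T0 p(2)] LIMSEQ_subseq_LIMSEQ[OF \<Xi>0 p(2)] by (simp_all add: o_def)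
      have "continuous_on UNIV (\<lambda>z. L x v (snd z) - (fst z \<bullet> v - F (q x) (fst z) (snd z)))"
        by (intro continuous_on_diff continuous_on_L continuous_on_inner continuous_on_F continuous_on_fst
            continuous_on_snd continuous_on_id continuous_on_const)
      from continuous_on_tendsto_compose[OF this tendsto_Pair[OF p(3) Tr(1)]]
      have "(\<lambda>n. L x v (T (r n)) - (P (r n) \<bullet> v - F (q x) (P (r n)) (T (r n)))) \<longlonglongrightarrow> L x v s - (p \<bullet> v - F (q x) p s)"
        by simp
      then have "L x v s - (p \<bullet> v - F (q x) p s) = 0"
        by (simp add: P(2) tendsto_const_iff)
      then have "p \<in> M" using p(1) by (simp add: M_def)
      have "continuous_on UNIV (\<lambda>z. - dF x (fst z) (snd z))"
        by (intro continuous_on_minus cdF continuous_on_fst continuous_on_snd continuous_on_id)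
      from continuous_on_tendsto_compose[OF this tendsto_Pair[OF p(3) Tr(2)]]
      have "(\<lambda>n. - dF x (P (r n)) (\<Xi> (r n))) \<longlonglongrightarrow> - dF x p s" by simp
      then have "a \<le> - dF x p s"
        by (rule tendsto_lowerbound) (auto intro: always_eventually le)
      also have "\<dots> \<le> D" using p0(2) \<open>p \<in> M\<close> by (simp add: D_def)
      finally show False using \<open>D < a\<close> by simp
    qed
  qed
  then show ?thesis using that[of D] by (simp add: has_field_derivative_iff Q_def)
qed

lemma L_right_derivative_zero_left_endpoint:
  assumes "s < t" "L x v s = L x v t"
  shows "((\<lambda>s. L x v s) has_real_derivative 0) (at_right s)"
proof -
  have "L x v y = L x v s" if "s < y" "y < t" for y
    using L_antimono[of s y x v] L_antimono[of y t x v] assms that by auto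
  then have "\<forall>\<^sub>F y in at_right s. (L x v y - L x v s) / (y - s) = 0"
    unfolding eventually_at_right_field using assms(1) by auto
  then show ?thesis unfolding has_field_derivative_iff by (rule tendsto_eventually)
qed

text \<open>For a momentum \<open>p\<close> maximal at \<open>s\<close>, Fenchel's inequality at
  \<open>t\<close> shows that \<open>F\<close> does not increase from \<open>t\<close> to
  \<open>s\<close>, so by monotonicity it is constant between them and its derivative at
  \<open>s\<close> vanishes. To the right of \<open>s\<close> the same \<open>p\<close> bounds the
  difference quotients of \<open>L\<close> from below by a quantity tending to 0; antitonicity
  bounds them above by 0.\<close>

lemma L_right_derivative_zero_right_endpoint:
  assumes "t < s" "L x v s = L x v t"
  shows "((\<lambda>s. L x v s) has_real_derivative 0) (at_right s)"
proof -
  obtain R where R: "R > 0"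
    "\<And>x' v' t. norm v' \<le> norm v \<Longrightarrow> \<bar>t\<bar> \<le> \<bar>s\<bar> \<Longrightarrow> \<exists>p. norm p \<le> R \<and> L x' v' t = p \<bullet> v' - F (q x') p t"
    by (rule L_maximizer[of "norm v" "\<bar>s\<bar>"]) blast
  obtain p where p: "L x v s = p \<bullet> v - F (q x) p s" using R(2)[OF order_refl order_refl] by blast
  have "F (q x) p s \<le> F (q x) p t" using fenchel[of p v x t] p assms by simp
  then have "F (q x) p y = F (q x) p s" if "t < y" "y < s" for y
    using mono[of t y x p] mono[of y s x p] that by simp
  then have ev: "\<forall>\<^sub>F y in at_left s. (F (q x) p y - F (q x) p s) / (y - s) = 0"
    unfolding eventually_at_left_field using assms(1) by auto
  have "((\<lambda>y. (F (q x) p y - F (q x) p s) / (y - s)) \<longlongrightarrow> 0) (at_left s)"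
    by (rule tendsto_eventually[OF ev])
  moreover have "((\<lambda>y. (F (q x) p y - F (q x) p s) / (y - s)) \<longlongrightarrow> dF x p s) (at_left s)"
    using has_field_derivative_at_within[OF F_deriv[of x p s]] by (simp add: has_field_derivative_iff)
  ultimately have d0: "dF x p s = 0"
    using tendsto_unique[OF trivial_limit_at_left_real] by blast
  have lim: "((\<lambda>y. - ((F (q x) p y - F (q x) p s) / (y - s))) \<longlongrightarrow> - dF x p s) (at_right s)"
    using has_field_derivative_at_within[OF F_deriv[of x p s]] by (intro tendsto_minus) (simp add: has_field_derivative_iff)
  have gt: "\<forall>\<^sub>F y in at_right s. s < y" by (rule eventually_at_right_less)
  have "((\<lambda>y. (L x v y - L x v s) / (y - s)) \<longlongrightarrow> 0) (at_right s)"
  proof (rule tendsto_sandwich[OF _ _ lim[unfolded d0 minus_zero] tendsto_const])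
    show "\<forall>\<^sub>F y in at_right s. - ((F (q x) p y - F (q x) p s) / (y - s)) \<le> (L x v y - L x v s) / (y - s)"
      using gt
    proof eventually_elim
      case (elim y)
      have "- (F (q x) p y - F (q x) p s) \<le> L x v y - L x v s" using fenchel[of p v x y] p by simp
      then show ?case unfolding minus_divide_left using elim by (intro divide_right_mono) auto
    qed
    show "\<forall>\<^sub>F y in at_right s. (L x v y - L x v s) / (y - s) \<le> 0"
      using gt
    proof eventually_elim
      case (elim y)
      then show ?case using L_antimono[of s y x v] by (simp add: divide_le_0_iff)
    qed
  qed
  then show ?thesis unfolding has_field_derivative_iff .
qed

end

section \<open>Mollification\<close>

lemma DERIV_max_0_squared: "((\<lambda>s. (max 0 s)\<^sup>2) has_real_derivative 2 * max 0 s) (at s)"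
proof -
  consider "s < 0" | "s = 0" | "s > 0" by linarith
  then show ?thesis
  proof cases
    case 1
    have "((\<lambda>s. 0 :: real) has_real_derivative 0) (at s)" by simp
    then have "((\<lambda>s. (max 0 s)\<^sup>2) has_real_derivative 0) (at s)"
      by (rule DERIV_cong_ev[THEN iffD1, rotated -1])
        (use 1 in \<open>auto simp: eventually_nhds intro!: exI[of _ "{..<0}"]\<close>)
    then show ?thesis using 1 by simp
  next
    case 2
    have "((\<lambda>t :: real. (max 0 t)\<^sup>2 / t) \<longlongrightarrow> 0) (at 0)"
    proof (rule Lim_null_comparison)
      show "\<forall>\<^sub>F t in at 0. norm ((max 0 t)\<^sup>2 / t) \<le> \<bar>t\<bar>"
        by (rule always_eventually) (auto simp: power2_eq_square max_def)
      show "((\<lambda>t :: real. \<bar>t\<bar>) \<longlongrightarrow> 0) (at 0)" by (auto intro!: tendsto_eq_intros)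
    qed
    then show ?thesis using 2 by (simp add: has_field_derivative_iff)
  next
    case 3
    have "((\<lambda>s. s\<^sup>2) has_real_derivative 2 * s) (at s)" by (auto intro!: derivative_eq_intros)
    then have "((\<lambda>s. (max 0 s)\<^sup>2) has_real_derivative 2 * s) (at s)"
      by (rule DERIV_cong_ev[THEN iffD1, rotated -1])
        (use 3 in \<open>auto simp: eventually_nhds intro!: exI[of _ "{0<..}"]\<close>)
    then show ?thesis using 3 by simp
  qed
qed

text \<open>Squaring the positive part makes the kernel continuously differentiable with an
  elementary gradient; test functions need only be of class \<open>C\<^sup>1\<close>. It is
  normalized later by its integral \<open>Z\<close>.\<close>

definition bump :: "real \<Rightarrow> 'a::euclidean_space \<Rightarrow> real" where
  "bump \<eta> z = (max 0 (\<eta>\<^sup>2 - z \<bullet> z))\<^sup>2"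

definition dbump :: "real \<Rightarrow> 'a::euclidean_space \<Rightarrow> 'a" where
  "dbump \<eta> z = - (4 * max 0 (\<eta>\<^sup>2 - z \<bullet> z)) *\<^sub>R z"

lemma bump_nonneg: "0 \<le> bump \<eta> z" by (simp add: bump_def)

lemma bump_eq_0: "\<eta> > 0 \<Longrightarrow> \<eta> \<le> norm z \<Longrightarrow> bump \<eta> z = 0" "\<eta> > 0 \<Longrightarrow> \<eta> \<le> norm z \<Longrightarrow> dbump \<eta> z = 0"
  unfolding bump_def dbump_def using power_mono[of \<eta> "norm z" 2] by (simp_all add: power2_norm_eq_inner)

lemma GDERIV_bump: "GDERIV (bump \<eta>) z :> dbump \<eta> z"
proof -
  have "((\<lambda>z :: 'a. \<eta>\<^sup>2 - z \<bullet> z) has_derivative (\<lambda>h. h \<bullet> (- 2 *\<^sub>R z))) (at z)"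
    by (rule derivative_eq_intros refl)+ (auto simp: inner_commute)
  then have "GDERIV (\<lambda>z :: 'a. \<eta>\<^sup>2 - z \<bullet> z) z :> - 2 *\<^sub>R z" by (simp add: gderiv_def)
  from GDERIV_DERIV_compose[OF this DERIV_max_0_squared]
  show ?thesis by (simp add: bump_def[abs_def] dbump_def)
qed

lemma continuous_on_bump [continuous_intros]:
  fixes f :: "'b::topological_space \<Rightarrow> 'a::euclidean_space"
  shows "continuous_on S f \<Longrightarrow> continuous_on S (\<lambda>x. bump \<eta> (f x))"
  unfolding bump_def by (intro continuous_intros)

lemma continuous_on_dbump [continuous_intros]:
  fixes f :: "'b::topological_space \<Rightarrow> 'a::euclidean_space"
  shows "continuous_on S f \<Longrightarrow> continuous_on S (\<lambda>x. dbump \<eta> (f x))"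
  unfolding dbump_def by (intro continuous_intros)

lemma mollify:
  fixes f :: "real ^ 'n \<Rightarrow> real"
  assumes "periodic \<epsilon> f" "continuous_on UNIV f" "\<eta> > 0"
  obtains g dg where "periodic \<epsilon> g" "periodic \<epsilon> dg" "\<And>x. GDERIV g x :> dg x" "continuous_on UNIV dg"
    "\<And>y v m C. (\<And>z h. norm z \<le> \<eta> \<Longrightarrow> 0 < h \<Longrightarrow> f (y + z) - f (y + z - h *\<^sub>R v) \<le> h * m + C * h\<^sup>2) \<Longrightarrow> dg y \<bullet> v \<le> m"
proof -
  let ?one = "(\<chi> i. 1) :: real ^ 'n"
  define a where "a = - \<eta> *\<^sub>R ?one"
  define b where "b = \<eta> *\<^sub>R ?one"
  define Z where "Z = integral (cbox a b) (bump \<eta>)"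
  have int: "k integrable_on cbox c d" if "continuous_on UNIV k" for k :: "real ^ 'n \<Rightarrow> 'b::banach" and c d
    by (rule integrable_continuous[OF continuous_on_subset[OF that subset_UNIV]])
  have cf: "continuous_on S (\<lambda>x. f (k x))" if "continuous_on S k" for S :: "'b::topological_space set" and k
    by (rule continuous_on_compose2[OF assms(2) that]) simp
  have Z: "Z > 0"
  proof -
    have "0 \<in> box a b" using assms(3) by (simp add: a_def b_def mem_box_cart)
    then have "box a b \<noteq> {}" by blast
    moreover have "continuous_on (cbox a b) (bump \<eta>)"
      using continuous_on_bump[OF continuous_on_id, of "cbox a b" \<eta>] by simp
    moreover have "bump \<eta> (0 :: real ^ 'n) \<noteq> 0" "0 \<in> cbox a b"
      using assms(3) \<open>0 \<in> box a b\<close> box_subset_cbox by (auto simp: bump_def)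
    ultimately have "Z \<noteq> 0"
      unfolding Z_def using integral_cbox_eq_0_iff[of a b "bump \<eta>"] bump_nonneg[of \<eta>] by blast
    moreover have "0 \<le> Z" unfolding Z_def by (rule integral_nonneg[OF int]) (use continuous_on_bump[OF continuous_on_id, of UNIV \<eta>] bump_nonneg in auto)
    ultimately show ?thesis by simp
  qed
  have outside: "z - y \<in> cbox a b" if "norm (z - y) < \<eta>" for z y :: "real ^ 'n"
    unfolding mem_box_cart a_def b_def
  proof
    fix i show "(- \<eta> *\<^sub>R ?one) $ i \<le> (z - y) $ i \<and> (z - y) $ i \<le> (\<eta> *\<^sub>R ?one) $ i"
      using component_le_norm_cart[of "z - y" i] that by auto
  qed
  \<comment> \<open>The convolution is needed in two forms: translating \<open>f\<close> shows
    periodicity and averages increments, translating the kernel permits differentiation under the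
    integral. The enlarged box depends only on \<open>y0\<close>, so the domain of integration is
    fixed while \<open>y\<close> varies in the unit ball.\<close>
  have shift: "integral (cbox a b) (\<lambda>z. k z (z + y)) = integral (cbox (a + y0 - ?one) (b + y0 + ?one)) (\<lambda>z. k (z - y) z)"
    if y: "y \<in> ball y0 1" and k: "\<And>z w. \<eta> \<le> norm z \<Longrightarrow> k z w = 0" for k :: "real ^ 'n \<Rightarrow> real ^ 'n \<Rightarrow> 'b::banach" and y y0
  proof -
    have "integral (cbox a b) (\<lambda>z. k z (z + y)) = integral (cbox a b) ((\<lambda>z. k (z - y) z) \<circ> ((+) y))"
      by (simp add: o_def add.commute)
    also have "\<dots> = integral (cbox (a + y) (b + y)) (\<lambda>z. k (z - y) z)" by (rule integral_shift_cbox_plus)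
    also have "\<dots> = integral UNIV (\<lambda>z. if z \<in> cbox (a + y) (b + y) then k (z - y) z else 0)"
      by (rule integral_restrict_UNIV[symmetric])
    also have "(\<lambda>z. if z \<in> cbox (a + y) (b + y) then k (z - y) z else 0) =
        (\<lambda>z. if z \<in> cbox (a + y0 - ?one) (b + y0 + ?one) then k (z - y) z else 0)"
    proof
      fix z
      have "z \<in> cbox (a + y) (b + y) \<and> z \<in> cbox (a + y0 - ?one) (b + y0 + ?one)" if "norm (z - y) < \<eta>"
      proof -
        have *: "a $ i \<le> (z - y) $ i" "(z - y) $ i \<le> b $ i" for i
          using outside[OF that] by (auto simp: mem_box_cart)
        have **: "\<bar>(y - y0) $ i\<bar> \<le> 1" for i
          using component_le_norm_cart[of "y - y0" i] y by (simp add: dist_norm norm_minus_commute)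
        show ?thesis unfolding mem_box_cart
        proof (intro conjI allI)
          fix i show "(a + y) $ i \<le> z $ i" "z $ i \<le> (b + y) $ i"
            "(a + y0 - ?one) $ i \<le> z $ i" "z $ i \<le> (b + y0 + ?one) $ i"
            using *[of i] **[of i] by (auto simp: abs_le_iff)
        qed
      qed
      then show "(if z \<in> cbox (a + y) (b + y) then k (z - y) z else 0) =
        (if z \<in> cbox (a + y0 - ?one) (b + y0 + ?one) then k (z - y) z else 0)"
        using k[of "z - y" z] by (cases "norm (z - y) < \<eta>") auto
    qed
    also have "integral UNIV \<dots> = integral (cbox (a + y0 - ?one) (b + y0 + ?one)) (\<lambda>z. k (z - y) z)"
      by (rule integral_restrict_UNIV)
    finally show ?thesis .
  qed
  define g0 where "g0 y = integral (cbox a b) (\<lambda>z. bump \<eta> z * f (z + y))" for y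
  define dg0 where "dg0 y = integral (cbox a b) (\<lambda>z. - f (z + y) *\<^sub>R dbump \<eta> z)" for y
  have cont_k: "continuous_on (S \<times> T) (\<lambda>(y, z). - f z *\<^sub>R dbump \<eta> (z - y))" for S T
    unfolding case_prod_beta
    by (intro continuous_on_scaleR continuous_on_minus cf continuous_on_dbump continuous_on_diff
        continuous_on_fst continuous_on_snd continuous_on_id)
  have local_dg0: "dg0 y = integral (cbox (a + y0 - ?one) (b + y0 + ?one)) (\<lambda>z. - f z *\<^sub>R dbump \<eta> (z - y))"
    if "y \<in> ball y0 1" for y y0
    unfolding dg0_def by (rule shift[OF that, of "\<lambda>z w. - f w *\<^sub>R dbump \<eta> z"]) (simp add: bump_eq_0 assms(3))
  have local_g0: "g0 y = integral (cbox (a + y0 - ?one) (b + y0 + ?one)) (\<lambda>z. bump \<eta> (z - y) * f z)"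
    if "y \<in> ball y0 1" for y y0
    unfolding g0_def by (rule shift[OF that, of "\<lambda>z w. bump \<eta> z * f w"]) (simp add: bump_eq_0 assms(3))
  have dg0_cont: "continuous_on UNIV dg0"
  proof (rule continuous_at_imp_continuous_on, rule ballI)
    fix y0
    have "continuous_on (ball y0 1) dg0"
      using integral_continuous_on_param[OF cont_k, of "ball y0 1" "a + y0 - ?one" "b + y0 + ?one"] local_dg0[of _ y0]
      by (subst continuous_on_cong[OF refl]) auto
    then show "isCont dg0 y0" by (rule continuous_on_interior) simp
  qed
  have g0_deriv: "GDERIV g0 y0 :> dg0 y0" for y0
  proof -
    let ?A = "a + y0 - ?one" and ?B = "b + y0 + ?one"
    define fx where "fx = (\<lambda>y z. blinfun_inner_left (- f z *\<^sub>R dbump \<eta> (z - y)))"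
    have "((\<lambda>y. integral (cbox ?A ?B) (\<lambda>z. bump \<eta> (z - y) * f z)) has_derivative integral (cbox ?A ?B) (fx y0)) (at y0 within ball y0 1)"
    proof (rule leibniz_rule[where fx = fx])
      show "((\<lambda>y. bump \<eta> (z - y) * f z) has_derivative blinfun_apply (fx y z)) (at y within ball y0 1)" for y z
      proof -
        have "((\<lambda>y. z - y) has_derivative (\<lambda>h. - h)) (at y)" by (auto intro!: derivative_eq_intros)
        moreover have "(bump \<eta> has_derivative (\<lambda>h. h \<bullet> dbump \<eta> (z - y))) (at (z - y))"
          using GDERIV_bump by (simp add: gderiv_def)
        ultimately have "((\<lambda>y. bump \<eta> (z - y)) has_derivative (\<lambda>h. - h \<bullet> dbump \<eta> (z - y))) (at y)"
          by (rule has_derivative_compose)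
        then have "((\<lambda>y. bump \<eta> (z - y) * f z) has_derivative (\<lambda>h. (- h \<bullet> dbump \<eta> (z - y)) * f z)) (at y)"
          by (rule has_derivative_mult_left)
        moreover have "(\<lambda>h. (- h \<bullet> dbump \<eta> (z - y)) * f z) = blinfun_apply (fx y z)"
          by (simp add: fx_def fun_eq_iff)
        ultimately show ?thesis by (metis has_derivative_at_withinI)
      qed
      show "(\<lambda>z. bump \<eta> (z - y) * f z) integrable_on cbox ?A ?B" for y
        by (intro int continuous_on_mult continuous_on_bump continuous_on_diff continuous_on_id continuous_on_const assms(2))
      show "continuous_on (ball y0 1 \<times> cbox ?A ?B) (\<lambda>(y, z). fx y z)"
        using bounded_linear.continuous_on[OF bounded_linear_blinfun_inner_left cont_k] by (simp add: fx_def case_prod_beta)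
    qed auto
    moreover have "blinfun_apply (integral (cbox ?A ?B) (fx y0)) = (\<lambda>h. h \<bullet> dg0 y0)"
    proof -
      have "(\<lambda>z. - f z *\<^sub>R dbump \<eta> (z - y0)) integrable_on cbox ?A ?B"
        by (intro int continuous_on_scaleR continuous_on_minus assms(2) continuous_on_dbump continuous_on_diff continuous_on_id continuous_on_const)
      from integral_linear[OF this bounded_linear_blinfun_inner_left]
      have "integral (cbox ?A ?B) (fx y0) = blinfun_inner_left (dg0 y0)"
        using local_dg0[of y0 y0] by (simp add: fx_def o_def)
      then show ?thesis by (simp add: fun_eq_iff)
    qed
    ultimately have "((\<lambda>y. integral (cbox ?A ?B) (\<lambda>z. bump \<eta> (z - y) * f z)) has_derivative (\<lambda>h. h \<bullet> dg0 y0)) (at y0 within ball y0 1)"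
      by simp
    then have "(g0 has_derivative (\<lambda>h. h \<bullet> dg0 y0)) (at y0 within ball y0 1)"
      by (rule has_derivative_transform[rotated 2]) (auto simp: local_g0)
    moreover have "at y0 within ball y0 1 = at y0" by (rule at_within_open) auto
    ultimately show ?thesis by (simp only: gderiv_def)
  qed
  have per: "z + (y + \<epsilon> *\<^sub>R k) = z + y + \<epsilon> *\<^sub>R k" for z y k :: "real ^ 'n" by simp
  have per0: "periodic \<epsilon> g0" "periodic \<epsilon> dg0"
    unfolding periodic_def g0_def dg0_def per by (simp_all add: periodicD[OF assms(1)])
  have bound: "dg0 y \<bullet> v \<le> Z * m"
    if le: "\<And>z h. norm z \<le> \<eta> \<Longrightarrow> 0 < h \<Longrightarrow> f (y + z) - f (y + z - h *\<^sub>R v) \<le> h * m + C * h\<^sup>2" for y v m C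
  proof -
    have step: "g0 y - g0 (y + (- h) *\<^sub>R v) \<le> Z * (h * m + C * h\<^sup>2)" if h: "0 < h" for h
    proof -
      have i1: "(\<lambda>z. bump \<eta> z * f (z + w)) integrable_on cbox a b" for w
        by (intro int continuous_on_mult continuous_on_bump cf continuous_on_add continuous_on_id continuous_on_const)
      have "g0 y - g0 (y + (- h) *\<^sub>R v) = integral (cbox a b) (\<lambda>z. bump \<eta> z * f (z + y) - bump \<eta> z * f (z + (y + (- h) *\<^sub>R v)))"
        unfolding g0_def by (rule integral_diff[symmetric]) (rule i1)+
      also have "\<dots> \<le> integral (cbox a b) (\<lambda>z. bump \<eta> z * (h * m + C * h\<^sup>2))"
      proof (rule integral_le)
        show "(\<lambda>z. bump \<eta> z * f (z + y) - bump \<eta> z * f (z + (y + (- h) *\<^sub>R v))) integrable_on cbox a b"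
          by (intro integrable_diff i1)
        show "(\<lambda>z. bump \<eta> z * (h * m + C * h\<^sup>2)) integrable_on cbox a b"
          by (intro int continuous_on_mult continuous_on_bump continuous_on_id continuous_on_const)
        fix z
        show "bump \<eta> z * f (z + y) - bump \<eta> z * f (z + (y + (- h) *\<^sub>R v)) \<le> bump \<eta> z * (h * m + C * h\<^sup>2)"
        proof (cases "norm z \<le> \<eta>")
          case True
          have "f (z + y) - f (z + (y + (- h) *\<^sub>R v)) \<le> h * m + C * h\<^sup>2"
            using le[OF True h] by (simp add: algebra_simps)
          then have "bump \<eta> z * (f (z + y) - f (z + (y + (- h) *\<^sub>R v))) \<le> bump \<eta> z * (h * m + C * h\<^sup>2)"
            by (rule mult_left_mono[OF _ bump_nonneg])
          then show ?thesis by (simp add: right_diff_distrib)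
        next
          case False
          then show ?thesis using bump_eq_0(1)[OF assms(3), of z] by simp
        qed
      qed
      also have "\<dots> = Z * (h * m + C * h\<^sup>2)" unfolding Z_def by (rule integral_mult_left)
      finally show ?thesis .
    qed
    have "((\<lambda>t. g0 (y + t *\<^sub>R v)) has_real_derivative (v \<bullet> dg0 y)) (at 0)"
    proof -
      have "((\<lambda>t :: real. y + t *\<^sub>R v) has_derivative (\<lambda>t. t *\<^sub>R v)) (at 0)"
        by (auto intro!: derivative_eq_intros)
      moreover have "(g0 has_derivative (\<lambda>h. h \<bullet> dg0 y)) (at (y + 0 *\<^sub>R v))"
        using g0_deriv[of y] by (simp add: gderiv_def)
      ultimately have "((\<lambda>t. g0 (y + t *\<^sub>R v)) has_derivative (\<lambda>t. t *\<^sub>R v \<bullet> dg0 y)) (at 0)"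
        by (rule has_derivative_compose)
      then show ?thesis by (simp add: has_field_derivative_def mult_commute_abs)
    qed
    \<comment> \<open>The hypothesis concerns backward increments, so the derivative is computed
      from the left.\<close>
    then have "((\<lambda>t. g0 (y + t *\<^sub>R v)) has_real_derivative (v \<bullet> dg0 y)) (at_left 0)"
      by (rule has_field_derivative_at_within)
    then have lim1: "((\<lambda>t. (g0 (y + t *\<^sub>R v) - g0 y) / t) \<longlongrightarrow> v \<bullet> dg0 y) (at_left 0)"
      by (simp add: has_field_derivative_iff)
    have lim2: "((\<lambda>t. Z * (m - C * t)) \<longlongrightarrow> Z * (m - C * 0)) (at_left 0)"
      by (intro tendsto_intros)
    have "\<forall>\<^sub>F t in at_left 0. (g0 (y + t *\<^sub>R v) - g0 y) / t \<le> Z * (m - C * t)"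
    proof (rule eventually_at_leftI[of "- 1"])
      fix t :: real assume "t \<in> {- 1<..<0}"
      then have t: "t < 0" by simp
      have "g0 y - g0 (y + t *\<^sub>R v) \<le> Z * ((- t) * m + C * t\<^sup>2)" using step[of "- t"] t by simp
      also have "\<dots> = (- t) * (Z * (m - C * t))" by (simp add: algebra_simps power2_eq_square)
      finally have "t * (Z * (m - C * t)) \<le> g0 (y + t *\<^sub>R v) - g0 y" by linarith
      then show "(g0 (y + t *\<^sub>R v) - g0 y) / t \<le> Z * (m - C * t)"
        using t by (simp add: neg_divide_le_eq mult.commute)
    qed simp
    from tendsto_le[OF trivial_limit_at_left_real lim2 lim1 this] show ?thesis by (simp add: inner_commute)
  qed
  show ?thesis
  proof (rule that[of "\<lambda>x. g0 x / Z" "\<lambda>x. dg0 x /\<^sub>R Z"])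
    show "periodic \<epsilon> (\<lambda>x. g0 x / Z)" "periodic \<epsilon> (\<lambda>x. dg0 x /\<^sub>R Z)"
      using per0 by (simp_all add: periodic_def)
    show "GDERIV (\<lambda>x. g0 x / Z) x :> dg0 x /\<^sub>R Z" for x
      using GDERIV_mult[OF GDERIV_const[of "inverse Z"] g0_deriv[of x]] by (simp add: divide_inverse mult.commute)
    show "continuous_on UNIV (\<lambda>x. dg0 x /\<^sub>R Z)"
      by (intro continuous_on_scaleR continuous_on_const dg0_cont)
    fix y v m C
    assume "\<And>z h. norm z \<le> \<eta> \<Longrightarrow> 0 < h \<Longrightarrow> f (y + z) - f (y + z - h *\<^sub>R v) \<le> h * m + C * h\<^sup>2"
    then have "dg0 y \<bullet> v \<le> Z * m" by (rule bound)
    then show "(dg0 y /\<^sub>R Z) \<bullet> v \<le> m" using Z by (simp add: field_simps)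
  qed
qed

context torus_hamiltonian
begin

text \<open>The Hamiltonian inequality is kept in its dual form, against every velocity. In that
  form it is linear in the gradient, so the average over the kernel preserves it without Jensen's
  inequality.\<close>

lemma C1_approximate_subsolution:
  assumes u: "visc_subsolution \<epsilon> F c u" and "\<delta> > 0"
  obtains \<phi> d\<phi> where "torus_C1 \<epsilon> \<phi> d\<phi>" "\<And>y v. d\<phi> (q y) \<bullet> v \<le> L y v (u (q y)) + c + \<delta>"
proof -
  define f where "f = (\<lambda>x. u (q x))"
  have f: "periodic \<epsilon> f" "continuous_on UNIV f"
    using periodic_coset visc_subsolution_continuous[OF u] by (auto simp: f_def)
  obtain B where B: "B > 0" "\<And>x. norm (f x) \<le> B" by (rule periodic_bounded1[OF eps f]) blast
  obtain K where K: "K > 0" "\<And>x p s. \<bar>s\<bar> \<le> B \<Longrightarrow> F (q x) p s \<le> c \<Longrightarrow> norm p \<le> K"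
    by (rule coercive[of B c]) blast
  obtain r1 where r1: "r1 > 0" "\<And>x y p s t. norm (x - y) < r1 \<Longrightarrow> norm p \<le> K \<Longrightarrow> \<bar>s\<bar> \<le> B \<Longrightarrow> \<bar>t\<bar> \<le> B \<Longrightarrow> \<bar>s - t\<bar> < r1
     \<Longrightarrow> \<bar>F (q x) p s - F (q y) p t\<bar> < \<delta>"
    by (rule F_uniformly_continuous[OF \<open>\<delta> > 0\<close>, of K B]) blast
  obtain r2 where r2: "r2 > 0" "\<And>x y. norm (x - y) < r2 \<Longrightarrow> dist (f x) (f y) < r1"
    by (rule periodic_uniformly_continuous1[OF eps f r1(1)]) blast
  \<comment> \<open>Two distances add up: from the maximizer to \<open>y\<close>, and from
    \<open>y\<close> to the point \<open>y0\<close> at which the Lagrangian is read. The second is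
    the radius of the mollifier.\<close>
  define r where "r = min r1 r2 / 2"
  have r: "r > 0" "2 * r \<le> r1" "2 * r \<le> r2" using r1(1) r2(1) by (auto simp: r_def)
  obtain A0 where A0: "A0 > 0" "\<And>A y. A \<ge> A0 \<Longrightarrow>
      \<exists>x. norm (x - y) < r \<and> (\<forall>z. f z - A * pen \<epsilon> (z - y) \<le> f x - A * pen \<epsilon> (x - y))"
    by (rule supconv_near[OF eps f r(1)]) blast
  define W where "W = supconv \<epsilon> A0 f"
  have step: "\<exists>p. norm p \<le> K \<and> (\<forall>v y0. norm (y - y0) \<le> r \<longrightarrow> p \<bullet> v \<le> L y0 v (f y0) + c + \<delta>) \<and>
      (\<forall>z. W y - W (y - z) \<le> p \<bullet> z + A0 / 2 * (norm z)\<^sup>2)" for y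
  proof -
    obtain x where x: "norm (x - y) < r" "\<And>z. f z - A0 * pen \<epsilon> (z - y) \<le> f x - A0 * pen \<epsilon> (x - y)"
      using A0(2)[OF order_refl] by blast
    let ?p = "A0 *\<^sub>R dpen \<epsilon> (x - y)"
    have sub: "F (q x) ?p (f x) \<le> c"
      unfolding f_def by (rule visc_subsolution_pen[OF eps u]) (use x(2) in \<open>simp add: f_def\<close>)
    have pK: "norm ?p \<le> K" using K(2)[OF _ sub] B(2)[of x] by simp
    have "?p \<bullet> v \<le> L y0 v (f y0) + c + \<delta>" if y0: "norm (y - y0) \<le> r" for v y0
    proof -
      have xy0: "norm (x - y0) < 2 * r" using norm_triangle_ineq[of "x - y" "y - y0"] x(1) y0 by simp
      have "\<bar>F (q x) ?p (f x) - F (q y0) ?p (f y0)\<bar> < \<delta>"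
        using r1(2)[of x y0 ?p "f x" "f y0"] xy0 r pK B(2)[of x] B(2)[of y0] r2(2)[of x y0] by (simp add: dist_real_def)
      then show ?thesis using fenchel[of ?p v y0 "f y0"] sub by linarith
    qed
    moreover have "W y - W (y - z) \<le> ?p \<bullet> z + A0 / 2 * (norm z)\<^sup>2" for z
      using supconv_semiconvex[OF eps f _ x(2), of z] A0(1) by (simp add: W_def)
    ultimately show ?thesis using pK by blast
  qed
  have Wlip: "W y - K * norm z \<le> W (y - z)" for y z
  proof (rule iterate_quadratic_bound[where C = "A0 / 2"])
    fix y z
    obtain p where p: "norm p \<le> K" "W y - W (y - z) \<le> p \<bullet> z + A0 / 2 * (norm z)\<^sup>2" using step[of y] by blast
    have "norm p * norm z \<le> K * norm z" using p(1) by (intro mult_right_mono) auto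
    then show "W y - K * norm z - A0 / 2 * (norm z)\<^sup>2 \<le> W (y - z)"
      using norm_cauchy_schwarz[of p z] p(2) by linarith
  qed
  have "continuous_on UNIV W"
  proof (rule lipschitz_on_continuous_on)
    show "K-lipschitz_on UNIV W"
    proof (rule lipschitz_onI)
      fix x y show "dist (W x) (W y) \<le> K * dist x y"
        using Wlip[of x "x - y"] Wlip[of y "y - x"] by (simp add: dist_real_def dist_norm norm_minus_commute abs_le_iff)
    qed (use K(1) in simp)
  qed
  then obtain g dg where g: "periodic \<epsilon> g" "periodic \<epsilon> dg" "\<And>x. GDERIV g x :> dg x" "continuous_on UNIV dg"
    "\<And>y v m C. (\<And>z h. norm z \<le> r \<Longrightarrow> 0 < h \<Longrightarrow> W (y + z) - W (y + z - h *\<^sub>R v) \<le> h * m + C * h\<^sup>2) \<Longrightarrow> dg y \<bullet> v \<le> m"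
    by (rule mollify[OF periodic_supconv[OF eps, of A0 f, folded W_def] _ r(1)]) blast
  obtain \<phi> d\<phi> where \<phi>: "torus_C1 \<epsilon> \<phi> d\<phi>" "\<And>x. \<phi> (coset \<epsilon> x) = g x" "\<And>x. d\<phi> (coset \<epsilon> x) = dg x"
    by (rule torus_C1_coset[OF g(1-4)]) blast
  have "dg y \<bullet> v \<le> L y v (f y) + c + \<delta>" for y v
  proof (rule g(5)[where C = "A0 / 2 * (norm v)\<^sup>2"])
    fix z :: "real ^ 'n" and h :: real assume z: "norm z \<le> r" and h: "0 < h"
    obtain p where p: "\<forall>v y0. norm (y + z - y0) \<le> r \<longrightarrow> p \<bullet> v \<le> L y0 v (f y0) + c + \<delta>"
      "\<forall>w. W (y + z) - W (y + z - w) \<le> p \<bullet> w + A0 / 2 * (norm w)\<^sup>2" using step[of "y + z"] by blast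
    have "p \<bullet> v \<le> L y v (f y) + c + \<delta>" using p(1) z by simp
    then have "h * (p \<bullet> v) \<le> h * (L y v (f y) + c + \<delta>)" using h by simp
    moreover have "W (y + z) - W (y + z - h *\<^sub>R v) \<le> p \<bullet> (h *\<^sub>R v) + A0 / 2 * (norm (h *\<^sub>R v))\<^sup>2" using p(2) by blast
    moreover have "(norm (h *\<^sub>R v))\<^sup>2 = (norm v)\<^sup>2 * h\<^sup>2" by (simp add: power_mult_distrib)
    ultimately show "W (y + z) - W (y + z - h *\<^sub>R v) \<le> h * (L y v (f y) + c + \<delta>) + A0 / 2 * (norm v)\<^sup>2 * h\<^sup>2"
      by simp
  qed
  then show ?thesis using that[OF \<phi>(1)] \<phi>(3) by (simp add: f_def)
qed

end

section \<open>Discrete calibrated chains\<close>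

text \<open>The supersolution inequality bounds momenta from the wrong side, so for the
  inf-convolution the bound has to come from the Lipschitz constant of the function itself: a longer
  penalty gradient \<open>p\<close> would let a move from \<open>x\<close> along \<open>- p\<close>
  improve on the maximizer.\<close>

lemma supconv_gradient_bound:
  fixes f :: "real ^ 'n \<Rightarrow> real"
  assumes "\<epsilon> > 0" "A \<ge> 0" and lip: "\<And>x y. \<bar>f x - f y\<bar> \<le> K * norm (x - y)"
    and x: "\<And>z. f z - A * pen \<epsilon> (z - y) \<le> f x - A * pen \<epsilon> (x - y)"
  shows "norm (A *\<^sub>R dpen \<epsilon> (x - y)) \<le> K"
proof (rule ccontr)
  define p where "p = A *\<^sub>R dpen \<epsilon> (x - y)"
  assume "\<not> ?thesis"
  then have Kp: "K < norm p" by (simp add: p_def)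
  have K0: "0 \<le> K" using lip[of "axis undefined 1" 0] by (simp add: norm_axis_1) 
  \<comment> \<open>Small enough that \<open>A * \<tau> * norm p \<le> norm p - K\<close>, so half
    of that excess absorbs the quadratic term; \<open>A + 1\<close> avoids division by zero.\<close>
  define \<tau> where "\<tau> = (norm p - K) / ((A + 1) * norm p)"
  have \<tau>: "\<tau> > 0" unfolding \<tau>_def using Kp K0 assms(2) by (intro divide_pos_pos mult_pos_pos) linarith+
  have "f (x - \<tau> *\<^sub>R p) - A * pen \<epsilon> (x - \<tau> *\<^sub>R p - y) \<le> f x - A * pen \<epsilon> (x - y)" by (rule x)
  moreover have "A * pen \<epsilon> (x - \<tau> *\<^sub>R p - y) \<le> A * pen \<epsilon> (x - y) - \<tau> * (norm p)\<^sup>2 + A * (\<tau> * norm p)\<^sup>2 / 2"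
  proof -
    have "A * pen \<epsilon> ((x - y) + (- (\<tau> *\<^sub>R p))) \<le>
        A * (pen \<epsilon> (x - y) + dpen \<epsilon> (x - y) \<bullet> (- (\<tau> *\<^sub>R p)) + (norm (- (\<tau> *\<^sub>R p)))\<^sup>2 / 2)"
      by (intro mult_left_mono pen_add_le assms)
    also have "\<dots> = A * pen \<epsilon> (x - y) - \<tau> * (p \<bullet> p) + A * (\<tau> * norm p)\<^sup>2 / 2"
      using \<tau> by (simp add: p_def algebra_simps)
    also have "(x - y) + (- (\<tau> *\<^sub>R p)) = x - \<tau> *\<^sub>R p - y" by simp
    finally show ?thesis by (simp add: power2_norm_eq_inner)
  qed
  moreover have "\<bar>f x - f (x - \<tau> *\<^sub>R p)\<bar> \<le> K * (\<tau> * norm p)"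
    using lip[of x "x - \<tau> *\<^sub>R p"] \<tau> by simp
  ultimately have "\<tau> * (norm p)\<^sup>2 \<le> K * (\<tau> * norm p) + A * (\<tau> * norm p)\<^sup>2 / 2"
    by linarith
  then have "(\<tau> * norm p) * norm p \<le> (\<tau> * norm p) * (K + A * (\<tau> * norm p) / 2)"
    by (simp add: power2_eq_square algebra_simps)
  moreover have "0 < \<tau> * norm p" using \<tau> Kp K0 by (intro mult_pos_pos) linarith+
  ultimately have "norm p \<le> K + A * (\<tau> * norm p) / 2" by (simp only: mult_le_cancel_left_pos)
  moreover have "A * (\<tau> * norm p) \<le> norm p - K"
  proof -
    have "norm p \<noteq> 0" using Kp K0 by linarith
    then have "\<tau> * norm p = (norm p - K) / (A + 1)" by (simp add: \<tau>_def)
    moreover have "A / (A + 1) \<le> 1" using assms(2) by simp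
    ultimately show ?thesis
      using mult_right_mono[of "A / (A + 1)" 1 "norm p - K"] Kp by (simp add: field_simps)
  qed
  ultimately show False using Kp by simp
qed

context torus_hamiltonian
begin

text \<open>\<open>V\<close> and \<open>C\<close> are fixed before the horizon \<open>T\<close> and
  the tolerance \<open>e\<close>. Since the total cost above \<open>- c\<close> is bounded by
  \<open>C\<close> plus the tolerance, it disappears on division by a long elapsed time.
  \<open>C\<close> is \<open>2 * B\<close>, a bound for the oscillation of the
  inf-convolution.\<close>

lemma calibrated_chain:
  assumes u: "visc_solution \<epsilon> F c u" and w: "visc_subsolution \<epsilon> F c w"
    and x0: "w (q x0) - u (q x0) = M" "M > 0" and M: "\<And>x. w (q x) - u (q x) \<le> M"
  obtains V C where "V > 0" "C > 0"
    "\<And>T e. T \<ge> 1 \<Longrightarrow> e > 0 \<Longrightarrow> \<exists>N h y v. 0 < N \<and> 0 < h \<and> h \<le> e \<and> T \<le> real N * h \<and>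
       (\<forall>k<N. norm (v k) \<le> V \<and> y (Suc k) = y k - h *\<^sub>R v k \<and> M - e \<le> w (q (y k)) - u (q (y k))) \<and>
       h * (\<Sum>k<N. L (y k) (v k) (u (q (y k))) + c) \<le> C + e \<and>
       h * (\<Sum>k<N. L (y k) (v k) (u (q (y k))) - L (y k) (v k) (w (q (y k)))) \<le> e"
proof -
  have usub: "visc_subsolution \<epsilon> F c u" and usup: "visc_supersolution \<epsilon> F c u"
    using u by (auto simp: visc_solution_def)
  define f where "f = (\<lambda>x. u (q x))"
  define g where "g = (\<lambda>x. w (q x))"
  have f: "periodic \<epsilon> f" "continuous_on UNIV f"
    using periodic_coset visc_subsolution_continuous[OF usub] by (auto simp: f_def)
  have g: "periodic \<epsilon> g" "continuous_on UNIV g"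
    using periodic_coset visc_subsolution_continuous[OF w] by (auto simp: g_def)
  have f': "periodic \<epsilon> (\<lambda>x. - f x)" "continuous_on UNIV (\<lambda>x. - f x)"
    using f by (auto simp: periodic_def intro: continuous_on_minus)
  obtain B where B: "B > 0" "\<And>x. norm (f x) \<le> B" by (rule periodic_bounded1[OF eps f]) blast
  obtain K where K: "K > 0" "\<And>x p s. \<bar>s\<bar> \<le> B \<Longrightarrow> F (q x) p s \<le> c \<Longrightarrow> norm p \<le> K"
    by (rule coercive[of B c]) blast
  have lip: "\<bar>f x - f y\<bar> \<le> K * norm (x - y)" for x y
    unfolding f_def
  proof (rule visc_subsolution_lipschitz[OF eps usub])
    fix x p assume "F (q x) p (u (q x)) \<le> c"
    then show "norm p \<le> K" using K(2) B(2)[of x] by (simp add: f_def)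
  qed
  obtain V where V: "V > 0"
    "\<And>x p s. norm p \<le> K \<Longrightarrow> \<bar>s\<bar> \<le> B \<Longrightarrow> \<exists>v. norm v \<le> V \<and> L x v s = p \<bullet> v - F (q x) p s"
    by (rule velocity[of K B]) blast
  have cL: "continuous_on (UNIV \<times> cball 0 V) (\<lambda>(x, v). L x v (k x))" if "continuous_on UNIV k" for k
    unfolding case_prod_beta
    by (intro continuous_on_L continuous_on_fst continuous_on_snd continuous_on_id
        continuous_on_compose2[OF that]) auto
  have pL: "periodic \<epsilon> (\<lambda>x v. L x v (k x))" if "periodic \<epsilon> k" for k
    using that by (simp add: periodic_def L_periodic)
  have "\<exists>N h y v. 0 < N \<and> 0 < h \<and> h \<le> e \<and> T \<le> real N * h \<and>
       (\<forall>k<N. norm (v k) \<le> V \<and> y (Suc k) = y k - h *\<^sub>R v k \<and> M - e \<le> g (y k) - f (y k)) \<and>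
       h * (\<Sum>k<N. L (y k) (v k) (f (y k)) + c) \<le> 2 * B + e \<and>
       h * (\<Sum>k<N. L (y k) (v k) (f (y k)) - L (y k) (v k) (g (y k))) \<le> e"
    if T: "T \<ge> 1" and e: "e > 0" for T e :: real
  proof -
    \<comment> \<open>The gap \<open>D\<close> may drift by \<open>4 * a * h\<close> per step over a
      time at most \<open>T + 1\<close>, and passing from convolutions back to \<open>u\<close> and
      \<open>w\<close> costs \<open>2 * a\<close>: in total \<open>a * (4 * T + 6)\<close>. The
      bound by \<open>M / 2\<close> keeps the gap positive along the whole chain.\<close>
    define a where "a = min e (M / 2) / (4 * T + 6)"
    have a: "a > 0" using T e x0(2) by (simp add: a_def)
    have aT: "a * (4 * T + 6) = min e (M / 2)" using T by (simp add: a_def)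
    obtain r1 where r1: "r1 > 0" "\<And>x y. norm (x - y) < r1 \<Longrightarrow> dist (f x) (f y) < a"
      by (rule periodic_uniformly_continuous1[OF eps f a]) blast
    obtain r2 where r2: "r2 > 0" "\<And>x y. norm (x - y) < r2 \<Longrightarrow> dist (g x) (g y) < a"
      by (rule periodic_uniformly_continuous1[OF eps g a]) blast
    obtain r3 where r3: "r3 > 0" "\<And>x y v v'. norm (x - y) < r3 \<Longrightarrow> v \<in> cball 0 V \<Longrightarrow> v' \<in> cball 0 V \<Longrightarrow>
        dist v v' < r3 \<Longrightarrow> dist (L x v (f x)) (L y v' (f y)) < a"
      by (rule periodic_uniformly_continuous[OF eps pL[OF f(1)] cL[OF f(2)] compact_cball a]) blast
    obtain r4 where r4: "r4 > 0" "\<And>x y v v'. norm (x - y) < r4 \<Longrightarrow> v \<in> cball 0 V \<Longrightarrow> v' \<in> cball 0 V \<Longrightarrow>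
        dist v v' < r4 \<Longrightarrow> dist (L x v (g x)) (L y v' (g y)) < a"
      by (rule periodic_uniformly_continuous[OF eps pL[OF g(1)] cL[OF g(2)] compact_cball a]) blast
    define r where "r = Min {r1, r2, r3, r4}"
    have r: "r > 0" "r \<le> r1" "r \<le> r2" "r \<le> r3" "r \<le> r4" using r1 r2 r3 r4 by (auto simp: r_def)
    obtain A1 where A1: "A1 > 0" "\<And>A y. A \<ge> A1 \<Longrightarrow>
        \<exists>x. norm (x - y) < r \<and> (\<forall>z. - f z - A * pen \<epsilon> (z - y) \<le> - f x - A * pen \<epsilon> (x - y))"
      by (rule supconv_near[OF eps f' r(1)]) blast
    obtain A2 where A2: "A2 > 0" "\<And>A y. A \<ge> A2 \<Longrightarrow>
        \<exists>x. norm (x - y) < r \<and> (\<forall>z. g z - A * pen \<epsilon> (z - y) \<le> g x - A * pen \<epsilon> (x - y))"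
      by (rule supconv_near[OF eps g r(1)]) blast
    define A where "A = max A1 A2"
    have A: "A \<ge> A1" "A \<ge> A2" "A > 0" using A1 by (auto simp: A_def)
    \<comment> \<open>The last entry makes the semiconvexity error
      \<open>A * (h * V)\<^sup>2 / 2\<close> at most \<open>h * a\<close>; \<open>h \<le> 1\<close>
      keeps the overshoot beyond \<open>T\<close> at most 1.\<close>
    define h where "h = Min {e, 1, 2 * a / (A * V\<^sup>2)}"
    have AV: "A * V\<^sup>2 > 0" using A V(1) by simp
    have h: "0 < h" "h \<le> e" "h \<le> 1" "h \<le> 2 * a / (A * V\<^sup>2)"
      using e a AV by (auto simp: h_def simp del: times_divide_eq_right)
    have quad: "A * (norm (h *\<^sub>R v))\<^sup>2 / 2 \<le> h * a" if "norm v \<le> V" for v :: "real ^ 'n"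
    proof -
      have "(norm (h *\<^sub>R v))\<^sup>2 \<le> (h * V)\<^sup>2" using that h(1) by (intro power_mono) (auto intro: mult_left_mono)
      then have "A * (norm (h *\<^sub>R v))\<^sup>2 / 2 \<le> A * (h * V)\<^sup>2 / 2" using A(3) by simp
      also have "\<dots> = h * (h * (A * V\<^sup>2)) / 2" by (simp add: power2_eq_square)
      also have "\<dots> \<le> h * (2 * a / (A * V\<^sup>2) * (A * V\<^sup>2)) / 2"
        using h AV by (intro divide_right_mono mult_left_mono mult_right_mono) auto
      also have "\<dots> = h * a" using AV by (auto simp: zero_less_mult_iff)
      finally show ?thesis .
    qed
    \<comment> \<open>The inf-convolution \<open>U\<close> of \<open>u\<close> is semiconcave and the sup-convolution \<open>W\<close> of \<open>w\<close> semiconvex, so along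
      a step \<open>- h v\<close> with \<open>v\<close> a subgradient of the Hamiltonian, \<open>U\<close> loses at least the action and \<open>W\<close>
      at most the action, up to \<open>O(h\<^sup>2)\<close>.\<close>
    define U where "U = (\<lambda>y. - supconv \<epsilon> A (\<lambda>x. - f x) y)"
    define W where "W = supconv \<epsilon> A g"
    have U_le: "U y \<le> f y" for y using supconv_ge(2)[OF eps f', of y A] by (simp add: U_def)
    have W_ge: "g y \<le> W y" for y using supconv_ge(2)[OF eps g, of y A] by (simp add: W_def)
    have U_ge: "- B \<le> U y \<and> f y - a \<le> U y" for y
    proof -
      obtain x where x: "norm (x - y) < r" "\<And>z. - f z - A * pen \<epsilon> (z - y) \<le> - f x - A * pen \<epsilon> (x - y)"
        using A1(2)[OF A(1)] by blast
      have "f x \<le> U y" using supconv_eqI[OF x(2)] A(3) pen_nonneg[of \<epsilon> "x - y"] by (simp add: U_def)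
      then show ?thesis using B(2)[of x] r1(2)[of x y] x(1) r by (auto simp: dist_real_def)
    qed
    have W_le: "W y \<le> g y + a" for y
    proof -
      obtain x where x: "norm (x - y) < r" "\<And>z. g z - A * pen \<epsilon> (z - y) \<le> g x - A * pen \<epsilon> (x - y)"
        using A2(2)[OF A(2)] by blast
      have "W y \<le> g x" using supconv_eqI[OF x(2)] A(3) pen_nonneg[of \<epsilon> "x - y"] by (simp add: W_def)
      then show ?thesis using r2(2)[of x y] x(1) r by (auto simp: dist_real_def)
    qed
    have "\<exists>v. norm v \<le> V \<and> h * (L y v (f y) + c) \<le> U y - U (y - h *\<^sub>R v) + 2 * a * h" for y
    proof -
      obtain x where x: "norm (x - y) < r" "\<And>z. - f z - A * pen \<epsilon> (z - y) \<le> - f x - A * pen \<epsilon> (x - y)"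
        using A1(2)[OF A(1)] by blast
      let ?p = "- (A *\<^sub>R dpen \<epsilon> (x - y))"
      have "norm (A *\<^sub>R dpen \<epsilon> (x - y)) \<le> K"
        by (rule supconv_gradient_bound[OF eps _ _ x(2)]) (use A(3) lip in \<open>auto simp: abs_minus_commute\<close>)
      then have "norm ?p \<le> K" by simp
      then obtain v where v: "norm v \<le> V" "L x v (f x) = ?p \<bullet> v - F (q x) ?p (f x)"
        using V(2) B(2)[of x] by (metis real_norm_def)
      have "c \<le> F (q x) ?p (u (q x))"
        by (rule visc_supersolution_pen[OF eps usup]) (use x(2) in \<open>simp add: f_def algebra_simps\<close>)
      then have "L x v (f x) + c \<le> ?p \<bullet> v" using v(2) by (simp add: f_def)
      then have "h * (L x v (f x) + c) \<le> h * (?p \<bullet> v)" using h(1) by (intro mult_left_mono) auto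
      then have 1: "h * (L x v (f x) + c) \<le> ?p \<bullet> (h *\<^sub>R v)" by simp
      have 2: "?p \<bullet> (h *\<^sub>R v) - A * (norm (h *\<^sub>R v))\<^sup>2 / 2 \<le> U y - U (y - h *\<^sub>R v)"
        using supconv_semiconvex[OF eps f' _ x(2), of "h *\<^sub>R v"] A(3) by (simp add: U_def)
      have "\<bar>L x v (f x) - L y v (f y)\<bar> < a"
        using r3(2)[of x y v v] x(1) v(1) r by (auto simp: dist_real_def)
      then have "h * L y v (f y) \<le> h * (L x v (f x) + a)" using h(1) by (intro mult_left_mono) auto
      then have "h * (L y v (f y) + c) \<le> U y - U (y - h *\<^sub>R v) + 2 * a * h"
        using 1 2 quad[OF v(1)] by (simp add: algebra_simps)
      then show ?thesis using v(1) by blast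
    qed
    then obtain vel where vel: "\<And>y. norm (vel y) \<le> V"
      "\<And>y. h * (L y (vel y) (f y) + c) \<le> U y - U (y - h *\<^sub>R vel y) + 2 * a * h" by metis
    have sub: "W y - W (y - h *\<^sub>R v) \<le> h * (L y v (g y) + c) + 2 * a * h" if v: "norm v \<le> V" for y v
    proof -
      obtain x where x: "norm (x - y) < r" "\<And>z. g z - A * pen \<epsilon> (z - y) \<le> g x - A * pen \<epsilon> (x - y)"
        using A2(2)[OF A(2)] by blast
      let ?p = "A *\<^sub>R dpen \<epsilon> (x - y)"
      have "F (q x) ?p (w (q x)) \<le> c"
        by (rule visc_subsolution_pen[OF eps w]) (use x(2) in \<open>simp add: g_def\<close>)
      then have "?p \<bullet> v \<le> L x v (g x) + c" using fenchel[of ?p v x "g x"] by (simp add: g_def)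
      then have "h * (?p \<bullet> v) \<le> h * (L x v (g x) + c)" using h(1) by (intro mult_left_mono) auto
      then have 1: "?p \<bullet> (h *\<^sub>R v) \<le> h * (L x v (g x) + c)" by simp
      have 2: "W y - ?p \<bullet> (h *\<^sub>R v) - A * (norm (h *\<^sub>R v))\<^sup>2 / 2 \<le> W (y - h *\<^sub>R v)"
        using supconv_semiconvex[OF eps g _ x(2), of "h *\<^sub>R v"] A(3) by (simp add: W_def)
      have "\<bar>L x v (g x) - L y v (g y)\<bar> < a"
        using r4(2)[of x y v v] x(1) v r by (auto simp: dist_real_def)
      then have "h * L x v (g x) \<le> h * (L y v (g y) + a)" using h(1) by (intro mult_left_mono) auto
      then show ?thesis using 1 2 quad[OF v] by (simp add: algebra_simps)
    qed
    define y where "y k = ((\<lambda>y. y - h *\<^sub>R vel y) ^^ k) x0" for k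
    define v where "v k = vel (y k)" for k
    have ySuc: "y (Suc k) = y k - h *\<^sub>R v k" for k by (simp add: y_def v_def)
    have y0: "y 0 = x0" by (simp add: y_def)
    define Lf where "Lf k = L (y k) (v k) (f (y k))" for k
    define Lg where "Lg k = L (y k) (v k) (g (y k))" for k
    have s1: "h * (Lf k + c) \<le> U (y k) - U (y (Suc k)) + 2 * a * h" for k
      using vel(2)[of "y k"] by (simp add: Lf_def ySuc v_def)
    have s2: "W (y k) - W (y (Suc k)) \<le> h * (Lg k + c) + 2 * a * h" for k
      using sub[OF vel(1), of "y k" "y k"] by (simp add: Lg_def ySuc v_def)
    define D where "D k = W (y k) - U (y k)" for k
    have D0: "M \<le> D 0" using x0(1) U_le[of x0] W_ge[of x0] by (simp add: D_def y0 f_def g_def)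
    have gap: "D k - 2 * a \<le> g (y k) - f (y k)" "g (y k) - f (y k) \<le> D k" for k
      using U_ge[of "y k"] W_le[of "y k"] U_le[of "y k"] W_ge[of "y k"] by (auto simp: D_def)
    have s3: "h * (Lf k - Lg k) \<le> D (Suc k) - D k + 4 * a * h" for k
      using s1[of k] s2[of k] by (simp add: D_def algebra_simps)
    define N where "N = nat \<lceil>T / h\<rceil>"
    have "T / h > 0" using T h by simp
    then have N0: "0 < N" by (simp add: N_def)
    have "T / h \<le> real N" "real N < T / h + 1" using \<open>T / h > 0\<close> unfolding N_def by linarith+
    then have TN: "T \<le> real N * h" "real N * h \<le> T + 1"
      using h(1,3) by (auto simp: field_simps)
    have budget: "4 * a * (real k * h) + 2 * a \<le> min e (M / 2)" if "k \<le> N" for k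
    proof -
      have "real k * h \<le> real N * h" using that h(1) by (intro mult_right_mono) auto
      then have "real k * h \<le> T + 1" using TN(2) by linarith
      then have "4 * a * (real k * h) \<le> 4 * a * (T + 1)" using a by (intro mult_left_mono) auto
      moreover have "4 * a * (T + 1) + 2 * a = a * (4 * T + 6)" by (simp add: algebra_simps)
      ultimately show ?thesis using aT by linarith
    qed
    \<comment> \<open>Positivity of the gap at step \<open>k\<close> gives \<open>u \<le> w\<close>
      there, so antitonicity of \<open>L\<close> makes the difference of actions nonnegative and the
      gap loses only the error. This positivity is part of what the induction carries
      forward.\<close>
    have Dk: "M - 4 * a * (real k * h) \<le> D k" if "k \<le> N" for k
      using that
    proof (induction k)
      case 0 then show ?case using D0 by simp
    next
      case (Suc k)
      then have IH: "M - 4 * a * (real k * h) \<le> D k" by simp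
      have "4 * a * (real k * h) + 2 * a \<le> M / 2" using budget[of k] Suc.prems by simp
      then have "f (y k) \<le> g (y k)" using IH gap(1)[of k] x0(2) by linarith
      then have "Lg k \<le> Lf k" unfolding Lf_def Lg_def by (rule L_antimono)
      then have "0 \<le> h * (Lf k - Lg k)" using h(1) by simp
      then have "D k - 4 * a * h \<le> D (Suc k)" using s3[of k] by linarith
      moreover have "4 * a * (real (Suc k) * h) = 4 * a * (real k * h) + 4 * a * h" by (simp add: algebra_simps)
      ultimately show ?case using IH by linarith
    qed
    have "M - e \<le> g (y k) - f (y k)" if "k < N" for k
      using Dk[of k] gap(1)[of k] budget[of k] that by simp
    moreover have "h * (\<Sum>k<n. Lf k + c) \<le> U (y 0) - U (y n) + 2 * a * (real n * h)" for n
    proof (induction n)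
      case (Suc n) then show ?case using s1[of n] by (simp add: algebra_simps)
    qed simp
    note this[of N]
    moreover have "U (y 0) \<le> B" using U_le[of "y 0"] B(2)[of "y 0"] by simp
    moreover have "- B \<le> U (y N)" using U_ge by blast
    \<comment> \<open>The difference of actions telescopes into the increase of \<open>D\<close>.
      That increase is small because \<open>D\<close> starts at least at \<open>M\<close>, the
      maximal gap, and ends at most at \<open>M + 2 * a\<close>.\<close>
    moreover have "h * (\<Sum>k<n. Lf k - Lg k) \<le> D n - D 0 + 4 * a * (real n * h)" for n
    proof (induction n)
      case (Suc n) then show ?case using s3[of n] by (simp add: algebra_simps)
    qed simp
    note this[of N]
    moreover have "D N \<le> M + 2 * a" using gap(1)[of N] M[of "y N"] by (simp add: f_def g_def)
    moreover have "0 \<le> a * (real N * h)" using a h by simp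
    ultimately show ?thesis
      using N0 h TN(1) vel(1) ySuc budget[of N] D0 a
      by (intro exI[of _ N] exI[of _ h] exI[of _ y] exI[of _ v]) (auto simp: Lf_def Lg_def v_def)
  qed
  then show ?thesis
    using that[of V "2 * B"] V(1) B(1) unfolding f_def g_def by simp
qed

end

section \<open>Mather measures carried by the contact set\<close>

lemma torus_C1_increment:
  assumes "torus_C1 \<epsilon> \<phi> d\<phi>"
  obtains t where "0 < t" "t < 1"
    "\<phi> (coset \<epsilon> y) - \<phi> (coset \<epsilon> (y - s)) = d\<phi> (coset \<epsilon> (y - t *\<^sub>R s)) \<bullet> s"
proof -
  have d: "((\<lambda>t. \<phi> (coset \<epsilon> (y - t *\<^sub>R s))) has_real_derivative - (d\<phi> (coset \<epsilon> (y - t *\<^sub>R s)) \<bullet> s)) (at t)" for t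
  proof -
    have "((\<lambda>t. y - t *\<^sub>R s) has_derivative (\<lambda>h. - (h *\<^sub>R s))) (at t)"
      by (auto intro!: derivative_eq_intros)
    moreover have "((\<lambda>y. \<phi> (coset \<epsilon> y)) has_derivative (\<lambda>h. h \<bullet> d\<phi> (coset \<epsilon> (y - t *\<^sub>R s)))) (at (y - t *\<^sub>R s))"
      using assms by (simp add: torus_C1_def gderiv_def)
    ultimately have "((\<lambda>t. \<phi> (coset \<epsilon> (y - t *\<^sub>R s))) has_derivative (\<lambda>h. - (h *\<^sub>R s) \<bullet> d\<phi> (coset \<epsilon> (y - t *\<^sub>R s)))) (at t)"
      by (rule has_derivative_compose)
    moreover have "(\<lambda>h. - (h *\<^sub>R s) \<bullet> d\<phi> (coset \<epsilon> (y - t *\<^sub>R s))) = (*) (- (d\<phi> (coset \<epsilon> (y - t *\<^sub>R s)) \<bullet> s))"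
      by (simp add: fun_eq_iff inner_commute)
    ultimately show ?thesis by (simp only: has_field_derivative_def)
  qed
  obtain t where "0 < t" "t < 1" "\<phi> (coset \<epsilon> (y - 1 *\<^sub>R s)) - \<phi> (coset \<epsilon> (y - 0 *\<^sub>R s)) = (1 - 0) * - (d\<phi> (coset \<epsilon> (y - t *\<^sub>R s)) \<bullet> s)"
    using MVT2[of 0 1, OF zero_less_one d] by blast
  then show ?thesis by (intro that[of t]) simp_all
qed

text \<open>The weighted sum of \<open>d\<phi> \<bullet> v\<close> telescopes, up to a mean value
  error, to a difference of two values of \<open>\<phi>\<close>. That difference stays bounded while
  the elapsed time \<open>N n * h n\<close> tends to infinity, and the error per unit time vanishes
  with the step.\<close>

lemma chain_holonomic:
  fixes V :: real and y v :: "nat \<Rightarrow> nat \<Rightarrow> real ^ 'n" and h :: "nat \<Rightarrow> real" and N :: "nat \<Rightarrow> nat"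
  assumes "\<epsilon> > 0" "V > 0" and \<phi>: "torus_C1 \<epsilon> \<phi> d\<phi>"
    and h: "\<And>n. 0 < h n" "\<And>n. h n \<le> inverse (real (Suc n))" and N: "\<And>n. real (Suc n) \<le> real (N n) * h n"
    and v: "\<And>n k. k < N n \<Longrightarrow> norm (v n k) \<le> V" and y: "\<And>n k. k < N n \<Longrightarrow> y n (Suc k) = y n k - h n *\<^sub>R v n k"
  shows "(\<lambda>n. (\<Sum>k<N n. d\<phi> (coset \<epsilon> (y n k)) \<bullet> v n k) / real (N n)) \<longlonglongrightarrow> 0"
proof (rule LIMSEQ_I)
  let ?q = "coset \<epsilon> :: real ^ 'n \<Rightarrow> _"
  fix e :: real assume e: "0 < e"
  obtain B where B: "B > 0" "\<And>x. norm (\<phi> (?q x)) \<le> B"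
    by (rule periodic_bounded1[OF assms(1) periodic_coset torus_C1_continuous(1)[OF \<phi>]]) blast
  \<comment> \<open>The mean value error and the telescoped boundary term each contribute at most
    \<open>e / 4\<close>; \<open>n2\<close> below takes care of the latter.\<close>
  define e' where "e' = e / (4 * V)"
  have e': "e' > 0" using e assms(2) by (simp add: e'_def)
  obtain r where r: "r > 0" "\<And>x z. norm (x - z) < r \<Longrightarrow> dist (d\<phi> (?q x)) (d\<phi> (?q z)) < e'"
    by (rule periodic_uniformly_continuous1[OF assms(1) periodic_coset torus_C1_continuous(2)[OF \<phi>] e']) blast
  obtain n1 where n1: "inverse (real (Suc n1)) < r / V" using reals_Archimedean[of "r / V"] r(1) assms(2) by auto
  obtain n2 where n2: "inverse (real (Suc n2)) < e / (8 * B)" using reals_Archimedean[of "e / (8 * B)"] e B(1) by auto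
  have "norm ((\<Sum>k<N n. d\<phi> (?q (y n k)) \<bullet> v n k) / real (N n) - 0) < e" if n: "n \<ge> max n1 n2" for n
  proof -
    have inv: "inverse (real (Suc n)) \<le> inverse (real (Suc n1))" "inverse (real (Suc n)) \<le> inverse (real (Suc n2))"
      using n by (auto intro!: le_imp_inverse_le simp del: of_nat_Suc)
    have hn: "h n * V < r"
    proof -
      have "h n < r / V" using h(2)[of n] inv(1) n1 by linarith
      then show ?thesis using assms(2) by (simp only: pos_less_divide_eq)
    qed
    have step: "\<bar>h n * (d\<phi> (?q (y n k)) \<bullet> v n k) - (\<phi> (?q (y n k)) - \<phi> (?q (y n (Suc k))))\<bar> \<le> h n * (V * e')" if k: "k < N n" for k
    proof -
      obtain t where t: "0 < t" "t < 1"
        "\<phi> (?q (y n k)) - \<phi> (?q (y n k - h n *\<^sub>R v n k)) = d\<phi> (?q (y n k - t *\<^sub>R h n *\<^sub>R v n k)) \<bullet> (h n *\<^sub>R v n k)"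
        by (rule torus_C1_increment[OF \<phi>])
      have "norm (y n k - (y n k - t *\<^sub>R h n *\<^sub>R v n k)) = t * (h n * norm (v n k))" using t(1) h(1)[of n] by simp
      also have "\<dots> \<le> 1 * (h n * V)" using t h(1)[of n] v[OF k] by (intro mult_mono) auto
      finally have "dist (d\<phi> (?q (y n k))) (d\<phi> (?q (y n k - t *\<^sub>R h n *\<^sub>R v n k))) < e'" using hn by (intro r(2)) simp
      then have d: "norm (d\<phi> (?q (y n k)) - d\<phi> (?q (y n k - t *\<^sub>R h n *\<^sub>R v n k))) \<le> e'" by (simp add: dist_norm)
      have "h n * (d\<phi> (?q (y n k)) \<bullet> v n k) - (\<phi> (?q (y n k)) - \<phi> (?q (y n (Suc k))))
          = h n * ((d\<phi> (?q (y n k)) - d\<phi> (?q (y n k - t *\<^sub>R h n *\<^sub>R v n k))) \<bullet> v n k)"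
        unfolding y[OF k] t(3) by (simp add: inner_diff_left right_diff_distrib)
      moreover have "\<bar>(d\<phi> (?q (y n k)) - d\<phi> (?q (y n k - t *\<^sub>R h n *\<^sub>R v n k))) \<bullet> v n k\<bar> \<le> e' * V"
        using Cauchy_Schwarz_ineq2[of "d\<phi> (?q (y n k)) - d\<phi> (?q (y n k - t *\<^sub>R h n *\<^sub>R v n k))" "v n k"]
          mult_mono[OF d v[OF k]] e' by simp
      ultimately show ?thesis using h(1)[of n] by (simp add: abs_mult mult.commute)
    qed
    have tele: "\<bar>h n * (\<Sum>k<m. d\<phi> (?q (y n k)) \<bullet> v n k) - (\<phi> (?q (y n 0)) - \<phi> (?q (y n m)))\<bar> \<le> real m * (h n * (V * e'))" if "m \<le> N n" for m
      using that
    proof (induction m)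
      case (Suc m)
      then have "\<bar>h n * (\<Sum>k<m. d\<phi> (?q (y n k)) \<bullet> v n k) - (\<phi> (?q (y n 0)) - \<phi> (?q (y n m)))\<bar> \<le> real m * (h n * (V * e'))" by simp
      moreover have "h n * (\<Sum>k<Suc m. d\<phi> (?q (y n k)) \<bullet> v n k) = h n * (\<Sum>k<m. d\<phi> (?q (y n k)) \<bullet> v n k) + h n * (d\<phi> (?q (y n m)) \<bullet> v n m)"
        by (simp add: distrib_left)
      moreover have "real (Suc m) * (h n * (V * e')) = real m * (h n * (V * e')) + h n * (V * e')" by (simp add: algebra_simps)
      ultimately show ?case using step[of m] Suc.prems by linarith
    qed simp
    define T where "T = real (N n) * h n"
    have T: "T > 0" "real (Suc n) \<le> T" using N[of n] by (auto simp: T_def intro: less_le_trans[OF of_nat_0_less_iff[THEN iffD2]])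
    have NT: "real (N n) = T / h n" using h(1)[of n] by (simp add: T_def)
    have "\<bar>h n * (\<Sum>k<N n. d\<phi> (?q (y n k)) \<bullet> v n k)\<bar> \<le> 2 * B + T * (V * e')"
      using tele[OF order_refl] B(2)[of "y n 0"] B(2)[of "y n (N n)"] by (simp add: T_def algebra_simps)
    then have "\<bar>h n * (\<Sum>k<N n. d\<phi> (?q (y n k)) \<bullet> v n k)\<bar> / T \<le> 2 * B * inverse T + V * e'"
      using T(1) by (simp add: field_simps)
    moreover have "inverse T \<le> e / (8 * B)"
    proof -
      have "inverse T \<le> inverse (real (Suc n))" by (rule le_imp_inverse_le[OF T(2)]) simp
      then show ?thesis using inv(2) n2 by linarith
    qed
    then have "2 * B * inverse T \<le> 2 * B * (e / (8 * B))" using B(1) by (intro mult_left_mono) auto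
    moreover have "2 * B * (e / (8 * B)) = e / 4" "V * e' = e / 4" using B(1) assms(2) by (auto simp: e'_def)
    moreover have "(\<Sum>k<N n. d\<phi> (?q (y n k)) \<bullet> v n k) / real (N n) = h n * (\<Sum>k<N n. d\<phi> (?q (y n k)) \<bullet> v n k) / T"
      using h(1)[of n] by (simp add: NT)
    ultimately show ?thesis using T(1) e by (simp add: abs_divide)
  qed
  then show "\<exists>no. \<forall>n\<ge>no. norm ((\<Sum>k<N n. d\<phi> (?q (y n k)) \<bullet> v n k) / real (N n) - 0) < e" by blast
qed

lemma holonomic_space:
  assumes "holonomic \<epsilon> \<nu>" "z \<in> space \<nu>"
  obtains x v where "z = (coset \<epsilon> x, v)"
proof -
  have "space \<nu> = space (borel_of (prod_topology (torus \<epsilon>) euclidean))"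
    using assms(1) by (intro sets_eq_imp_space_eq) (simp add: holonomic_def)
  then have "z \<in> topspace (torus \<epsilon>) \<times> UNIV" using assms(2) by (simp add: space_borel_of)
  then show ?thesis using that by (auto simp: topspace_torus)
qed

lemma holonomic_measurable:
  fixes g :: "_ \<Rightarrow> real"
  assumes "holonomic \<epsilon> \<nu>" "continuous_on UNIV (\<lambda>(x, v). g (coset \<epsilon> x, v))"
  shows "g \<in> borel_measurable \<nu>"
proof -
  have "g \<in> borel_measurable (borel_of (prod_topology (torus \<epsilon>) euclidean))"
    using assms(2) by (intro measurable_borel_of_continuous) (simp add: continuous_map_torus_prod)
  then show ?thesis using assms(1) measurable_cong_sets[of \<nu>] by (auto simp: holonomic_def)
qed

context contact_hamiltonian
begin

context
  fixes H :: "(real ^ 'a) set \<Rightarrow> real ^ 'a \<Rightarrow> real \<Rightarrow> real"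
  assumes FH: "F = eps_hamiltonian \<epsilon> H"
begin

lemma lagrangian_eq_L: "lagrangian H (rescale \<epsilon> (q x)) v s = L x v s"
proof -
  have "H (rescale \<epsilon> (q x)) p s = F (q x) p s" for p by (simp only: FH eps_hamiltonian_def)
  then show ?thesis by (simp only: lagrangian_def L_def)
qed

lemma continuous_lagrangian:
  assumes "continuous_on UNIV (\<lambda>x. \<phi> (q x))"
  shows "continuous_on UNIV (\<lambda>(x, v). (\<lambda>(X, v). lagrangian H (rescale \<epsilon> X) v (\<phi> X + t)) (q x, v))"
proof -
  have "continuous_on UNIV (\<lambda>z :: (real ^ 'a) \<times> (real ^ 'a). L (fst z) (snd z) (\<phi> (q (fst z)) + t))"
    by (intro continuous_on_L continuous_on_add continuous_on_fst continuous_on_snd continuous_on_id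
        continuous_on_compose2[OF assms] continuous_on_const) auto
  then show ?thesis by (simp add: lagrangian_eq_L case_prod_beta)
qed

lemma lagrangian_du_eqI:
  assumes "((\<lambda>s. L x v s) has_real_derivative D) (at_right s)"
  shows "lagrangian_du H (rescale \<epsilon> (q x)) v s = D"
proof -
  have "lagrangian H (rescale \<epsilon> (q x)) v = L x v" by (rule ext) (rule lagrangian_eq_L)
  moreover have "(L x v has_vector_derivative D) (at_right s)"
    using assms by (simp add: has_real_derivative_iff_has_vector_derivative)
  ultimately show ?thesis
    unfolding lagrangian_du_def by (simp add: vector_derivative_within[OF trivial_limit_at_right_real])
qed

text \<open>The right derivative is a pointwise limit of difference quotients with increments
  \<open>inverse (real (Suc n))\<close>, each continuous on the tangent bundle. It need not be
  continuous itself.\<close>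

lemma lagrangian_du_measurable:
  assumes \<nu>: "holonomic \<epsilon> \<nu>" and \<phi>: "continuous_on UNIV (\<lambda>x. \<phi> (q x))"
  shows "(\<lambda>(X, v). lagrangian_du H (rescale \<epsilon> X) v (\<phi> X)) \<in> borel_measurable \<nu>"
proof (rule borel_measurable_LIMSEQ_real)
  let ?t = "\<lambda>n. inverse (real (Suc n))"
  let ?Q = "\<lambda>n. (\<lambda>(X, v). (lagrangian H (rescale \<epsilon> X) v (\<phi> X + ?t n) - lagrangian H (rescale \<epsilon> X) v (\<phi> X + 0)) / ?t n)"
  show "?Q n \<in> borel_measurable \<nu>" for n
  proof -
    have "(\<lambda>(X, v). lagrangian H (rescale \<epsilon> X) v (\<phi> X + t)) \<in> borel_measurable \<nu>" for t
      by (rule holonomic_measurable[OF \<nu> continuous_lagrangian[OF \<phi>]])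
    then have "(\<lambda>z. ((\<lambda>(X, v). lagrangian H (rescale \<epsilon> X) v (\<phi> X + ?t n)) z - (\<lambda>(X, v). lagrangian H (rescale \<epsilon> X) v (\<phi> X + 0)) z) / ?t n)
        \<in> borel_measurable \<nu>" by (intro borel_measurable_divide borel_measurable_diff borel_measurable_const)
    then show ?thesis by (simp add: case_prod_beta)
  qed
  fix z assume "z \<in> space \<nu>"
  then obtain x v where z: "z = (q x, v)" by (rule holonomic_space[OF \<nu>])
  obtain D where D: "((\<lambda>s. L x v s) has_real_derivative D) (at_right (\<phi> (q x)))" by (rule L_right_derivative)
  have "filterlim (\<lambda>n. \<phi> (q x) + ?t n) (at_right (\<phi> (q x))) sequentially"
    unfolding filterlim_at
  proof
    show "\<forall>\<^sub>F n in sequentially. \<phi> (q x) + ?t n \<in> {\<phi> (q x)<..} \<and> \<phi> (q x) + ?t n \<noteq> \<phi> (q x)"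
      by (rule always_eventually) simp
    show "(\<lambda>n. \<phi> (q x) + ?t n) \<longlonglongrightarrow> \<phi> (q x)"
      using tendsto_add[OF tendsto_const[of "\<phi> (q x)"] LIMSEQ_inverse_real_of_nat] by simp
  qed
  then have "(\<lambda>n. (L x v (\<phi> (q x) + ?t n) - L x v (\<phi> (q x))) / (\<phi> (q x) + ?t n - \<phi> (q x))) \<longlonglongrightarrow> D"
    using D unfolding has_field_derivative_iff by (rule filterlim_compose[rotated])
  then show "(\<lambda>n. ?Q n z) \<longlonglongrightarrow> (case z of (X, v) \<Rightarrow> lagrangian_du H (rescale \<epsilon> X) v (\<phi> X))"
    by (simp add: z lagrangian_eq_L lagrangian_du_eqI[OF D] del: of_nat_Suc)
qed

lemma action_lower_bound:
  assumes u: "visc_subsolution \<epsilon> F c u" and \<nu>: "holonomic \<epsilon> \<nu>"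
    and int: "integrable \<nu> (\<lambda>(X, v). lagrangian H (rescale \<epsilon> X) v (u X))"
  shows "- c \<le> (\<integral>(X, v). lagrangian H (rescale \<epsilon> X) v (u X) \<partial>\<nu>)"
proof (rule field_le_epsilon)
  fix \<delta> :: real assume "\<delta> > 0"
  interpret prob_space \<nu> using \<nu> by (simp add: holonomic_def)
  obtain \<phi> d\<phi> where \<phi>: "torus_C1 \<epsilon> \<phi> d\<phi>" "\<And>y v. d\<phi> (q y) \<bullet> v \<le> L y v (u (q y)) + c + \<delta>"
    by (rule C1_approximate_subsolution[OF u \<open>\<delta> > 0\<close>]) blast
  note cd = torus_C1_continuous(2)[OF \<phi>(1)]
  obtain B where B: "B > 0" "\<And>x. norm (d\<phi> (q x)) \<le> B" by (rule periodic_bounded1[OF eps periodic_coset cd]) blast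
  have "continuous_on UNIV (\<lambda>z :: (real ^ 'a) \<times> (real ^ 'a). d\<phi> (q (fst z)) \<bullet> snd z)"
    by (intro continuous_on_inner continuous_on_snd continuous_on_id continuous_on_compose2[OF cd] continuous_on_fst) auto
  then have meas: "(\<lambda>(X, v). d\<phi> X \<bullet> v) \<in> borel_measurable \<nu>"
    by (intro holonomic_measurable[OF \<nu>]) (simp add: case_prod_beta)
  have intv: "integrable \<nu> (\<lambda>z. B * norm (snd z))"
    using \<nu> by (intro integrable_mult_right) (simp add: holonomic_def case_prod_unfold)
  have intd: "integrable \<nu> (\<lambda>(X, v). d\<phi> X \<bullet> v)"
  proof (rule Bochner_Integration.integrable_bound[OF intv meas], rule AE_I2)
    fix z assume "z \<in> space \<nu>"
    then obtain x v where z: "z = (q x, v)" by (rule holonomic_space[OF \<nu>])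
    have "\<bar>d\<phi> (q x) \<bullet> v\<bar> \<le> norm (d\<phi> (q x)) * norm v" by (rule Cauchy_Schwarz_ineq2)
    also have "\<dots> \<le> B * norm v" using B by (intro mult_right_mono) auto
    finally show "norm (case z of (X, v) \<Rightarrow> d\<phi> X \<bullet> v) \<le> norm (B * norm (snd z))" using B(1) by (simp add: z)
  qed
  have "0 = (\<integral>(X, v). d\<phi> X \<bullet> v \<partial>\<nu>)" using \<nu> \<phi>(1) by (simp add: holonomic_def)
  also have "\<dots> \<le> (\<integral>z. (\<lambda>(X, v). lagrangian H (rescale \<epsilon> X) v (u X)) z + (c + \<delta>) \<partial>\<nu>)"
  proof (rule integral_mono[OF intd])
    show "integrable \<nu> (\<lambda>z. (\<lambda>(X, v). lagrangian H (rescale \<epsilon> X) v (u X)) z + (c + \<delta>))" using int by simp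
    fix z assume "z \<in> space \<nu>"
    then obtain x v where z: "z = (q x, v)" by (rule holonomic_space[OF \<nu>])
    show "(case z of (X, v) \<Rightarrow> d\<phi> X \<bullet> v) \<le> (\<lambda>(X, v). lagrangian H (rescale \<epsilon> X) v (u X)) z + (c + \<delta>)"
      using \<phi>(2)[of x v] by (simp add: z lagrangian_eq_L)
  qed
  also have "\<dots> = (\<integral>(X, v). lagrangian H (rescale \<epsilon> X) v (u X) \<partial>\<nu>) + (c + \<delta>)"
    using int by (subst Bochner_Integration.integral_add) (auto simp: prob_space)
  finally show "- c \<le> (\<integral>(X, v). lagrangian H (rescale \<epsilon> X) v (u X) \<partial>\<nu>) + \<delta>" by simp
qed

text \<open>Action at most \<open>- c\<close> meets the universal lower bound, which gives
  minimality. The lower bound comes from the subsolution property, so the criterion applies equally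
  to the solution and to the subsolution above it.\<close>

lemma ordinal_mather_measuresI:
  assumes u: "visc_subsolution \<epsilon> F c u" and \<mu>: "holonomic \<epsilon> \<mu>"
    and int: "integrable \<mu> (\<lambda>(X, v). lagrangian H (rescale \<epsilon> X) v (u X))"
    and le: "(\<integral>(X, v). lagrangian H (rescale \<epsilon> X) v (u X) \<partial>\<mu>) \<le> - c"
    and du: "AE z in \<mu>. (\<lambda>(X, v). lagrangian_du H (rescale \<epsilon> X) v (u X)) z = 0"
  shows "\<mu> \<in> ordinal_mather_measures \<epsilon> H u"
proof -
  note m = lagrangian_du_measurable[OF \<mu> visc_subsolution_continuous[OF u]]
  have "integrable \<mu> (\<lambda>(X, v). lagrangian_du H (rescale \<epsilon> X) v (u X))"
    using integrable_cong_AE[OF m _ du] by simp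
  moreover have "(\<integral>(X, v). lagrangian_du H (rescale \<epsilon> X) v (u X) \<partial>\<mu>) = 0"
    using integral_cong_AE[OF m _ du] by simp
  moreover have "mather_measure \<epsilon> H u \<mu>"
    unfolding mather_measure_def using \<mu> int le action_lower_bound[OF u] by (meson order_trans)
  ultimately show ?thesis by (simp add: ordinal_mather_measures_def)
qed

lemma contact_measure:
  assumes u: "visc_solution \<epsilon> F c u" and w: "visc_subsolution \<epsilon> F c w" and less: "u (q x1) < w (q x1)"
  obtains \<mu> where "\<mu> \<in> ordinal_mather_measures \<epsilon> H u" "\<mu> \<in> ordinal_mather_measures \<epsilon> H w"
    "(\<integral>(X, v). u X \<partial>\<mu>) < (\<integral>(X, v). w X \<partial>\<mu>)"
proof -
  have usub: "visc_subsolution \<epsilon> F c u" using u by (simp add: visc_solution_def)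
  note cu = visc_subsolution_continuous[OF usub] and cw = visc_subsolution_continuous[OF w]
  obtain x0 where x0: "\<And>x. w (q x) - u (q x) \<le> w (q x0) - u (q x0)"
    by (rule periodic_attains_sup[OF eps _ continuous_on_diff[OF cw cu]]) (auto simp: periodic_def coset_shift)
  define M where "M = w (q x0) - u (q x0)"
  have M: "M > 0" "\<And>x. w (q x) - u (q x) \<le> M" using less x0[of x1] by (linarith | simp add: M_def x0)+
  obtain V C where V: "V > 0" "C > 0" and
    chain: "\<And>T e. T \<ge> 1 \<Longrightarrow> e > 0 \<Longrightarrow> \<exists>N h y v. 0 < N \<and> 0 < h \<and> h \<le> e \<and> T \<le> real N * h \<and>
       (\<forall>k<N. norm (v k) \<le> V \<and> y (Suc k) = y k - h *\<^sub>R v k \<and> M - e \<le> w (q (y k)) - u (q (y k))) \<and>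
       h * (\<Sum>k<N. L (y k) (v k) (u (q (y k))) + c) \<le> C + e \<and>
       h * (\<Sum>k<N. L (y k) (v k) (u (q (y k))) - L (y k) (v k) (w (q (y k)))) \<le> e"
    by (rule calibrated_chain[OF u w _ M]) (use M_def in auto)
  \<comment> \<open>Chain number \<open>n\<close> has horizon \<open>n + 1\<close> and tolerance
    \<open>1 / (n + 1)\<close>.\<close>
  define P where "P n N h y v \<longleftrightarrow> 0 < N \<and> 0 < h \<and> h \<le> inverse (real (Suc n)) \<and> real (Suc n) \<le> real N * h \<and>
       (\<forall>k<N. norm (v k) \<le> V \<and> y (Suc k) = y k - h *\<^sub>R v k \<and> M - inverse (real (Suc n)) \<le> w (q (y k)) - u (q (y k))) \<and>
       h * (\<Sum>k<N. L (y k) (v k) (u (q (y k))) + c) \<le> C + inverse (real (Suc n)) \<and>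
       h * (\<Sum>k<N. L (y k) (v k) (u (q (y k))) - L (y k) (v k) (w (q (y k)))) \<le> inverse (real (Suc n))" for n N h y v
  have "\<exists>N h y v. P n N h y v" for n
    unfolding P_def by (rule chain) auto
  then obtain N h y v where P: "\<And>n. P n (N n) (h n) (y n) (v n)" by metis
  have N: "N n > 0" and h: "0 < h n" "h n \<le> inverse (real (Suc n))" and Nh: "real (Suc n) \<le> real (N n) * h n"
    and vV: "k < N n \<Longrightarrow> norm (v n k) \<le> V" and ySuc: "k < N n \<Longrightarrow> y n (Suc k) = y n k - h n *\<^sub>R v n k"
    and gap: "k < N n \<Longrightarrow> M - inverse (real (Suc n)) \<le> w (q (y n k)) - u (q (y n k))"
    and sum1: "h n * (\<Sum>k<N n. L (y n k) (v n k) (u (q (y n k))) + c) \<le> C + inverse (real (Suc n))"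
    and sum2: "h n * (\<Sum>k<N n. L (y n k) (v n k) (u (q (y n k))) - L (y n k) (v n k) (w (q (y n k)))) \<le> inverse (real (Suc n))"
    for n k using P[of n] by (auto simp: P_def simp del: of_nat_Suc)
  obtain \<mu> r where \<mu>: "prob_space \<mu>" "sets \<mu> = sets (borel_of (prod_topology (torus \<epsilon>) euclidean))"
    and r: "strict_mono (r :: nat \<Rightarrow> nat)"
    and int: "\<And>g :: _ \<Rightarrow> real. continuous_on UNIV (\<lambda>(x, w). g (q x, w)) \<Longrightarrow> integrable \<mu> g"
    and lim: "\<And>g :: _ \<Rightarrow> real. continuous_on UNIV (\<lambda>(x, w). g (q x, w)) \<Longrightarrow>
       (\<lambda>n. (\<Sum>k<N (r n). g (q (y (r n) k), v (r n) k)) / real (N (r n))) \<longlonglongrightarrow> (\<integral>z. g z \<partial>\<mu>)"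
    by (rule occupation_measure_limit[where y = y and v = v and N = N, OF eps V(1) N]) (use vV in blast)+
  interpret prob_space \<mu> by (rule \<mu>(1))
  have inv0: "(\<lambda>n. inverse (real (Suc (r n)))) \<longlonglongrightarrow> 0"
    using LIMSEQ_subseq_LIMSEQ[OF LIMSEQ_inverse_real_of_nat r] by (simp add: o_def)
  \<comment> \<open>An occupation average is a time integral divided by the elapsed time, which is
    at least \<open>n + 1\<close>. A bounded integral therefore has a vanishing average.\<close>
  have avg_le: "S / real (N n) \<le> K * inverse (real (Suc n))" if "h n * S \<le> K" "0 \<le> K" for S K n
  proof -
    have "S / real (N n) = (h n * S) / (real (N n) * h n)" using h(1)[of n] by simp
    also have "\<dots> \<le> K / (real (N n) * h n)" using that(1) h(1)[of n] N[of n] by (intro divide_right_mono) auto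
    also have "\<dots> \<le> K / real (Suc n)" using that(2) Nh[of n] by (intro divide_left_mono) (auto intro: mult_pos_pos h N simp del: of_nat_Suc)
    finally show ?thesis by (simp add: divide_inverse)
  qed
  have hol: "holonomic \<epsilon> \<mu>"
    unfolding holonomic_def
  proof (intro conjI allI impI \<mu>)
    show "integrable \<mu> (\<lambda>(X, v). norm v)"
      by (rule int) (simp add: case_prod_beta continuous_on_norm continuous_on_snd continuous_on_id)
    fix \<phi> and d\<phi> :: "(real ^ 'a) set \<Rightarrow> real ^ 'a" assume \<phi>: "torus_C1 \<epsilon> \<phi> d\<phi>"
    have "continuous_on UNIV (\<lambda>z :: (real ^ 'a) \<times> (real ^ 'a). d\<phi> (q (fst z)) \<bullet> snd z)"
      by (intro continuous_on_inner continuous_on_snd continuous_on_id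
          continuous_on_compose2[OF torus_C1_continuous(2)[OF \<phi>]] continuous_on_fst) auto
    then have "(\<lambda>n. (\<Sum>k<N (r n). (\<lambda>(X, v). d\<phi> X \<bullet> v) (q (y (r n) k), v (r n) k)) / real (N (r n))) \<longlonglongrightarrow> (\<integral>(X, v). d\<phi> X \<bullet> v \<partial>\<mu>)"
      by (intro lim) (simp add: case_prod_beta)
    moreover have "(\<lambda>n. (\<Sum>k<N n. d\<phi> (q (y n k)) \<bullet> v n k) / real (N n)) \<longlonglongrightarrow> 0"
      by (rule chain_holonomic[where h = h and N = N and v = v and y = y, OF eps V(1) \<phi> h Nh vV ySuc])
    from LIMSEQ_subseq_LIMSEQ[OF this r]
    have "(\<lambda>n. (\<Sum>k<N (r n). (\<lambda>(X, v). d\<phi> X \<bullet> v) (q (y (r n) k), v (r n) k)) / real (N (r n))) \<longlonglongrightarrow> 0"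
      by (simp add: o_def)
    ultimately show "(\<integral>(X, v). d\<phi> X \<bullet> v \<partial>\<mu>) = 0" by (rule LIMSEQ_unique)
  qed
  define Lu where "Lu = (\<lambda>(X, v). lagrangian H (rescale \<epsilon> X) v (u X))"
  define Lw where "Lw = (\<lambda>(X, v). lagrangian H (rescale \<epsilon> X) v (w X))"
  have cLu: "continuous_on UNIV (\<lambda>(x, v). Lu (q x, v))" and cLw: "continuous_on UNIV (\<lambda>(x, v). Lw (q x, v))"
    using continuous_lagrangian[OF cu, of 0] continuous_lagrangian[OF cw, of 0] by (simp_all add: Lu_def Lw_def)
  have intLu: "integrable \<mu> Lu" and intLw: "integrable \<mu> Lw" using int[OF cLu] int[OF cLw] by auto
  have Lu_le: "(\<integral>z. Lu z \<partial>\<mu>) \<le> - c"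
  proof (rule LIMSEQ_le[OF lim[OF cLu]])
    have "(\<lambda>n. - c + (C + 1) * inverse (real (Suc (r n)))) \<longlonglongrightarrow> - c + (C + 1) * 0"
      by (intro tendsto_intros inv0)
    then show "(\<lambda>n. - c + (C + 1) * inverse (real (Suc (r n)))) \<longlonglongrightarrow> - c" by simp
    have "(\<Sum>k<N n. Lu (q (y n k), v n k)) / real (N n) \<le> - c + (C + 1) * inverse (real (Suc n))" for n
    proof -
      have "inverse (real (Suc n)) \<le> 1" by (simp add: field_simps)
      then have "h n * (\<Sum>k<N n. L (y n k) (v n k) (u (q (y n k))) + c) \<le> C + 1" using sum1[of n] by linarith
      from avg_le[OF this] have "(\<Sum>k<N n. L (y n k) (v n k) (u (q (y n k))) + c) / real (N n) \<le> (C + 1) * inverse (real (Suc n))"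
        using V(2) by simp
      moreover have "(\<Sum>k<N n. L (y n k) (v n k) (u (q (y n k))) + c) / real (N n) = (\<Sum>k<N n. Lu (q (y n k), v n k)) / real (N n) + c"
        using N[of n] by (simp add: Lu_def lagrangian_eq_L sum.distrib add_divide_distrib)
      ultimately show ?thesis by linarith
    qed
    then show "\<exists>m. \<forall>n\<ge>m. (\<Sum>k<N (r n). Lu (q (y (r n) k), v (r n) k)) / real (N (r n)) \<le> - c + (C + 1) * inverse (real (Suc (r n)))"
      by blast
  qed
  have LuLw: "(\<integral>z. Lu z - Lw z \<partial>\<mu>) \<le> 0"
  proof (rule LIMSEQ_le[OF lim])
    show "continuous_on UNIV (\<lambda>(x, v). Lu (q x, v) - Lw (q x, v))"
      using continuous_on_diff[OF cLu cLw] by (simp add: case_prod_beta)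
    show "(\<lambda>n. inverse (real (Suc (r n)))) \<longlonglongrightarrow> 0" by (rule inv0)
    have "(\<Sum>k<N n. Lu (q (y n k), v n k) - Lw (q (y n k), v n k)) / real (N n) \<le> inverse (real (Suc n))" for n
    proof -
      have "inverse (real (Suc n)) \<le> 1" by (simp add: field_simps)
      then have "h n * (\<Sum>k<N n. L (y n k) (v n k) (u (q (y n k))) - L (y n k) (v n k) (w (q (y n k)))) \<le> 1" using sum2[of n] by linarith
      from avg_le[OF this] show ?thesis by (simp add: Lu_def Lw_def lagrangian_eq_L)
    qed
    then show "\<exists>m. \<forall>n\<ge>m. (\<Sum>k<N (r n). Lu (q (y (r n) k), v (r n) k) - Lw (q (y (r n) k), v (r n) k)) / real (N (r n)) \<le> inverse (real (Suc (r n)))"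
      by blast
  qed
  define d where "d = (\<lambda>(X, v :: real ^ 'a). w X - u X)"
  have cd: "continuous_on UNIV (\<lambda>(x, v). d (q x, v))"
  proof -
    have "continuous_on UNIV (\<lambda>z :: (real ^ 'a) \<times> (real ^ 'a). w (q (fst z)) - u (q (fst z)))"
      by (intro continuous_on_diff continuous_on_compose2[OF cw] continuous_on_compose2[OF cu] continuous_on_fst continuous_on_id) auto
    then show ?thesis by (simp add: d_def case_prod_beta)
  qed
  have d_ge: "M \<le> (\<integral>z. d z \<partial>\<mu>)"
  proof (rule LIMSEQ_le[OF _ lim[OF cd]])
    have "(\<lambda>n. M - inverse (real (Suc (r n)))) \<longlonglongrightarrow> M - 0" by (intro tendsto_intros inv0)
    then show "(\<lambda>n. M - inverse (real (Suc (r n)))) \<longlonglongrightarrow> M" by simp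
    have "M - inverse (real (Suc n)) \<le> (\<Sum>k<N n. d (q (y n k), v n k)) / real (N n)" for n
    proof -
      have "(\<Sum>k<N n. M - inverse (real (Suc n))) \<le> (\<Sum>k<N n. d (q (y n k), v n k))"
        by (rule sum_mono) (use gap in \<open>simp add: d_def del: of_nat_Suc\<close>)
      then show ?thesis using N[of n] by (simp add: field_simps del: of_nat_Suc)
    qed
    then show "\<exists>m. \<forall>n\<ge>m. M - inverse (real (Suc (r n))) \<le> (\<Sum>k<N (r n). d (q (y (r n) k), v (r n) k)) / real (N (r n))"
      by blast
  qed
  have intd: "integrable \<mu> d" by (rule int[OF cd])
  have d_AE: "AE z in \<mu>. M - d z = 0"
  proof -
    have nn: "AE z in \<mu>. 0 \<le> M - d z"
    proof (rule AE_I2)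
      fix z assume "z \<in> space \<mu>"
      then obtain x v where "z = (q x, v)" by (rule holonomic_space[OF hol])
      then show "0 \<le> M - d z" using M(2)[of x] by (simp add: d_def)
    qed
    have i: "integrable \<mu> (\<lambda>z. M - d z)" using intd by simp
    have "(\<integral>z. M - d z \<partial>\<mu>) = M - (\<integral>z. d z \<partial>\<mu>)" using intd by (simp add: prob_space)
    then have "(\<integral>z. M - d z \<partial>\<mu>) = 0" using d_ge integral_nonneg_AE[OF nn] by linarith
    then show ?thesis using integral_nonneg_eq_0_iff_AE[OF i nn] by simp
  qed
  have LL_AE: "AE z in \<mu>. Lu z - Lw z = 0"
  proof -
    \<comment> \<open>The sign is known only almost everywhere: \<open>u \<le> w\<close> may fail
      elsewhere, but \<open>w - u = M\<close> holds almost everywhere by the previous step. A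
      nonnegative integrand with nonpositive integral then vanishes.\<close>
    have nn: "AE z in \<mu>. 0 \<le> Lu z - Lw z"
      using d_AE AE_space
    proof eventually_elim
      case (elim z)
      obtain x v where z: "z = (q x, v)" by (rule holonomic_space[OF hol elim(2)])
      have "u (q x) \<le> w (q x)" using elim(1) M(1) by (simp add: z d_def)
      then show ?case using L_antimono[of "u (q x)" "w (q x)" x v] by (simp add: z Lu_def Lw_def lagrangian_eq_L)
    qed
    have i: "integrable \<mu> (\<lambda>z. Lu z - Lw z)" using intLu intLw by simp
    have "(\<integral>z. Lu z - Lw z \<partial>\<mu>) = 0" using LuLw integral_nonneg_AE[OF nn] by linarith
    then show ?thesis using integral_nonneg_eq_0_iff_AE[OF i nn] by simp
  qed
  have "(\<integral>z. Lu z \<partial>\<mu>) = (\<integral>z. Lw z \<partial>\<mu>)"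
    by (rule integral_cong_AE) (use LL_AE intLu intLw in \<open>auto intro: borel_measurable_integrable\<close>)
  then have Lw_le: "(\<integral>z. Lw z \<partial>\<mu>) \<le> - c" using Lu_le by simp
  have "AE z in \<mu>. (\<lambda>(X, v). lagrangian_du H (rescale \<epsilon> X) v (u X)) z = 0 \<and> (\<lambda>(X, v). lagrangian_du H (rescale \<epsilon> X) v (w X)) z = 0"
    using d_AE LL_AE AE_space
  proof eventually_elim
    case (elim z)
    obtain x v where z: "z = (q x, v)" by (rule holonomic_space[OF hol elim(3)])
    \<comment> \<open>Both endpoint lemmas require a nondegenerate interval; its length is
      \<open>M > 0\<close>.\<close>
    have l: "u (q x) < w (q x)" using elim(1) M(1) by (simp add: z d_def)
    have e: "L x v (u (q x)) = L x v (w (q x))" using elim(2) by (simp add: z Lu_def Lw_def lagrangian_eq_L)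
    show ?case
      using lagrangian_du_eqI[OF L_right_derivative_zero_left_endpoint[OF l e]]
        lagrangian_du_eqI[OF L_right_derivative_zero_right_endpoint[OF l e[symmetric]]] by (simp add: z)
  qed
  then have du: "AE z in \<mu>. (\<lambda>(X, v). lagrangian_du H (rescale \<epsilon> X) v (u X)) z = 0"
    and dw: "AE z in \<mu>. (\<lambda>(X, v). lagrangian_du H (rescale \<epsilon> X) v (w X)) z = 0" by auto
  have intuw: "integrable \<mu> (\<lambda>(X, v :: real ^ 'a). k X)" if "continuous_on UNIV (\<lambda>x. k (q x))" for k :: "_ \<Rightarrow> real"
  proof (rule int)
    have "continuous_on UNIV (\<lambda>z :: (real ^ 'a) \<times> (real ^ 'a). k (q (fst z)))"
      by (intro continuous_on_compose2[OF that] continuous_on_fst continuous_on_id) auto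
    then show "continuous_on UNIV (\<lambda>(x, w). (\<lambda>(X, v :: real ^ 'a). k X) (q x, w))" by (simp add: case_prod_beta)
  qed
  have "(\<integral>z. d z \<partial>\<mu>) = (\<integral>(X, v). w X \<partial>\<mu>) - (\<integral>(X, v). u X \<partial>\<mu>)"
    using Bochner_Integration.integral_diff[OF intuw[OF cw] intuw[OF cu]] by (simp add: d_def case_prod_beta)
  then have "(\<integral>(X, v). u X \<partial>\<mu>) < (\<integral>(X, v). w X \<partial>\<mu>)" using d_ge M(1) by simp
  moreover have "\<mu> \<in> ordinal_mather_measures \<epsilon> H u"
    by (rule ordinal_mather_measuresI[OF usub hol intLu[unfolded Lu_def] Lu_le[unfolded Lu_def] du])
  moreover have "\<mu> \<in> ordinal_mather_measures \<epsilon> H w"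
    by (rule ordinal_mather_measuresI[OF w hol intLw[unfolded Lw_def] Lw_le[unfolded Lw_def] dw])
  ultimately show ?thesis using that by blast
qed

end

end

section \<open>The effective Hamiltonian\<close>

lemma contact_hamiltonian_eps:
  fixes H :: "(real ^ 'n) set \<Rightarrow> real ^ 'n \<Rightarrow> real \<Rightarrow> real"
  assumes H_cont: "continuous_map (prod_topology (torus 1) (prod_topology euclidean euclideanreal))
                     euclideanreal (\<lambda>(X, p, \<theta>). H X p \<theta>)"
    and A1: "\<And>X \<theta>. X \<in> topspace (torus 1) \<Longrightarrow> convex_on UNIV (\<lambda>p. H X p \<theta>)"
    and A2: "\<And>X \<theta>. X \<in> topspace (torus 1) \<Longrightarrow>
               filterlim (\<lambda>p. H X p \<theta> / norm p) at_top at_infinity"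
    and A3_diff: "\<And>X p \<theta>. X \<in> topspace (torus 1) \<Longrightarrow> H X p field_differentiable (at \<theta>)"
    and A3_cont: "continuous_map (prod_topology (torus 1) (prod_topology euclidean euclideanreal))
                    euclideanreal (\<lambda>(X, p, \<theta>). deriv (H X p) \<theta>)"
    and A3_nonneg: "\<And>X p \<theta>. X \<in> topspace (torus 1) \<Longrightarrow> 0 \<le> deriv (H X p) \<theta>"
    and eps: "\<epsilon> > 0"
  shows "contact_hamiltonian \<epsilon> (eps_hamiltonian \<epsilon> H) (\<lambda>x p s. deriv (H (coset 1 (x /\<^sub>R \<epsilon>)) p) s)"
proof -
  have prod: "prod_topology (euclidean :: (real ^ 'n) topology) euclideanreal = euclidean"
    by simp
  have top: "coset 1 x \<in> topspace (torus 1)" for x :: "real ^ 'n" by (simp add: topspace_torus)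
  have F: "eps_hamiltonian \<epsilon> H (coset \<epsilon> x) p s = H (coset 1 (x /\<^sub>R \<epsilon>)) p s" for x p s
    by (simp add: eps_hamiltonian_def rescale_coset[OF eps])
  have scaled: "continuous_on UNIV (\<lambda>(x, p, s). k (coset 1 (x /\<^sub>R \<epsilon>)) p s)"
    if "continuous_map (prod_topology (torus 1) (prod_topology euclidean euclideanreal)) euclideanreal (\<lambda>(X, p, s). k X p s)"
    for k :: "(real ^ 'n) set \<Rightarrow> real ^ 'n \<Rightarrow> real \<Rightarrow> real"
  proof -
    have "continuous_on UNIV (\<lambda>(x :: real ^ 'n, z). (\<lambda>(X, p, s). k X p s) (coset 1 x, z))"
      using that unfolding prod continuous_map_torus_prod .
    from continuous_on_compose2[OF this, of UNIV "\<lambda>z :: (real ^ 'n) \<times> (real ^ 'n) \<times> real. (fst z /\<^sub>R \<epsilon>, snd z)"]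
    show ?thesis
      by (simp add: case_prod_beta continuous_on_Pair continuous_on_scaleR continuous_on_const continuous_on_fst continuous_on_snd continuous_on_id)
  qed
  have deriv: "(H (coset 1 (x /\<^sub>R \<epsilon>)) p has_real_derivative deriv (H (coset 1 (x /\<^sub>R \<epsilon>)) p) s) (at s)" for x p s
    using A3_diff[OF top] by (rule field_differentiable_derivI)
  show ?thesis
  proof
    show "\<epsilon> > 0" by (rule eps)
    show "continuous_on UNIV (\<lambda>(x, p, s). eps_hamiltonian \<epsilon> H (coset \<epsilon> x) p s)"
      unfolding F by (rule scaled[OF H_cont])
    show "convex_on UNIV (\<lambda>p. eps_hamiltonian \<epsilon> H (coset \<epsilon> x) p s)" for x s
      unfolding F by (rule A1[OF top])
    show "filterlim (\<lambda>p. eps_hamiltonian \<epsilon> H (coset \<epsilon> x) p s / norm p) at_top at_infinity" for x s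
      unfolding F by (rule A2[OF top])
    show "eps_hamiltonian \<epsilon> H (coset \<epsilon> x) p s \<le> eps_hamiltonian \<epsilon> H (coset \<epsilon> x) p t" if "s \<le> t" for x p s t
      unfolding F using that
      by (rule DERIV_nonneg_imp_nondecreasing) (use deriv A3_nonneg[OF top] in blast)
    show "((\<lambda>s. eps_hamiltonian \<epsilon> H (coset \<epsilon> x) p s) has_real_derivative deriv (H (coset 1 (x /\<^sub>R \<epsilon>)) p) s) (at s)" for x p s
      unfolding F by (rule deriv)
    show "continuous_on UNIV (\<lambda>(x, p, s). deriv (H (coset 1 (x /\<^sub>R \<epsilon>)) p) s)"
      by (rule scaled[OF A3_cont])
  qed
qed

lemma eps_hamiltonian_1: "eps_hamiltonian 1 H = H"
  by (simp add: eps_hamiltonian_def rescale_def)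

section \<open>Raising solutions, changing the Hamiltonian, and rescaling the torus\<close>

lemma visc_supersolution_mono:
  assumes "visc_supersolution \<epsilon> F c u" "\<And>x p. F (coset \<epsilon> x) p (u (coset \<epsilon> x)) \<le> F' (coset \<epsilon> x) p (u' (coset \<epsilon> x))"
    "\<And>x. u' (coset \<epsilon> x) = u (coset \<epsilon> x) + k"
  shows "visc_supersolution \<epsilon> F' c u'"
  unfolding visc_supersolution_def
proof (intro conjI allI impI)
  have "continuous_on UNIV (\<lambda>x. u (coset \<epsilon> x) + k)"
    by (intro continuous_on_add visc_supersolution_continuous[OF assms(1)] continuous_on_const)
  then show "continuous_map (torus \<epsilon>) euclideanreal u'" by (simp add: continuous_map_torus assms(3))
  fix \<phi> d\<phi> X U
  assume *: "torus_C1 \<epsilon> \<phi> d\<phi> \<and> openin (torus \<epsilon>) U \<and> X \<in> U \<and> (\<forall>Y\<in>U. u' X - \<phi> X \<le> u' Y - \<phi> Y)"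
  have U: "Y \<in> range (coset \<epsilon>)" if "Y \<in> U" for Y using * that openin_torus by blast
  obtain x where X: "X = coset \<epsilon> x" using U * by blast
  have "\<forall>Y\<in>U. u X - \<phi> X \<le> u Y - \<phi> Y"
  proof
    fix Y assume Y: "Y \<in> U"
    then obtain y where "Y = coset \<epsilon> y" using U by blast
    moreover have "u' X - \<phi> X \<le> u' Y - \<phi> Y" using * Y by blast
    ultimately show "u X - \<phi> X \<le> u Y - \<phi> Y" by (simp add: X assms(3))
  qed
  then have "c \<le> F X (d\<phi> X) (u X)" using assms(1) * unfolding visc_supersolution_def by blast
  also have "\<dots> \<le> F' X (d\<phi> X) (u' X)" using assms(2)[of x] by (simp add: X)
  finally show "c \<le> F' X (d\<phi> X) (u' X)" .
qed

lemma visc_subsolution_mono: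
  assumes "visc_subsolution \<epsilon> F c u" "\<And>x p. F' (coset \<epsilon> x) p (u' (coset \<epsilon> x)) \<le> F (coset \<epsilon> x) p (u (coset \<epsilon> x))"
    "\<And>x. u' (coset \<epsilon> x) = u (coset \<epsilon> x) + k"
  shows "visc_subsolution \<epsilon> F' c u'"
  unfolding visc_subsolution_def
proof (intro conjI allI impI)
  have "continuous_on UNIV (\<lambda>x. u (coset \<epsilon> x) + k)"
    by (intro continuous_on_add visc_subsolution_continuous[OF assms(1)] continuous_on_const)
  then show "continuous_map (torus \<epsilon>) euclideanreal u'" by (simp add: continuous_map_torus assms(3))
  fix \<phi> d\<phi> X U
  assume *: "torus_C1 \<epsilon> \<phi> d\<phi> \<and> openin (torus \<epsilon>) U \<and> X \<in> U \<and> (\<forall>Y\<in>U. u' Y - \<phi> Y \<le> u' X - \<phi> X)"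
  have U: "Y \<in> range (coset \<epsilon>)" if "Y \<in> U" for Y using * that openin_torus by blast
  obtain x where X: "X = coset \<epsilon> x" using U * by blast
  have "\<forall>Y\<in>U. u Y - \<phi> Y \<le> u X - \<phi> X"
  proof
    fix Y assume Y: "Y \<in> U"
    then obtain y where "Y = coset \<epsilon> y" using U by blast
    moreover have "u' Y - \<phi> Y \<le> u' X - \<phi> X" using * Y by blast
    ultimately show "u Y - \<phi> Y \<le> u X - \<phi> X" by (simp add: X assms(3))
  qed
  then have "F X (d\<phi> X) (u X) \<le> c" using assms(1) * unfolding visc_subsolution_def by blast
  then show "F' X (d\<phi> X) (u' X) \<le> c" using assms(2)[of x "d\<phi> X"] by (simp add: X)
qed

lemma torus_C1_rescale:
  fixes \<phi> :: "(real ^ 'n) set \<Rightarrow> real"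
  assumes "\<epsilon> > 0" "torus_C1 \<epsilon> \<phi> d\<phi>"
  obtains \<psi> d\<psi> where "torus_C1 1 \<psi> d\<psi>" "\<And>x. \<psi> (coset 1 x) = \<phi> (coset \<epsilon> (\<epsilon> *\<^sub>R x)) / \<epsilon>"
    "\<And>x. d\<psi> (coset 1 x) = d\<phi> (coset \<epsilon> (\<epsilon> *\<^sub>R x))"
proof -
  have shift: "coset \<epsilon> (\<epsilon> *\<^sub>R (x + 1 *\<^sub>R k)) = coset \<epsilon> (\<epsilon> *\<^sub>R x)" if "k \<in> lattice" for x k :: "real ^ 'n"
    using coset_shift[OF that, of \<epsilon> "\<epsilon> *\<^sub>R x"] by (simp add: scaleR_add_right)
  have "periodic 1 (\<lambda>x. \<phi> (coset \<epsilon> (\<epsilon> *\<^sub>R x)) / \<epsilon>)"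
    unfolding periodic_def by (intro ballI allI) (simp only: shift)
  moreover have "periodic 1 (\<lambda>x. d\<phi> (coset \<epsilon> (\<epsilon> *\<^sub>R x)))"
    unfolding periodic_def by (intro ballI allI) (simp only: shift)
  moreover have "GDERIV (\<lambda>x. \<phi> (coset \<epsilon> (\<epsilon> *\<^sub>R x)) / \<epsilon>) x :> d\<phi> (coset \<epsilon> (\<epsilon> *\<^sub>R x))" for x
  proof -
    have "((\<lambda>x :: real ^ 'n. \<epsilon> *\<^sub>R x) has_derivative (\<lambda>h. \<epsilon> *\<^sub>R h)) (at x)"
      by (auto intro!: derivative_eq_intros)
    moreover have "((\<lambda>y. \<phi> (coset \<epsilon> y)) has_derivative (\<lambda>h. h \<bullet> d\<phi> (coset \<epsilon> (\<epsilon> *\<^sub>R x)))) (at (\<epsilon> *\<^sub>R x))"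
      using assms(2) by (simp add: torus_C1_def gderiv_def)
    ultimately have "((\<lambda>x. \<phi> (coset \<epsilon> (\<epsilon> *\<^sub>R x))) has_derivative (\<lambda>h. \<epsilon> *\<^sub>R h \<bullet> d\<phi> (coset \<epsilon> (\<epsilon> *\<^sub>R x)))) (at x)"
      by (rule has_derivative_compose)
    then have "((\<lambda>x. \<phi> (coset \<epsilon> (\<epsilon> *\<^sub>R x)) * inverse \<epsilon>) has_derivative (\<lambda>h. (\<epsilon> *\<^sub>R h \<bullet> d\<phi> (coset \<epsilon> (\<epsilon> *\<^sub>R x))) * inverse \<epsilon>)) (at x)"
      by (rule has_derivative_mult_left)
    moreover have "(\<lambda>h. (\<epsilon> *\<^sub>R h \<bullet> d\<phi> (coset \<epsilon> (\<epsilon> *\<^sub>R x))) * inverse \<epsilon>) = (\<lambda>h. h \<bullet> d\<phi> (coset \<epsilon> (\<epsilon> *\<^sub>R x)))"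
      using assms(1) by (simp add: fun_eq_iff)
    ultimately show ?thesis by (simp only: gderiv_def divide_inverse)
  qed
  moreover have "continuous_on UNIV (\<lambda>x. d\<phi> (coset \<epsilon> (\<epsilon> *\<^sub>R x)))"
    by (rule continuous_on_compose2[OF torus_C1_continuous(2)[OF assms(2)]])
      (auto intro: continuous_on_scaleR continuous_on_const continuous_on_id)
  ultimately show ?thesis by (rule torus_C1_coset) (rule that)
qed

text \<open>The factor \<open>\<epsilon>\<close> in front compensates the inner division: the
  gradient of the rescaled function is that of \<open>v\<close> at \<open>x / \<epsilon>\<close>, so
  the level \<open>a\<close> is unchanged. Test functions travel the opposite way through
  \<open>torus_C1_rescale\<close>.\<close>

lemma visc_supersolution_rescale:
  assumes "\<epsilon> > 0" and v: "visc_supersolution 1 (\<lambda>X p s. G X p) a v"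
  shows "visc_supersolution \<epsilon> (\<lambda>X p s. G (rescale \<epsilon> X) p) a (\<lambda>X. \<epsilon> * v (rescale \<epsilon> X))"
  unfolding visc_supersolution_def
proof (intro conjI allI impI)
  have "continuous_on UNIV (\<lambda>x. v (coset 1 (x /\<^sub>R \<epsilon>)))"
    by (rule continuous_on_compose2[OF visc_supersolution_continuous[OF v]])
      (auto intro: continuous_on_scaleR continuous_on_const continuous_on_id)
  then show "continuous_map (torus \<epsilon>) euclideanreal (\<lambda>X. \<epsilon> * v (rescale \<epsilon> X))"
    by (simp add: continuous_map_torus rescale_coset[OF assms(1)] continuous_on_mult_left)
  fix \<phi> d\<phi> and X :: "(real ^ 'a) set" and U
  assume *: "torus_C1 \<epsilon> \<phi> d\<phi> \<and> openin (torus \<epsilon>) U \<and> X \<in> U \<and>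
    (\<forall>Y\<in>U. \<epsilon> * v (rescale \<epsilon> X) - \<phi> X \<le> \<epsilon> * v (rescale \<epsilon> Y) - \<phi> Y)"
  then obtain x where X: "X = coset \<epsilon> x" using openin_torus by blast
  obtain \<psi> d\<psi> where \<psi>: "torus_C1 1 \<psi> d\<psi>" "\<And>x. \<psi> (coset 1 x) = \<phi> (coset \<epsilon> (\<epsilon> *\<^sub>R x)) / \<epsilon>"
    "\<And>x. d\<psi> (coset 1 x) = d\<phi> (coset \<epsilon> (\<epsilon> *\<^sub>R x))"
    by (rule torus_C1_rescale[OF assms(1), of \<phi> d\<phi>]) (use * in blast)+
  define U' where "U' = coset 1 ` ((\<lambda>x. \<epsilon> *\<^sub>R x) -` (coset \<epsilon> -` U))"
  have "open (coset \<epsilon> -` U)" using * by (simp add: openin_torus)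
  then have "open ((\<lambda>x. \<epsilon> *\<^sub>R x) -` (coset \<epsilon> -` U))"
    by (intro open_vimage continuous_on_scaleR continuous_on_const continuous_on_id)
  then have "openin (torus 1) U'" unfolding U'_def by (rule openin_coset_image)
  moreover have "coset 1 (x /\<^sub>R \<epsilon>) \<in> U'"
    unfolding U'_def using * assms(1) by (intro imageI) (simp add: X)
  moreover have "\<forall>Y\<in>U'. v (coset 1 (x /\<^sub>R \<epsilon>)) - \<psi> (coset 1 (x /\<^sub>R \<epsilon>)) \<le> v Y - \<psi> Y"
  proof
    fix Y assume "Y \<in> U'"
    then obtain y where y: "Y = coset 1 y" "coset \<epsilon> (\<epsilon> *\<^sub>R y) \<in> U" by (auto simp: U'_def)
    have "\<epsilon> * v (rescale \<epsilon> X) - \<phi> X \<le> \<epsilon> * v (rescale \<epsilon> (coset \<epsilon> (\<epsilon> *\<^sub>R y))) - \<phi> (coset \<epsilon> (\<epsilon> *\<^sub>R y))"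
      using * y(2) by blast
    then have "\<epsilon> * v (coset 1 (x /\<^sub>R \<epsilon>)) - \<phi> X \<le> \<epsilon> * v (coset 1 y) - \<phi> (coset \<epsilon> (\<epsilon> *\<^sub>R y))"
      using assms(1) by (simp add: X rescale_coset)
    then have "(\<epsilon> * v (coset 1 (x /\<^sub>R \<epsilon>)) - \<phi> X) / \<epsilon> \<le> (\<epsilon> * v (coset 1 y) - \<phi> (coset \<epsilon> (\<epsilon> *\<^sub>R y))) / \<epsilon>"
      using assms(1) by (intro divide_right_mono) auto
    then show "v (coset 1 (x /\<^sub>R \<epsilon>)) - \<psi> (coset 1 (x /\<^sub>R \<epsilon>)) \<le> v Y - \<psi> Y"
      using assms(1) by (simp add: X y(1) \<psi>(2) diff_divide_distrib)
  qed
  ultimately have "a \<le> G (coset 1 (x /\<^sub>R \<epsilon>)) (d\<psi> (coset 1 (x /\<^sub>R \<epsilon>)))"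
    using v \<psi>(1) unfolding visc_supersolution_def by blast
  then show "a \<le> G (rescale \<epsilon> X) (d\<phi> X)" using assms(1) by (simp add: X rescale_coset \<psi>(3))
qed

context torus_hamiltonian
begin

lemma frozen: "torus_hamiltonian \<epsilon> (\<lambda>X p s. F X p \<theta>)"
proof
  show "continuous_on UNIV (\<lambda>(x, p, s :: real). F (q x) p \<theta>)"
    unfolding case_prod_beta
    by (intro continuous_on_F continuous_on_fst continuous_on_snd continuous_on_id continuous_on_const)
qed (use eps convex superlinear in auto)

text \<open>Adding a constant to a subsolution of an equation without zeroth-order term gives a
  subsolution, so the comparison principle excludes \<open>a < b\<close>.\<close>

lemma frozen_level_le:
  assumes u: "visc_subsolution \<epsilon> (\<lambda>X p s. F X p \<theta>) a u" and v: "visc_supersolution \<epsilon> (\<lambda>X p s. F X p \<theta>) b v"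
  shows "b \<le> a"
proof (rule ccontr)
  assume "\<not> ?thesis"
  then have ab: "a < b" by simp
  interpret frozen: torus_hamiltonian \<epsilon> "\<lambda>X p s. F X p \<theta>" by (rule frozen)
  define k where "k = v (q 0) - u (q 0) + 1"
  have "visc_subsolution \<epsilon> (\<lambda>X p s. F X p \<theta>) a (\<lambda>X. u X + k)"
    by (rule visc_subsolution_mono[OF u]) auto
  from frozen.visc_comparison[OF this v ab, of 0] show False by (simp add: k_def)
qed

lemma frozen_solution: "\<exists>a u. visc_solution \<epsilon> (\<lambda>X p s. F X p \<theta>) a u"
proof -
  have "continuous_on UNIV (\<lambda>z :: (real ^ 'n) \<times> (real ^ 'n). F (q (fst z)) (snd z) \<theta>)"
    by (intro continuous_on_F continuous_on_fst continuous_on_snd continuous_on_id continuous_on_const)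
  then have c: "continuous_on UNIV (\<lambda>(x, p). F (q x) p \<theta>)" by (simp add: case_prod_beta)
  have "\<exists>K. \<forall>x p. F (q x) p \<theta> \<le> A \<longrightarrow> norm p \<le> K" for A
  proof -
    obtain R where "\<And>x p s. \<bar>s\<bar> \<le> \<bar>\<theta>\<bar> \<Longrightarrow> F (q x) p s \<le> A \<Longrightarrow> norm p \<le> R"
      by (rule coercive[of "\<bar>\<theta>\<bar>" A]) blast
    then show ?thesis by blast
  qed
  from cell_solution[OF eps c this] show ?thesis by blast
qed

end

lemma effective_hamiltonian_eqI:
  assumes "torus_hamiltonian 1 H" "visc_solution 1 (\<lambda>X p s. H X p \<theta>) a u"
  shows "effective_hamiltonian H 0 \<theta> = a"
proof -
  interpret torus_hamiltonian 1 H by (rule assms)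
  have unique: "b = a" if "visc_solution 1 (\<lambda>X p s. H X p \<theta>) b v" for b v
  proof (rule order_antisym)
    show "b \<le> a" using that assms(2) unfolding visc_solution_def by (blast intro: frozen_level_le)
    show "a \<le> b" using that assms(2) unfolding visc_solution_def by (blast intro: frozen_level_le)
  qed
  show ?thesis
    unfolding effective_hamiltonian_def add_0
  proof (rule the_equality)
    show "\<exists>u. visc_solution 1 (\<lambda>X q _. H X q \<theta>) a u" by (intro exI[of _ u] assms(2))
    show "b = a" if "\<exists>u. visc_solution 1 (\<lambda>X q _. H X q \<theta>) b u" for b
      using that by (elim exE) (rule unique)
  qed
qed

lemma effective_hamiltonian_solution:
  assumes "torus_hamiltonian 1 H"
  obtains u where "visc_solution 1 (\<lambda>X p s. H X p \<theta>) (effective_hamiltonian H 0 \<theta>) u"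
proof -
  interpret torus_hamiltonian 1 H by (rule assms)
  obtain a u where "visc_solution 1 (\<lambda>X p s. H X p \<theta>) a u" using frozen_solution by blast
  then show ?thesis using effective_hamiltonian_eqI[OF assms] that by metis
qed

text \<open>The cell solution at \<open>\<theta>'\<close> is a subsolution of the cell problem at
  the smaller \<open>\<theta>\<close>, and a subsolution level is never below a supersolution
  level.\<close>

lemma effective_hamiltonian_mono:
  assumes "torus_hamiltonian 1 H" "\<theta> \<le> \<theta>'"
  shows "effective_hamiltonian H 0 \<theta> \<le> effective_hamiltonian H 0 \<theta>'"
proof -
  interpret torus_hamiltonian 1 H by (rule assms)
  obtain u where u: "visc_solution 1 (\<lambda>X p s. H X p \<theta>) (effective_hamiltonian H 0 \<theta>) u"
    by (rule effective_hamiltonian_solution[OF assms(1)])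
  obtain v where v: "visc_solution 1 (\<lambda>X p s. H X p \<theta>') (effective_hamiltonian H 0 \<theta>') v"
    by (rule effective_hamiltonian_solution[OF assms(1)])
  have "visc_subsolution 1 (\<lambda>X p s. H X p \<theta>) (effective_hamiltonian H 0 \<theta>') v"
    by (rule visc_subsolution_mono[of 1 "\<lambda>X p s. H X p \<theta>'" _ v _ _ 0])
      (use v mono[OF assms(2)] in \<open>auto simp: visc_solution_def\<close>)
  then show ?thesis using u unfolding visc_solution_def by (blast intro: frozen_level_le)
qed

lemma dominating_supersolution:
  fixes H :: "(real ^ 'n) set \<Rightarrow> real ^ 'n \<Rightarrow> real \<Rightarrow> real"
  assumes H1: "torus_hamiltonian 1 H" and H\<epsilon>: "torus_hamiltonian \<epsilon> (eps_hamiltonian \<epsilon> H)"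
    and c: "c \<in> range (\<lambda>\<theta>. effective_hamiltonian H 0 \<theta>)"
    and bdd: "bdd_above {\<theta>. effective_hamiltonian H 0 \<theta> = c}"
  obtains \<nu> where "visc_supersolution \<epsilon> (eps_hamiltonian \<epsilon> H) c \<nu>"
    "\<And>u x. visc_subsolution \<epsilon> (eps_hamiltonian \<epsilon> H) c u \<Longrightarrow> u (coset \<epsilon> x) \<le> \<nu> (coset \<epsilon> x)"
proof -
  interpret torus_hamiltonian \<epsilon> "eps_hamiltonian \<epsilon> H" by (rule H\<epsilon>)
  obtain \<theta>0 where \<theta>0: "effective_hamiltonian H 0 \<theta>0 = c" using c by blast
  obtain b where b: "\<And>\<theta>. effective_hamiltonian H 0 \<theta> = c \<Longrightarrow> \<theta> \<le> b" using bdd by (auto simp: bdd_above_def)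
  \<comment> \<open>Beyond every parameter of level \<open>c\<close>, so the level here differs from
    \<open>c\<close>. As \<open>c\<close> is attained at some \<open>\<theta>0 \<le> b\<close>,
    monotonicity leaves only a larger level.\<close>
  define \<theta> where "\<theta> = b + 1"
  define a where "a = effective_hamiltonian H 0 \<theta>"
  have "a \<noteq> c" using b[of \<theta>] by (auto simp: a_def \<theta>_def)
  moreover have "c \<le> a"
    unfolding a_def \<theta>0[symmetric] by (rule effective_hamiltonian_mono[OF H1]) (use b[OF \<theta>0] in \<open>simp add: \<theta>_def\<close>)
  ultimately have ca: "c < a" by simp
  obtain v where v: "visc_solution 1 (\<lambda>X p s. H X p \<theta>) a v"
    unfolding a_def by (rule effective_hamiltonian_solution[OF H1])
  then have "visc_supersolution 1 (\<lambda>X p s. H X p \<theta>) a v" by (simp add: visc_solution_def)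
  from visc_supersolution_rescale[OF eps this]
  have v\<epsilon>: "visc_supersolution \<epsilon> (\<lambda>X p s. eps_hamiltonian \<epsilon> H X p \<theta>) a (\<lambda>X. \<epsilon> * v (rescale \<epsilon> X))"
    by (simp add: eps_hamiltonian_def)
  obtain B where B: "B > 0" "\<And>x. norm (\<epsilon> * v (rescale \<epsilon> (q x))) \<le> B"
    by (rule periodic_bounded1[OF eps periodic_coset visc_supersolution_continuous[OF v\<epsilon>]]) blast
  define \<nu> where "\<nu> X = \<epsilon> * v (rescale \<epsilon> X) + (\<theta> + B)" for X
  have \<nu>a: "visc_supersolution \<epsilon> (eps_hamiltonian \<epsilon> H) a \<nu>"
  proof (rule visc_supersolution_mono[OF v\<epsilon>, of _ _ "\<theta> + B"])
    fix x p
    have "\<theta> \<le> \<nu> (q x)" using B(2)[of x] by (simp add: \<nu>_def abs_le_iff)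
    then show "eps_hamiltonian \<epsilon> H (q x) p \<theta> \<le> eps_hamiltonian \<epsilon> H (q x) p (\<nu> (q x))" by (rule mono)
  qed (simp add: \<nu>_def)
  then have "visc_supersolution \<epsilon> (eps_hamiltonian \<epsilon> H) c \<nu>"
    unfolding visc_supersolution_def using ca by (meson less_imp_le order_trans)
  \<comment> \<open>Comparison is applied at the higher level \<open>a\<close>, where
    \<open>\<nu>\<close> is a supersolution; the gap between \<open>c\<close> and \<open>a\<close>
    is what the doubling argument consumes.\<close>
  then show ?thesis using that visc_comparison[OF _ \<nu>a ca] by blast
qed

theorem proposition2p9:
  fixes H :: "(real ^ 'n) set \<Rightarrow> real ^ 'n \<Rightarrow> real \<Rightarrow> real"
    and \<epsilon> c :: real
  assumes H_cont: "continuous_map (prod_topology (torus 1) (prod_topology euclidean euclideanreal))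
                     euclideanreal (\<lambda>(X, p, \<theta>). H X p \<theta>)"
    and A1: "\<And>X \<theta>. X \<in> topspace (torus 1) \<Longrightarrow> convex_on UNIV (\<lambda>p. H X p \<theta>)"
    and A2: "\<And>X \<theta>. X \<in> topspace (torus 1) \<Longrightarrow>
               filterlim (\<lambda>p. H X p \<theta> / norm p) at_top at_infinity"
    and A3_diff: "\<And>X p \<theta>. X \<in> topspace (torus 1) \<Longrightarrow> H X p field_differentiable (at \<theta>)"
    and A3_cont: "continuous_map (prod_topology (torus 1) (prod_topology euclidean euclideanreal))
                    euclideanreal (\<lambda>(X, p, \<theta>). deriv (H X p) \<theta>)"
    and A3_nonneg: "\<And>X p \<theta>. X \<in> topspace (torus 1) \<Longrightarrow> 0 \<le> deriv (H X p) \<theta>"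
    and eps: "\<epsilon> > 0"
    and c: "c \<in> range (\<lambda>\<theta>. effective_hamiltonian H 0 \<theta>)"
  shows
    "(\<forall>u1 u2. visc_solution \<epsilon> (eps_hamiltonian \<epsilon> H) c u1 \<and> visc_subsolution \<epsilon> (eps_hamiltonian \<epsilon> H) c u2 \<and>
        (\<forall>\<mu> \<in> ordinal_mather_measures \<epsilon> H u1.
           (\<integral>(X, v). u1 X \<partial>\<mu>) \<ge> (\<integral>(X, v). u2 X \<partial>\<mu>)) \<longrightarrow>
        (\<forall>X \<in> topspace (torus \<epsilon>). u1 X \<ge> u2 X))
     \<and>
     (\<forall>u1. visc_solution \<epsilon> (eps_hamiltonian \<epsilon> H) c u1 \<and> ordinal_mather_measures \<epsilon> H u1 = {} \<longrightarrow>
        (\<forall>u. visc_solution \<epsilon> (eps_hamiltonian \<epsilon> H) c u \<longrightarrow> (\<forall>X \<in> topspace (torus \<epsilon>). u X = u1 X)))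
     \<and>
     (\<forall>u w. visc_solution \<epsilon> (eps_hamiltonian \<epsilon> H) c u \<and> visc_strict_subsolution \<epsilon> (eps_hamiltonian \<epsilon> H) c w \<longrightarrow>
        (\<forall>X \<in> topspace (torus \<epsilon>). w X \<le> u X))
     \<and>
     (bdd_above {\<theta>. effective_hamiltonian H 0 \<theta> = c} \<longrightarrow>
        (\<exists>\<nu>. visc_supersolution \<epsilon> (eps_hamiltonian \<epsilon> H) c \<nu> \<and>
             (\<forall>u. visc_solution \<epsilon> (eps_hamiltonian \<epsilon> H) c u \<longrightarrow> (\<forall>X \<in> topspace (torus \<epsilon>). u X \<le> \<nu> X))))"
proof -
  note hyps = H_cont A1 A2 A3_diff A3_cont A3_nonneg
  interpret contact_hamiltonian \<epsilon> "eps_hamiltonian \<epsilon> H" "\<lambda>x p s. deriv (H (coset 1 (x /\<^sub>R \<epsilon>)) p) s"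
    by (rule contact_hamiltonian_eps[OF hyps eps])
  interpret one: contact_hamiltonian 1 H "\<lambda>x p s. deriv (H (coset 1 (x /\<^sub>R 1)) p) s"
    by (rule contact_hamiltonian_eps[OF hyps zero_less_one, unfolded eps_hamiltonian_1])
  note contact = contact_measure[OF refl]
  have solD: "visc_subsolution \<epsilon> (eps_hamiltonian \<epsilon> H) c u" "visc_supersolution \<epsilon> (eps_hamiltonian \<epsilon> H) c u"
    if "visc_solution \<epsilon> (eps_hamiltonian \<epsilon> H) c u" for u using that by (auto simp: visc_solution_def)
  have 1: "\<forall>X \<in> topspace (torus \<epsilon>). u1 X \<ge> u2 X"
    if u1: "visc_solution \<epsilon> (eps_hamiltonian \<epsilon> H) c u1" and u2: "visc_subsolution \<epsilon> (eps_hamiltonian \<epsilon> H) c u2"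
      and \<mu>: "\<forall>\<mu> \<in> ordinal_mather_measures \<epsilon> H u1. (\<integral>(X, v). u1 X \<partial>\<mu>) \<ge> (\<integral>(X, v). u2 X \<partial>\<mu>)" for u1 u2
  proof (rule ccontr)
    assume "\<not> ?thesis"
    then obtain x where "u1 (q x) < u2 (q x)" by (auto simp: topspace_torus not_le)
    then obtain \<mu>' where "\<mu>' \<in> ordinal_mather_measures \<epsilon> H u1" "(\<integral>(X, v). u1 X \<partial>\<mu>') < (\<integral>(X, v). u2 X \<partial>\<mu>')"
      by (rule contact[OF u1 u2]) blast
    then show False using \<mu> by fastforce
  qed
  have 2: "\<forall>X \<in> topspace (torus \<epsilon>). u X = u1 X"
    if u1: "visc_solution \<epsilon> (eps_hamiltonian \<epsilon> H) c u1" and empty: "ordinal_mather_measures \<epsilon> H u1 = {}"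
      and u: "visc_solution \<epsilon> (eps_hamiltonian \<epsilon> H) c u" for u1 u
  proof (rule ccontr)
    assume "\<not> ?thesis"
    then obtain x where "u (q x) \<noteq> u1 (q x)" by (auto simp: topspace_torus)
    then consider "u1 (q x) < u (q x)" | "u (q x) < u1 (q x)" by linarith
    then show False
    proof cases
      case 1
      then show False by (rule contact[OF u1 solD(1)[OF u]]) (use empty in blast)
    next
      \<comment> \<open>Here \<open>u1\<close> is the upper function, so the contradiction uses that
        the contact measure is ordinal for the subsolution in
        \<open>contact_measure\<close>.\<close>
      case 2
      then show False by (rule contact[OF u solD(1)[OF u1]]) (use empty in blast)
    qed
  qed
  have 3: "\<forall>X \<in> topspace (torus \<epsilon>). w X \<le> u X"
    if u: "visc_solution \<epsilon> (eps_hamiltonian \<epsilon> H) c u" and w: "visc_strict_subsolution \<epsilon> (eps_hamiltonian \<epsilon> H) c w" for u w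
  proof -
    obtain \<delta> where \<delta>: "\<delta> > 0" "visc_subsolution \<epsilon> (eps_hamiltonian \<epsilon> H) (c - \<delta>) w"
      using w by (auto simp: visc_strict_subsolution_def)
    have "w (q x) \<le> u (q x)" for x by (rule visc_comparison[OF \<delta>(2) solD(2)[OF u]]) (use \<delta>(1) in simp)
    then show ?thesis by (auto simp: topspace_torus)
  qed
  have 4: "\<exists>\<nu>. visc_supersolution \<epsilon> (eps_hamiltonian \<epsilon> H) c \<nu> \<and>
       (\<forall>u. visc_solution \<epsilon> (eps_hamiltonian \<epsilon> H) c u \<longrightarrow> (\<forall>X \<in> topspace (torus \<epsilon>). u X \<le> \<nu> X))"
    if bdd: "bdd_above {\<theta>. effective_hamiltonian H 0 \<theta> = c}"
  proof -
    obtain \<nu> where "visc_supersolution \<epsilon> (eps_hamiltonian \<epsilon> H) c \<nu>"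
      "\<And>u x. visc_subsolution \<epsilon> (eps_hamiltonian \<epsilon> H) c u \<Longrightarrow> u (q x) \<le> \<nu> (q x)"
      by (rule dominating_supersolution[OF one.torus_hamiltonian_axioms torus_hamiltonian_axioms c bdd]) blast
    then show ?thesis using solD(1) by (auto simp: topspace_torus)
  qed
  show ?thesis
    by (intro conjI allI impI; (elim conjE)?; (rule 1 2 3 4; assumption))
qed

end
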